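(* Fix $\varepsilon\in(0,1)$. Let $\mathcal{F}_n$ be the fireproof forest resulting from the fire dynamics with firing rate $n^{-\alpha}$ on a uniform Cayley tree $\mathbf{t}_n$ on $[n]$. (i) If $\alpha>1/2$, the probability that there exists a tree-component with size greater than $(1-\varepsilon)n$ in $\mathcal{F}_n$ converges to $1$ as $n\to\infty$. (ii) If $\alpha=1/2$, the probability that there exists a tree-component with size greater than $\varepsilon n$ in $\mathcal{F}_n$ converges to $0$ as $n\to\infty$.
   Context: For $n\ge1$, $[n]=\{1,\dots,n\}$. A uniform Cayley tree $\mathbf{t}_n$ is a tree picked uniformly at random among the $n^{n-2}$ trees on the labeled vertex set $[n]$. Fire dynamics with firing rate $r>0$ on a finite tree: this is a continuous-time Markov process in which each edge is in one of three states: inflammable, fireproof, or burnt. Initially every edge is inflammable. The only transitions are from inflammable to fireproof or burnt. Each inflammable edge becomes fireproof at rate $1$, independently of the other edges. Each inflammable edge is also set on fire at rate $r$; when this happens, the fire propagates instantaneously through neighboring inflammable edges (edges sharing a vertex) and is stopped only at fireproof edges, so that all edges in the connected cluster of inflammable edges containing the edge set on fire become burnt. After a finite time all edges are either burnt or fireproof; this is the terminal state. Given the random tree $\mathbf{t}_n$, the dynamics are run on $\mathbf{t}_n$ with $r=n^{-\alpha}$. A vertex is called fireproof if all its adjacent edges are fireproof in the terminal state, and burnt otherwise. The fireproof forest $\mathcal{F}_n$ is the graph whose vertices are the fireproof vertices and whose edges are the fireproof edges with both end-points fireproof. Its tree-components are its connected components, and the size of a tree-component is its number of vertices. *)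

theory Defs
  imports "HOL-Probability.Probability"
begin

section \<open>Finite simple graphs given by their edge sets\<close>

type_synonym edge = "nat set"

definition adj :: "edge set \<Rightarrow> (nat \<times> nat) set" where
  "adj E = {(u, v). {u, v} \<in> E}"

definition simple_graph :: "nat set \<Rightarrow> edge set \<Rightarrow> bool" where
  "simple_graph V E \<longleftrightarrow> (\<forall>e\<in>E. e \<subseteq> V \<and> card e = 2)"

definition is_connected :: "nat set \<Rightarrow> edge set \<Rightarrow> bool" where
  "is_connected V E \<longleftrightarrow> (\<forall>u\<in>V. \<forall>v\<in>V. (u, v) \<in> (adj E)\<^sup>*)"

definition is_cycle :: "edge set \<Rightarrow> nat list \<Rightarrow> bool" where
  "is_cycle E vs \<longleftrightarrow> length vs \<ge> 3 \<and> distinct vs \<and>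
     (\<forall>i<length vs. {vs ! i, vs ! ((i + 1) mod length vs)} \<in> E)"

definition is_tree :: "nat set \<Rightarrow> edge set \<Rightarrow> bool" where
  "is_tree V E \<longleftrightarrow> simple_graph V E \<and> is_connected V E \<and> (\<nexists>vs. is_cycle E vs)"

definition cayley_trees :: "nat \<Rightarrow> edge set set" where
  "cayley_trees n = {T. is_tree {1..n} T}"

definition components :: "nat set \<Rightarrow> edge set \<Rightarrow> nat set set" where
  "components V E = {C. \<exists>v\<in>V. C = {u \<in> V. (v, u) \<in> (adj E)\<^sup>*}}"


section \<open>Continuous-time Markov chains on a finite state space\<close>

text \<open>Here \<open>q x y\<close> is the rate of the jump from \<open>x\<close> to \<open>y\<close>, for \<open>x \<noteq> y\<close>; the diagonal
  values of \<open>q\<close> are irrelevant.\<close>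

definition generator :: "'s set \<Rightarrow> ('s \<Rightarrow> 's \<Rightarrow> real) \<Rightarrow> 's \<Rightarrow> 's \<Rightarrow> real" where
  "generator S q x y = (if x = y then - (\<Sum>z\<in>S - {x}. q x z) else q x y)"

primrec kernel_pow :: "'s set \<Rightarrow> ('s \<Rightarrow> 's \<Rightarrow> real) \<Rightarrow> nat \<Rightarrow> 's \<Rightarrow> 's \<Rightarrow> real" where
  "kernel_pow S Q 0 x y = of_bool (x = y)"
| "kernel_pow S Q (Suc k) x y = (\<Sum>z\<in>S. kernel_pow S Q k x z * Q z y)"

text \<open>The transition function is the matrix exponential of \<open>t\<close> times the generator.\<close>

definition trans_prob :: "'s set \<Rightarrow> ('s \<Rightarrow> 's \<Rightarrow> real) \<Rightarrow> real \<Rightarrow> 's \<Rightarrow> 's \<Rightarrow> real" where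
  "trans_prob S q t x y = (\<Sum>k. t ^ k / fact k * kernel_pow S (generator S q) k x y)"

text \<open>Time is \<open>t \<ge> 0\<close>. The Markov property (with respect to the natural filtration) is written
  multiplicatively, so that histories of probability zero need no special treatment.
  Right-continuity refers to the discrete topology on states.\<close>

definition markov_chain ::
    "'w measure \<Rightarrow> 's set \<Rightarrow> ('s \<Rightarrow> 's \<Rightarrow> real) \<Rightarrow> (real \<Rightarrow> 'w \<Rightarrow> 's) \<Rightarrow> bool" where
  "markov_chain M S q X \<longleftrightarrow>
     prob_space M \<and> finite S \<and>
     (\<forall>t\<ge>0. X t \<in> measurable M (count_space S)) \<and>
     (\<forall>\<omega>\<in>space M. \<forall>t\<ge>0. \<forall>\<^sub>F u in at_right t. X u \<omega> = X t \<omega>) \<and>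
     (\<forall>(k::nat) (\<tau> :: nat \<Rightarrow> real) (x :: nat \<Rightarrow> 's).
        0 \<le> \<tau> 0 \<longrightarrow> (\<forall>i\<le>k. \<tau> i \<le> \<tau> (Suc i)) \<longrightarrow> (\<forall>i\<le>Suc k. x i \<in> S) \<longrightarrow>
        measure M {\<omega>\<in>space M. \<forall>i\<le>Suc k. X (\<tau> i) \<omega> = x i} =
        measure M {\<omega>\<in>space M. \<forall>i\<le>k. X (\<tau> i) \<omega> = x i} *
          trans_prob S q (\<tau> (Suc k) - \<tau> k) (x k) (x (Suc k)))"


section \<open>Fire dynamics\<close>

datatype estate = Inflammable | Fireproof | Burnt

text \<open>A configuration on \<open>T\<close> is an element of \<open>T \<rightarrow>\<^sub>E UNIV\<close>, i.e. it has the fixed value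
  \<open>undefined\<close> outside \<open>T\<close>.\<close>

type_synonym config = "edge \<Rightarrow> estate"

definition initial_config :: "edge set \<Rightarrow> config" where
  "initial_config T = (\<lambda>e\<in>T. Inflammable)"

definition inflammable_edges :: "edge set \<Rightarrow> config \<Rightarrow> edge set" where
  "inflammable_edges T s = {e \<in> T. s e = Inflammable}"

definition cluster :: "edge set \<Rightarrow> config \<Rightarrow> edge \<Rightarrow> edge set" where
  "cluster T s e = {f. (e, f) \<in>
     {(a, b). a \<in> inflammable_edges T s \<and> b \<in> inflammable_edges T s \<and> a \<inter> b \<noteq> {}}\<^sup>*}"

definition burn :: "edge set \<Rightarrow> edge \<Rightarrow> config \<Rightarrow> config" where
  "burn T e s = (\<lambda>f. if f \<in> cluster T s e then Burnt else s f)"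

text \<open>Setting any edge of a given cluster on fire leads to the same configuration, so the rates of
  the edges of the cluster add up.\<close>

definition fire_rate :: "edge set \<Rightarrow> real \<Rightarrow> config \<Rightarrow> config \<Rightarrow> real" where
  "fire_rate T r s s' =
     (\<Sum>e\<in>inflammable_edges T s. 1 * of_bool (s' = s(e := Fireproof))) +
     (\<Sum>e\<in>inflammable_edges T s. r * of_bool (s' = burn T e s))"

definition fire_dynamics ::
    "'w measure \<Rightarrow> edge set \<Rightarrow> real \<Rightarrow> (real \<Rightarrow> 'w \<Rightarrow> config) \<Rightarrow> bool" where
  "fire_dynamics M T r X \<longleftrightarrow>
     markov_chain M (T \<rightarrow>\<^sub>E UNIV) (fire_rate T r) X \<and>
     (AE \<omega> in M. X 0 \<omega> = initial_config T)"

text \<open>The event \<open>A\<close>, as a probability space in its own right under the conditional probability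
  given \<open>A\<close>.\<close>

definition cond_space :: "'w measure \<Rightarrow> 'w set \<Rightarrow> 'w measure" where
  "cond_space M A = uniform_measure (restrict_space M A) A"

text \<open>Here \<open>tr\<close> is the random tree; conditionally on \<open>tr = T\<close>, the process \<open>X\<close> is the fire
  dynamics on \<open>T\<close>.\<close>

definition cayley_fire_dynamics ::
    "nat \<Rightarrow> real \<Rightarrow> 'w measure \<Rightarrow> ('w \<Rightarrow> edge set) \<Rightarrow> (real \<Rightarrow> 'w \<Rightarrow> config) \<Rightarrow> bool" where
  "cayley_fire_dynamics n r M tr X \<longleftrightarrow>
     prob_space M \<and>
     tr \<in> measurable M (count_space (cayley_trees n)) \<and>
     distr M (count_space (cayley_trees n)) tr = uniform_count_measure (cayley_trees n) \<and>
     (\<forall>T\<in>cayley_trees n.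
        fire_dynamics (cond_space M {\<omega>\<in>space M. tr \<omega> = T}) T r X)"

text \<open>The terminal state exists almost surely.\<close>

definition terminal_config :: "(real \<Rightarrow> 'w \<Rightarrow> config) \<Rightarrow> 'w \<Rightarrow> config" where
  "terminal_config X \<omega> = (THE s. \<forall>\<^sub>F t in at_top. X t \<omega> = s)"


section \<open>The fireproof forest\<close>

definition fireproof_vertices :: "nat set \<Rightarrow> edge set \<Rightarrow> config \<Rightarrow> nat set" where
  "fireproof_vertices V T s = {v \<in> V. \<forall>e\<in>T. v \<in> e \<longrightarrow> s e = Fireproof}"

definition fireproof_forest_edges :: "nat set \<Rightarrow> edge set \<Rightarrow> config \<Rightarrow> edge set" where
  "fireproof_forest_edges V T s = {e \<in> T. s e = Fireproof \<and> e \<subseteq> fireproof_vertices V T s}"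

definition forest_components :: "nat set \<Rightarrow> edge set \<Rightarrow> config \<Rightarrow> nat set set" where
  "forest_components V T s =
     components (fireproof_vertices V T s) (fireproof_forest_edges V T s)"

end

theory Submission
  imports Defs
begin

text \<open>Let \<open>R\<close> be the path between two vertices of the tree. For an edge \<open>e\<close>, let \<open>d(e)\<close> be the number
  of edges of the path from \<open>e\<close> (included) to \<open>R\<close>, and for a configuration that has no burnt edge at
  \<open>R\<close> let \<open>A\<close> be the sum of \<open>1/d(e)\<close> over the edges \<open>e\<close> from which a fire would reach \<open>R\<close>.
  Fires reach \<open>R\<close> at rate \<open>r C\<close>, where \<open>C\<close> is the number of these edges, and fireproofing decreases
  \<open>A\<close> at rate \<open>C\<close>. It follows that \<open>r A\<close> (extended by \<open>1\<close> after a fire has reached \<open>R\<close>) and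
  \<open>1/(1 + r A)\<close> (extended by \<open>0\<close>) are superharmonic, so that a fire reaches \<open>R\<close> with probability
  at most \<open>r A\<^sub>0\<close>, and no fire does with probability at most \<open>1/(1 + r A\<^sub>0)\<close>, where
  \<open>A\<^sub>0\<close> is the initial value of \<open>A\<close>.

  For two uniform vertices of a Cayley tree, \<open>R\<close> has about \<open>sqrt n\<close> vertices, and the number of
  vertices at any fixed distance from \<open>R\<close> is close to the size of \<open>R\<close>. Hence
  \<open>A\<^sub>0\<close> is at most of order \<open>sqrt n ln n\<close>, but exceeds every multiple of \<open>sqrt n\<close> with high probability.
  If \<open>\<alpha> > 1/2\<close>, two uniform vertices thus lie in the same component of the fireproof forest
  with probability tending to \<open>1\<close>, and if \<open>\<alpha> = 1/2\<close>, with probability tending to \<open>0\<close>. The two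
  claims follow, because a component of size \<open>c n\<close> contains a fraction \<open>c\<^sup>2\<close> of all pairs, and if no
  component is larger than \<open>c n\<close> then at most a fraction \<open>c\<close> of all pairs are connected.\<close>

section \<open>Counting forests with a given set of roots\<close>

text \<open>The weight \<open>1/d(e)\<close> makes the two rates proportional. An edge counted in
  \<open>A\<close> drops out as soon as one of the \<open>d(e)\<close> edges leading to
  \<open>R\<close> becomes fireproof, which costs \<open>1/d(e)\<close> at rate \<open>d(e)\<close>:
  one unit per counted edge, whereas fires start there at rate \<open>r\<close>. A fire that misses
  \<open>R\<close> cannot have met any chain of inflammable edges leading to \<open>R\<close>, so it
  leaves the counted set unchanged. Superharmonicity thus holds on every tree, and the random shape
  enters only through the initial value. Given the path, the rest of the tree is a uniform forest
  rooted at it. Cutting this forest at the children of its roots gives a recursion for the moments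
  of the generation sizes. At \<open>\<alpha> = 1/2\<close> the gain is only logarithmic. A fixed
  number \<open>D\<close> of generations contributes about \<open>harm D\<close> times the path
  length, with an error that is exponential in \<open>D\<close> but vanishes as \<open>n\<close>
  grows. Since \<open>D\<close> is fixed before \<open>n\<close>, crude constants suffice. Pairs of
  vertices are averaged inside the superharmonic function: the sum over all pairs is again
  superharmonic.\<close>

definition level :: "('a \<Rightarrow> 'a) \<Rightarrow> 'a set \<Rightarrow> 'a \<Rightarrow> nat" where
  "level f R v = (LEAST i. (f ^^ i) v \<in> R)"

text \<open>A forest on \<open>R \<union> S\<close> with root set \<open>R\<close> is encoded by its parent function on \<open>S\<close>.\<close>

definition forests :: "'a set \<Rightarrow> 'a set \<Rightarrow> ('a \<Rightarrow> 'a) set" where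
  "forests R S = {f \<in> S \<rightarrow>\<^sub>E (R \<union> S). \<forall>v\<in>S. \<exists>i. (f ^^ i) v \<in> R}"

definition generation_size :: "'a set \<Rightarrow> 'a set \<Rightarrow> ('a \<Rightarrow> 'a) \<Rightarrow> nat \<Rightarrow> nat" where
  "generation_size R S f d = card {v \<in> R \<union> S. level f R v = d}"

lemma level_root: "v \<in> R \<Longrightarrow> level f R v = 0"
  unfolding level_def by (rule Least_equality) auto

lemma level_Suc:
  assumes "v \<notin> R" and "\<exists>i. (f ^^ i) v \<in> R"
  shows "level f R v = Suc (level f R (f v))"
proof -
  from assms(2) obtain i where i: "(f ^^ i) v \<in> R" by blast
  have "(LEAST i. (f ^^ i) v \<in> R) = Suc (LEAST i. (f ^^ Suc i) v \<in> R)"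
    using i assms(1) by (intro Least_Suc) auto
  then show ?thesis
    unfolding level_def by (simp only: funpow_Suc_right o_apply)
qed

text \<open>A labelling that vanishes on \<open>R\<close> and drops by one along \<open>f\<close>
  leads the iteration into \<open>R\<close> after exactly that many steps. Exhibiting one therefore
  both shows that a parent function is a forest and computes its levels.\<close>

lemma level_unique:
  assumes R: "\<And>v. v \<in> R \<Longrightarrow> L v = 0"
    and S: "\<And>v. v \<in> S \<Longrightarrow> f v \<in> R \<union> S \<and> L v = Suc (L (f v))"
    and "v \<in> R \<union> S"
  shows "(f ^^ L v) v \<in> R \<and> level f R v = L v"
  using assms(3)
proof (induction "L v" arbitrary: v)
  case 0
  then have "v \<in> R" using S[of v] by auto
  then show ?case using 0 by (simp add: level_root)
next
  case (Suc k)
  have vR: "v \<notin> R" using R[of v] Suc(2) by auto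
  with Suc(3) have vS: "v \<in> S" by auto
  have Lf: "L (f v) = k" using S[OF vS] Suc(2) by simp
  have IH: "(f ^^ k) (f v) \<in> R" "level f R (f v) = k"
    using Suc(1)[of "f v"] S[OF vS] Lf by auto
  then have *: "(f ^^ L v) v \<in> R"
    unfolding Suc(2)[symmetric] by (simp add: funpow_swap1)
  moreover have "level f R v = Suc (level f R (f v))"
    by (rule level_Suc[OF vR]) (use * in blast)
  ultimately show ?case using IH(2) Suc(2) by simp
qed

lemma forests_levelD:
  assumes "f \<in> forests R S" and "R \<inter> S = {}" and "v \<in> S"
  shows "f v \<in> R \<union> S" and "level f R v = Suc (level f R (f v))"
proof -
  show "f v \<in> R \<union> S" using assms unfolding forests_def by auto
  show "level f R v = Suc (level f R (f v))"
    by (rule level_Suc) (use assms in \<open>auto simp: forests_def\<close>)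
qed

lemma forestsI:
  assumes "f \<in> S \<rightarrow>\<^sub>E (R \<union> S)" and "\<And>v. v \<in> R \<Longrightarrow> L v = 0"
    and "\<And>v. v \<in> S \<Longrightarrow> L v = Suc (L (f v))"
  shows "f \<in> forests R S"
proof -
  have "(f ^^ L v) v \<in> R" if "v \<in> S" for v
    using level_unique[of R L S f v] assms that by auto
  with assms(1) show ?thesis unfolding forests_def by auto
qed

lemma finite_forests: "finite R \<Longrightarrow> finite S \<Longrightarrow> finite (forests R S)"
  unfolding forests_def by (rule finite_subset[of _ "S \<rightarrow>\<^sub>E (R \<union> S)"]) (auto intro: finite_PiE)

lemma forests_empty: "forests R {} = {\<lambda>_. undefined}"
  unfolding forests_def by auto

lemma forests_no_roots: "S \<noteq> {} \<Longrightarrow> forests {} S = {}"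
  unfolding forests_def by auto

abbreviation glue :: "'a set \<Rightarrow> ('a \<Rightarrow> 'a) \<Rightarrow> ('a \<Rightarrow> 'a) \<Rightarrow> 'a \<Rightarrow> 'a" where
  "glue K g h \<equiv> \<lambda>v. if v \<in> K then g v else h v"

text \<open>A forest is cut at the set \<open>K\<close> of children of the roots: \<open>g\<close>
  records the root to which each child is attached, and \<open>h\<close> is the forest that remains
  when the children become the roots.\<close>

lemma glue_forest:
  assumes RS: "R \<inter> S = {}" and K: "K \<subseteq> S" and g: "g \<in> K \<rightarrow>\<^sub>E R" and h: "h \<in> forests K (S - K)"
  shows "glue K g h \<in> forests R S"
    and "v \<in> S \<Longrightarrow> level (glue K g h) R v = Suc (level h K v)"
    and "{v \<in> S. glue K g h v \<in> R} = K"
proof -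
  define L where "L v = (if v \<in> R then 0 else Suc (level h K v))" for v
  have hv: "h v \<in> S" "level h K v = Suc (level h K (h v))" if "v \<in> S" "v \<notin> K" for v
    using forests_levelD[OF h, of v] that K by auto
  have gl: "glue K g h v \<in> R \<union> S" if "v \<in> S" for v
    using that hv[of v] g by (auto simp: PiE_def)
  have ext: "glue K g h \<in> S \<rightarrow>\<^sub>E (R \<union> S)"
    using gl h K unfolding forests_def by (auto simp: PiE_def extensional_def)
  have L0: "L v = 0" if "v \<in> R" for v using that by (simp add: L_def)
  have L1: "L v = Suc (L (glue K g h v))" if "v \<in> S" for v
  proof (cases "v \<in> K")
    case True
    then have "g v \<in> R" using g by auto
    moreover have "v \<notin> R" using that RS by auto
    ultimately show ?thesis using True by (simp add: L_def level_root)
  next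
    case False
    then show ?thesis using hv[OF that False] that RS by (auto simp: L_def)
  qed
  show "glue K g h \<in> forests R S" using ext L0 L1 by (rule forestsI)
  show "level (glue K g h) R v = Suc (level h K v)" if "v \<in> S"
  proof -
    have "level (glue K g h) R v = L v"
      using level_unique[of R L S "glue K g h" v] L0 L1 gl that by blast
    moreover have "v \<notin> R" using that RS by auto
    ultimately show ?thesis by (simp add: L_def)
  qed
  show "{v \<in> S. glue K g h v \<in> R} = K"
    using K g hv(1) RS by (auto simp: PiE_def split: if_splits)
qed

text \<open>The cut at the children is a bijection; its inverse restricts the parent function to the
  preimage of \<open>R\<close> and to the complement. If \<open>K\<close> is empty and
  \<open>S\<close> is not, there is no forest \<open>h\<close> and the term vanishes.\<close>

lemma sum_forests:
  fixes \<phi> :: "('a \<Rightarrow> 'a) \<Rightarrow> 'b::comm_monoid_add"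
  assumes fin: "finite R" "finite S" and RS: "R \<inter> S = {}"
  shows "(\<Sum>f\<in>forests R S. \<phi> f) =
    (\<Sum>K\<in>Pow S. \<Sum>g\<in>K \<rightarrow>\<^sub>E R. \<Sum>h\<in>forests K (S - K). \<phi> (glue K g h))"
proof -
  have finK: "finite K" if "K \<in> Pow S" for K using that fin finite_subset by auto
  let ?D = "SIGMA K:Pow S. SIGMA g:K \<rightarrow>\<^sub>E R. forests K (S - K)"
  let ?K = "\<lambda>f. {v \<in> S. f v \<in> R}"
  have "(\<Sum>K\<in>Pow S. \<Sum>g\<in>K \<rightarrow>\<^sub>E R. \<Sum>h\<in>forests K (S - K). \<phi> (glue K g h))
     = (\<Sum>K\<in>Pow S. \<Sum>(g,h)\<in>(SIGMA g:K \<rightarrow>\<^sub>E R. forests K (S - K)). \<phi> (glue K g h))"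
    by (intro sum.cong refl sum.Sigma) (auto intro!: finite_PiE finite_forests finK fin)
  also have "\<dots> = (\<Sum>(K,g,h)\<in>?D. \<phi> (glue K g h))"
    by (subst sum.Sigma)
      (auto intro!: finite_SigmaI finite_PiE finite_forests finK fin simp: split_def)
  also have "\<dots> = (\<Sum>f\<in>forests R S. \<phi> f)"
  proof (rule sum.reindex_bij_witness[where
        i = "\<lambda>f. (?K f, restrict f (?K f), restrict f (S - ?K f))"
        and j = "\<lambda>(K, g, h). glue K g h"])
    fix x assume "x \<in> ?D"
    then obtain K g h where x: "x = (K, g, h)" "K \<subseteq> S" "g \<in> K \<rightarrow>\<^sub>E R" "h \<in> forests K (S - K)"
      by auto
    note gf = glue_forest[OF RS x(2-4)]
    have "restrict (glue K g h) K = g"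
      using x(3) by (auto simp: PiE_def extensional_def fun_eq_iff)
    moreover have "restrict (glue K g h) (S - K) = h"
      using x(4) by (auto simp: PiE_def extensional_def fun_eq_iff forests_def)
    ultimately show "(\<lambda>f. (?K f, restrict f (?K f), restrict f (S - ?K f)))
        ((\<lambda>(K, g, h). glue K g h) x) = x"
      unfolding x(1) prod.case gf(3) by simp
    show "(case x of (K, g, h) \<Rightarrow> glue K g h) \<in> forests R S"
      using gf(1) x(1) by simp
    show "\<phi> (case x of (K, g, h) \<Rightarrow> glue K g h) = (case x of (K, g, h) \<Rightarrow> \<phi> (glue K g h))"
      using x(1) by simp
  next
    fix f assume f: "f \<in> forests R S"
    note fl = forests_levelD[OF f RS]
    have ext: "f \<in> extensional S" using f by (auto simp: forests_def PiE_def)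
    \<comment> \<open>Levels relative to the new roots are the old ones minus one; nothing is
      truncated, as vertices of \<open>S\<close> have level at least one.\<close>
    have "restrict f (S - ?K f) \<in> forests (?K f) (S - ?K f)"
    proof (rule forestsI[where L = "\<lambda>v. level f R v - 1"])
      show "restrict f (S - ?K f) \<in> S - ?K f \<rightarrow>\<^sub>E ?K f \<union> (S - ?K f)"
        using fl(1) by auto
      show "level f R v - 1 = 0" if "v \<in> ?K f" for v
        using fl(2)[of v] that by (simp add: level_root)
      show "level f R v - 1 = Suc (level f R (restrict f (S - ?K f) v) - 1)" if "v \<in> S - ?K f" for v
        using fl(2)[of v] fl(2)[of "f v"] fl(1)[of v] that by auto
    qed
    moreover have "restrict f (?K f) \<in> ?K f \<rightarrow>\<^sub>E R" by auto
    ultimately show "(?K f, restrict f (?K f), restrict f (S - ?K f)) \<in> ?D" by auto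
    show "(case (?K f, restrict f (?K f), restrict f (S - ?K f)) of (K, g, h) \<Rightarrow> glue K g h) = f"
      using ext by (auto simp: fun_eq_iff extensional_def)
  qed
  finally show ?thesis ..
qed

lemma generation_size_glue:
  assumes RS: "R \<inter> S = {}" and K: "K \<subseteq> S" and g: "g \<in> K \<rightarrow>\<^sub>E R" and h: "h \<in> forests K (S - K)"
  shows "generation_size R S (glue K g h) (Suc d) = generation_size K (S - K) h d"
proof -
  note gf = glue_forest[OF RS K g h]
  have "{v \<in> R \<union> S. level (glue K g h) R v = Suc d} = {v \<in> K \<union> (S - K). level h K v = d}"
    using K gf(2) by (auto simp: level_root)
  then show ?thesis unfolding generation_size_def by simp
qed

section \<open>Binomial moments and the number of forests\<close>

lemma sum_Pow_card:
  fixes \<phi> :: "nat \<Rightarrow> real"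
  assumes "finite S"
  shows "(\<Sum>K\<in>Pow S. \<phi> (card K)) = (\<Sum>k\<le>card S. real (card S choose k) * \<phi> k)"
proof -
  have "(\<Sum>K\<in>Pow S. \<phi> (card K)) = (\<Sum>k\<le>card S. \<Sum>K\<in>{K \<in> Pow S. card K = k}. \<phi> (card K))"
    using assms by (intro sum.group[symmetric]) (auto intro: card_mono)
  also have "\<dots> = (\<Sum>k\<le>card S. real (card S choose k) * \<phi> k)"
    using n_subsets[OF assms] by (intro sum.cong) auto
  finally show ?thesis .
qed

text \<open>For nonnegative \<open>a\<close> and \<open>b\<close>, not both zero, this is
  \<open>(a + b) ^ M\<close> times the mean of \<phi> under the binomial law with parameters
  \<open>M\<close> and \<open>a / (a + b)\<close>.\<close>

definition binomial_sum :: "nat \<Rightarrow> real \<Rightarrow> real \<Rightarrow> (nat \<Rightarrow> real) \<Rightarrow> real" where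
  "binomial_sum M a b \<phi> = (\<Sum>k\<le>M. real (M choose k) * a ^ k * b ^ (M - k) * \<phi> k)"

text \<open>Absorption identity for binomial coefficients: size-biasing shifts the argument by
  one.\<close>

lemma binomial_sum_Suc:
  "binomial_sum (Suc M) a b (\<lambda>k. real k * \<phi> k) = real (Suc M) * a * binomial_sum M a b (\<lambda>k. \<phi> (Suc k))"
proof -
  have "binomial_sum (Suc M) a b (\<lambda>k. real k * \<phi> k) =
     (\<Sum>k\<le>M. real (Suc M choose Suc k) * a ^ Suc k * b ^ (Suc M - Suc k) * (real (Suc k) * \<phi> (Suc k)))"
    unfolding binomial_sum_def by (subst sum.atMost_Suc_shift) simp
  also have "\<dots> = (\<Sum>k\<le>M. real (Suc M) * a * (real (M choose k) * a ^ k * b ^ (M - k) * \<phi> (Suc k)))"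
  proof (rule sum.cong[OF refl])
    fix k
    have "real (Suc k) * real (Suc M choose Suc k) = real (Suc M) * real (M choose k)"
      using Suc_times_binomial[of k M] by (metis of_nat_mult)
    then show "real (Suc M choose Suc k) * a ^ Suc k * b ^ (Suc M - Suc k) * (real (Suc k) * \<phi> (Suc k))
       = real (Suc M) * a * (real (M choose k) * a ^ k * b ^ (M - k) * \<phi> (Suc k))"
      by (simp add: algebra_simps del: of_nat_Suc binomial_Suc_Suc)
  qed
  also have "\<dots> = real (Suc M) * a * binomial_sum M a b (\<lambda>k. \<phi> (Suc k))"
    unfolding binomial_sum_def by (simp add: sum_distrib_left)
  finally show ?thesis .
qed

lemma binomial_sum_1: "binomial_sum M a b (\<lambda>k. 1) = (a + b) ^ M"
  unfolding binomial_sum_def by (simp add: binomial_ring)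

lemma binomial_sum_id:
  "(a + b) * binomial_sum M a b real = real M * a * (a + b) ^ M"
proof (cases M)
  case (Suc K)
  have "binomial_sum M a b real = real M * a * (a + b) ^ K"
    using binomial_sum_Suc[of K a b "\<lambda>k. 1"] by (simp add: Suc binomial_sum_1)
  then show ?thesis by (simp add: Suc)
qed (simp add: binomial_sum_def)

lemma binomial_sum_falling:
  "(a + b)\<^sup>2 * binomial_sum M a b (\<lambda>k. real k * (real k - 1)) = real M * (real M - 1) * a\<^sup>2 * (a + b) ^ M"
proof (cases M)
  case (Suc K)
  have "binomial_sum M a b (\<lambda>k. real k * (real k - 1)) = real M * a * binomial_sum K a b real"
    using binomial_sum_Suc[of K a b "\<lambda>k. real k - 1"] by (simp add: Suc)
  then have "(a + b)\<^sup>2 * binomial_sum M a b (\<lambda>k. real k * (real k - 1))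
      = real M * a * (a + b) * ((a + b) * binomial_sum K a b real)"
    by (simp add: power2_eq_square)
  also have "\<dots> = real M * (real M - 1) * a\<^sup>2 * (a + b) ^ M"
    unfolding binomial_sum_id by (simp add: Suc power2_eq_square algebra_simps)
  finally show ?thesis .
qed (simp add: binomial_sum_def)

text \<open>Moments of one plus a binomial variable, from the factorial moments and
  \<open>(k + 1)\<^sup>2 = k * (k - 1) + 3 * k + 1\<close>.\<close>

lemma binomial_sum_quadratic:
  fixes a b c0 c1 c2 :: real
  assumes "a + b > 0"
  shows "binomial_sum M a b (\<lambda>k. c0 + c1 * real (Suc k) + c2 * (real (Suc k))\<^sup>2) =
    (c0 + c1 * (1 + real M * a / (a + b))
      + c2 * (1 + 3 * real M * a / (a + b) + real M * (real M - 1) * a\<^sup>2 / (a + b)\<^sup>2)) * (a + b) ^ M"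
proof -
  define P X Z where "P = (a + b) ^ M" and "X = real M * a / (a + b)"
    and "Z = real M * (real M - 1) * a\<^sup>2 / (a + b)\<^sup>2"
  have "binomial_sum M a b (\<lambda>k. c0 + c1 * real (Suc k) + c2 * (real (Suc k))\<^sup>2)
     = binomial_sum M a b (\<lambda>k. (c0 + c1 + c2) * 1 + (c1 + 3 * c2) * real k + c2 * (real k * (real k - 1)))"
    by (simp add: algebra_simps power2_eq_square)
  also have "\<dots> = (c0 + c1 + c2) * binomial_sum M a b (\<lambda>k. 1) + (c1 + 3 * c2) * binomial_sum M a b real
      + c2 * binomial_sum M a b (\<lambda>k. real k * (real k - 1))"
    unfolding binomial_sum_def sum_distrib_left sum.distrib[symmetric]
    by (intro sum.cong refl) (simp add: algebra_simps)
  also have "\<dots> = (c0 + c1 + c2) * P + (c1 + 3 * c2) * (X * P) + c2 * (Z * P)"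
  proof -
    have "binomial_sum M a b real = X * P"
      using binomial_sum_id[of a b M] assms by (simp add: X_def P_def nonzero_eq_divide_eq mult_ac)
    moreover have "binomial_sum M a b (\<lambda>k. real k * (real k - 1)) = Z * P"
      using binomial_sum_falling[of a b M] assms by (simp add: Z_def P_def nonzero_eq_divide_eq mult_ac)
    ultimately show ?thesis unfolding binomial_sum_1 P_def by simp
  qed
  also have "\<dots> = (c0 + c1 * (1 + X) + c2 * (1 + 3 * X + Z)) * P"
    by (simp add: algebra_simps)
  finally show ?thesis by (simp add: P_def X_def Z_def mult.assoc)
qed

text \<open>The classical count \<open>card R * n ^ (card S - 1)\<close> for \<open>n\<close>
  vertices, multiplied by \<open>n\<close> so that an empty \<open>S\<close> is no exception. After
  the cut at the children, the induction hypothesis contributes a factor \<open>card K\<close>;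
  size-biasing absorbs it and the binomial theorem sums the rest.\<close>

lemma card_forests:
  assumes "finite R" "finite S" "R \<inter> S = {}"
  shows "card (forests R S) * (card R + card S) = card R * (card R + card S) ^ card S"
  using assms
proof (induction "card S" arbitrary: R S rule: less_induct)
  case less
  show ?case
  proof (cases "S = {}")
    case True
    then show ?thesis by (simp add: forests_empty)
  next
    case False
    define N where "N = card S"
    have "N \<noteq> 0" using False less.prems N_def by simp
    then obtain M where M: "N = Suc M" using not0_implies_Suc by blast
    have sub: "real (card (forests K (S - K))) * N = real (card K) * real N ^ (N - card K)"
      if "K \<in> Pow S" for K
    proof (cases "K = {}")
      case True
      then show ?thesis using False by (simp add: forests_no_roots)
    next
      case K: False
      have fK: "finite K" using that less.prems finite_subset by auto
      have cK: "card (S - K) = N - card K" "card K \<le> N" "card K > 0"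
        using that fK K less.prems by (auto simp: N_def card_Diff_subset card_mono card_gt_0_iff)
      have "card (forests K (S - K)) * (card K + card (S - K)) = card K * (card K + card (S - K)) ^ card (S - K)"
        by (rule less.hyps) (use cK fK less.prems N_def in auto)
      then have "card (forests K (S - K)) * N = card K * N ^ (N - card K)" using cK by simp
      then show ?thesis by (metis of_nat_mult of_nat_power)
    qed
    have "real (card (forests R S)) * N =
        (\<Sum>K\<in>Pow S. \<Sum>g\<in>K \<rightarrow>\<^sub>E R. \<Sum>h\<in>forests K (S - K). 1) * real N"
      using sum_forests[of R S "\<lambda>_. 1::real"] less.prems by simp
    also have "\<dots> = (\<Sum>K\<in>Pow S. real (card R) ^ card K * (real (card K) * real N ^ (N - card K)))"
    proof (subst sum_distrib_right, rule sum.cong[OF refl])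
      fix K assume K: "K \<in> Pow S"
      then have "finite K" using less.prems finite_subset by auto
      then show "(\<Sum>g\<in>K \<rightarrow>\<^sub>E R. \<Sum>h\<in>forests K (S - K). 1) * real N
          = real (card R) ^ card K * (real (card K) * real N ^ (N - card K))"
        using sub[OF K] by (simp add: card_PiE mult.assoc)
    qed
    also have "\<dots> = (\<Sum>k\<le>N. real (N choose k) * (real (card R) ^ k * (real k * real N ^ (N - k))))"
      unfolding N_def by (rule sum_Pow_card) (use less.prems in auto)
    also have "\<dots> = binomial_sum N (card R) N (\<lambda>k. real k * 1)"
      unfolding binomial_sum_def by (intro sum.cong) (auto simp: mult_ac)
    also have "\<dots> = real N * card R * (real (card R) + N) ^ M"
      unfolding M binomial_sum_Suc binomial_sum_1 by simp
    finally have "real (card (forests R S)) = card R * (real (card R) + N) ^ M"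
      using M by simp
    then have "real (card (forests R S)) = real (card R * (card R + N) ^ M)" by simp
    then have "card (forests R S) = card R * (card R + N) ^ M"
      by (simp only: of_nat_eq_iff)
    then show ?thesis using M unfolding N_def[symmetric] by (simp add: mult_ac)
  qed
qed

lemma real_card_forests:
  assumes "finite R" "finite S" "R \<inter> S = {}" and "card S = Suc M"
  shows "real (card (forests R S)) = card R * (real (card R) + card S) ^ M"
proof -
  have "card (forests R S) * (card R + card S) = card R * (card R + card S) ^ M * (card R + card S)"
    using card_forests[OF assms(1-3)] assms(4) by (simp only: power_Suc mult_ac)
  moreover have "card R + card S > 0" using assms(4) by simp
  ultimately have "card (forests R S) = card R * (card R + card S) ^ M"
    by (auto simp only: mult_cancel2)
  then show ?thesis by simp
qed

text \<open>The number of ways to continue from the children is proportional to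
  \<open>card K\<close>. Hence, for nonempty \<open>R\<close>, the number of children of the roots
  in a uniform forest is one plus a binomial variable with parameters \<open>M\<close> and
  \<open>card R / (card R + card S)\<close>. A bound that is quadratic in the number of roots is
  thus carried one generation further. As \<phi> may be negative, lower bounds are covered
  too.\<close>

lemma forests_moment_step:
  fixes \<phi> :: "nat \<Rightarrow> real" and c0 c1 c2 :: real
  assumes fin: "finite R" "finite S" and RS: "R \<inter> S = {}" and M: "card S = Suc M"
    and bound: "\<And>K. K \<subseteq> S \<Longrightarrow> (\<Sum>h\<in>forests K (S - K). \<phi> (generation_size K (S - K) h d))
        \<le> (c0 + c1 * real (card K) + c2 * (real (card K))\<^sup>2) * real (card (forests K (S - K)))"
  shows "(\<Sum>f\<in>forests R S. \<phi> (generation_size R S f (Suc d))) \<le>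
    (c0 + c1 * (1 + real M * real (card R) / (real (card R) + card S))
      + c2 * (1 + 3 * real M * real (card R) / (real (card R) + card S)
              + real M * (real M - 1) * (real (card R))\<^sup>2 / (real (card R) + card S)\<^sup>2))
      * real (card (forests R S))"
proof -
  define N where "N = card S"
  define m where "m = real (card R)"
  let ?c = "\<lambda>k. c0 + c1 * real k + c2 * (real k)\<^sup>2"
  have N0: "real N > 0" using M N_def by simp
  have sub: "real (card (forests K (S - K))) * N = real (card K) * real N ^ (N - card K)"
    if "K \<in> Pow S" for K
  proof -
    have fK: "finite K" using that fin finite_subset by auto
    have cK: "card (S - K) = N - card K" "card K \<le> N"
      using that fK fin by (auto simp: N_def card_Diff_subset card_mono)
    have "card (forests K (S - K)) * (card K + card (S - K)) = card K * (card K + card (S - K)) ^ card (S - K)"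
      by (rule card_forests) (use fK fin in auto)
    then have "card (forests K (S - K)) * N = card K * N ^ (N - card K)" using cK by simp
    then show ?thesis by (metis of_nat_mult of_nat_power)
  qed
  have "(\<Sum>f\<in>forests R S. \<phi> (generation_size R S f (Suc d))) * N =
     (\<Sum>K\<in>Pow S. \<Sum>g\<in>K \<rightarrow>\<^sub>E R. \<Sum>h\<in>forests K (S - K). \<phi> (generation_size R S (glue K g h) (Suc d))) * N"
    by (subst sum_forests[OF fin RS]) simp
  also have "\<dots> = (\<Sum>K\<in>Pow S. \<Sum>g\<in>K \<rightarrow>\<^sub>E R. \<Sum>h\<in>forests K (S - K). \<phi> (generation_size K (S - K) h d)) * N"
    by (intro arg_cong2[of _ _ _ _ "(*)"] refl sum.cong arg_cong[of _ _ \<phi>] generation_size_glue[OF RS]) auto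
  also have "\<dots> \<le> (\<Sum>K\<in>Pow S. \<Sum>g\<in>K \<rightarrow>\<^sub>E R. ?c (card K) * real (card (forests K (S - K)))) * N"
    by (intro mult_right_mono sum_mono bound) auto
  also have "\<dots> = (\<Sum>K\<in>Pow S. m ^ card K * ?c (card K) * (real (card K) * real N ^ (N - card K)))"
    unfolding sum_distrib_right
  proof (rule sum.cong[OF refl])
    fix K assume K: "K \<in> Pow S"
    then have "finite K" using fin finite_subset by auto
    then show "(\<Sum>g\<in>K \<rightarrow>\<^sub>E R. ?c (card K) * real (card (forests K (S - K))) * real N)
        = m ^ card K * ?c (card K) * (real (card K) * real N ^ (N - card K))"
      using sub[OF K] by (simp add: card_PiE mult.assoc m_def)
  qed
  also have "\<dots> = (\<Sum>k\<le>N. real (N choose k) * (m ^ k * ?c k * (real k * real N ^ (N - k))))"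
    unfolding N_def by (rule sum_Pow_card) (use fin in auto)
  also have "\<dots> = binomial_sum N m N (\<lambda>k. real k * ?c k)"
    unfolding binomial_sum_def by (intro sum.cong) (auto simp: mult_ac)
  also have "\<dots> = real N * m * binomial_sum M m N (\<lambda>k. ?c (Suc k))"
    using binomial_sum_Suc[of M m "real N" ?c] M N_def by simp
  also have "\<dots> = real N * m * ((c0 + c1 * (1 + real M * m / (m + N))
      + c2 * (1 + 3 * real M * m / (m + N) + real M * (real M - 1) * m\<^sup>2 / (m + N)\<^sup>2)) * (m + N) ^ M)"
    using binomial_sum_quadratic[of m "real N" M c0 c1 c2] N0 by (simp add: m_def)
  also have "\<dots> = ((c0 + c1 * (1 + real M * m / (m + N))
      + c2 * (1 + 3 * real M * m / (m + N) + real M * (real M - 1) * m\<^sup>2 / (m + N)\<^sup>2))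
      * real (card (forests R S))) * N"
    using real_card_forests[OF fin RS M] by (simp add: m_def N_def)
  finally show ?thesis
    using N0 unfolding m_def N_def by (simp only: mult_le_cancel_right_pos)
qed


section \<open>Moments of the generation sizes\<close>

lemma generation_size_0:
  assumes "f \<in> forests R S" and "R \<inter> S = {}"
  shows "generation_size R S f 0 = card R"
proof -
  have "{v \<in> R \<union> S. level f R v = 0} = R"
    using forests_levelD(2)[OF assms] by (auto simp: level_root)
  then show ?thesis by (simp add: generation_size_def)
qed

lemma generation_size_no_descendants: "generation_size R {} f (Suc d) = 0"
  unfolding generation_size_def by (simp add: level_root card_eq_0_iff)

text \<open>The mean number of children of \<open>m\<close> roots is at most \<open>m + 1\<close>,
  so each generation adds at most one.\<close>

lemma generation_size_mean_le:
  assumes "finite R" "finite S" "R \<inter> S = {}"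
  shows "(\<Sum>f\<in>forests R S. real (generation_size R S f d))
    \<le> (real (card R) + d) * real (card (forests R S))"
  using assms
proof (induction d arbitrary: R S)
  case 0
  then show ?case by (simp add: generation_size_0)
next
  case (Suc d)
  show ?case
  proof (cases "S = {}")
    case True
    then show ?thesis by (simp add: generation_size_no_descendants)
  next
    case False
    then obtain M where M: "card S = Suc M" using Suc.prems(2) by (metis card_0_eq not0_implies_Suc)
    let ?m = "real (card R)" and ?n = "real (card R) + card S"
    have "(\<Sum>f\<in>forests R S. real (generation_size R S f (Suc d))) \<le>
      (d + 1 * (1 + real M * ?m / ?n)
        + 0 * (1 + 3 * real M * ?m / ?n + real M * (real M - 1) * ?m\<^sup>2 / ?n\<^sup>2))
      * real (card (forests R S))"
    proof (rule forests_moment_step[OF Suc.prems M])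
      fix K assume "K \<subseteq> S"
      then show "(\<Sum>h\<in>forests K (S - K). real (generation_size K (S - K) h d))
        \<le> (real d + 1 * real (card K) + 0 * (real (card K))\<^sup>2) * real (card (forests K (S - K)))"
        using Suc.IH[of K "S - K"] Suc.prems(2) finite_subset[of K S] by (simp add: add.commute)
    qed
    also have "\<dots> \<le> (?m + Suc d) * real (card (forests R S))"
    proof (intro mult_right_mono)
      have "real M * ?m \<le> ?n * ?m" using M by (intro mult_right_mono) auto
      then have "real M * ?m / ?n \<le> ?m" using M by (simp add: divide_le_eq mult.commute)
      then show "d + 1 * (1 + real M * ?m / ?n)
        + 0 * (1 + 3 * real M * ?m / ?n + real M * (real M - 1) * ?m\<^sup>2 / ?n\<^sup>2) \<le> ?m + Suc d" by simp
    qed simp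
    finally show ?thesis .
  qed
qed

lemma second_moment_factor_le:
  fixes M m n :: real
  assumes "m \<ge> 1" "0 \<le> M" "M \<le> n" "0 < n"
  shows "1 + 3 * M * m / n + M * (M - 1) * m\<^sup>2 / n\<^sup>2 \<le> m\<^sup>2 + 4 * m"
proof -
  have "M * m \<le> n * m" using assms by (intro mult_right_mono) auto
  then have "3 * M * m / n \<le> 3 * m" using assms by (simp add: divide_le_eq mult_ac)
  moreover have "M * (M - 1) * m\<^sup>2 / n\<^sup>2 \<le> m\<^sup>2"
  proof -
    have "M * (M - 1) \<le> n * n"
      using assms by (intro order_trans[OF mult_left_mono[of "M - 1" n M]] mult_right_mono) auto
    then have "M * (M - 1) * m\<^sup>2 \<le> n\<^sup>2 * m\<^sup>2"
      by (intro mult_right_mono) (auto simp: power2_eq_square)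
    then show ?thesis using assms by (simp add: divide_le_eq mult_ac)
  qed
  ultimately show ?thesis using assms(1) by simp
qed

text \<open>The coefficient of the linear term solves \<open>C' = 2 * C + 4\<close> with start 0:
  with \<open>m\<close> roots, the mean number of children is at most \<open>2 * m\<close> and its
  second moment at most \<open>m\<^sup>2 + 4 * m\<close>.\<close>

lemma generation_size_second_moment_le:
  assumes "finite R" "finite S" "R \<inter> S = {}"
  shows "(\<Sum>f\<in>forests R S. (real (generation_size R S f d))\<^sup>2)
    \<le> ((real (card R))\<^sup>2 + 4 * (2 ^ d - 1) * real (card R)) * real (card (forests R S))"
  using assms
proof (induction d arbitrary: R S)
  case 0
  then show ?case by (simp add: generation_size_0)
next
  case (Suc d)
  show ?case
  proof (cases "S = {} \<or> R = {}")
    case True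
    have "(1::real) \<le> 2 ^ Suc d" by (rule one_le_power) simp
    then have "0 \<le> 4 * ((2::real) ^ Suc d - 1)" by (simp del: power_Suc)
    then show ?thesis using True
      by (cases "S = {}") (auto simp del: power_Suc simp: generation_size_no_descendants forests_no_roots)
  next
    case False
    then obtain M where M: "card S = Suc M" using Suc.prems(2) by (metis card_0_eq not0_implies_Suc)
    let ?m = "real (card R)" and ?n = "real (card R) + card S"
    have m1: "?m \<ge> 1" using False Suc.prems(1) by (simp add: Suc_le_eq card_gt_0_iff)
    let ?C = "4 * (2 ^ d - 1) :: real"
    have "(\<Sum>f\<in>forests R S. (real (generation_size R S f (Suc d)))\<^sup>2) \<le>
      (0 + ?C * (1 + real M * ?m / ?n)
        + 1 * (1 + 3 * real M * ?m / ?n + real M * (real M - 1) * ?m\<^sup>2 / ?n\<^sup>2))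
      * real (card (forests R S))"
    proof (rule forests_moment_step[OF Suc.prems M])
      fix K assume "K \<subseteq> S"
      then show "(\<Sum>h\<in>forests K (S - K). (real (generation_size K (S - K) h d))\<^sup>2)
        \<le> (0 + ?C * real (card K) + 1 * (real (card K))\<^sup>2) * real (card (forests K (S - K)))"
        using Suc.IH[of K "S - K"] Suc.prems(2) finite_subset[of K S] by (simp add: add.commute)
    qed
    also have "\<dots> \<le> (?m\<^sup>2 + 4 * (2 ^ Suc d - 1) * ?m) * real (card (forests R S))"
    proof (intro mult_right_mono)
      have "real M * ?m \<le> ?n * ?m" using M by (intro mult_right_mono) auto
      then have "real M * ?m / ?n \<le> ?m" using M by (simp add: divide_le_eq mult.commute)
      then have "1 + real M * ?m / ?n \<le> 2 * ?m" using m1 by linarith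
      then have 1: "?C * (1 + real M * ?m / ?n) \<le> ?C * (2 * ?m)"
        by (intro mult_left_mono) auto
      have 2: "1 + 3 * real M * ?m / ?n + real M * (real M - 1) * ?m\<^sup>2 / ?n\<^sup>2 \<le> ?m\<^sup>2 + 4 * ?m"
        by (rule second_moment_factor_le) (use m1 M in auto)
      have 3: "?C * (2 * ?m) + (?m\<^sup>2 + 4 * ?m) = ?m\<^sup>2 + 4 * (2 ^ Suc d - 1) * ?m"
        by (simp add: left_diff_distrib)
      have "0 + x + 1 * y \<le> w" if "x \<le> p" "y \<le> q" "p + q = w" for x y p q w :: real
        using that by linarith
      from this[OF 1 2 3] show "0 + ?C * (1 + real M * ?m / ?n)
        + 1 * (1 + 3 * real M * ?m / ?n + real M * (real M - 1) * ?m\<^sup>2 / ?n\<^sup>2)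
        \<le> ?m\<^sup>2 + 4 * (2 ^ Suc d - 1) * ?m" .
    qed simp
    finally show ?thesis .
  qed
qed

text \<open>The constant \<open>c\<close> in the lower bound \<open>m - c * m\<^sup>2 / n\<close>
  for the mean generation size. Values of at least 2 make that bound trivial when the roots are at
  least half of all vertices. In the step, 1 is the defect of the mean number of children, and 10 is
  the product of 5, from a second moment of at most \<open>5 * m\<^sup>2\<close>, and 2, from
  \<open>card S \<ge> n / 2\<close>.\<close>

primrec mean_defect :: "nat \<Rightarrow> real" where
  "mean_defect 0 = 2"
| "mean_defect (Suc d) = 1 + 10 * mean_defect d"

lemma mean_defect_ge: "mean_defect d \<ge> 2"
  by (induction d) auto

lemma mean_defect_mono: "i \<le> j \<Longrightarrow> mean_defect i \<le> mean_defect j"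
proof (induction rule: dec_induct)
  case (step k)
  then show ?case using mean_defect_ge[of k] by simp
qed simp

lemma generation_size_mean_ge:
  assumes "finite R" "finite S" "R \<inter> S = {}"
  shows "(\<Sum>f\<in>forests R S. real (generation_size R S f d))
    \<ge> (real (card R) - mean_defect d * (real (card R))\<^sup>2 / (real (card R) + card S)) * real (card (forests R S))"
  using assms
proof (induction d arbitrary: R S)
  case 0
  have "(real (card R) - mean_defect 0 * (real (card R))\<^sup>2 / (real (card R) + card S)) * real (card (forests R S))
     \<le> real (card R) * real (card (forests R S))"
    by (intro mult_right_mono) auto
  also have "\<dots> = (\<Sum>f\<in>forests R S. real (generation_size R S f 0))"
    using 0 by (simp add: generation_size_0)
  finally show ?case .
next
  case (Suc d)
  let ?m = "real (card R)" and ?n = "real (card R) + card S"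
  let ?c = "mean_defect d"
  show ?case
  proof (cases "?n \<le> 2 * ?m \<or> ?m < 1")
    case True
    have "?m - mean_defect (Suc d) * ?m\<^sup>2 / ?n \<le> 0"
    proof (cases "?m = 0")
      case False
      then have n: "?m \<ge> 1" "?n > 0" by auto
      have "2 * ?m \<le> mean_defect (Suc d) * ?m"
        using mean_defect_ge[of "Suc d"] by (intro mult_right_mono) auto
      then have "?n * ?m \<le> mean_defect (Suc d) * ?m * ?m"
        using True n by (intro mult_right_mono) linarith+
      then show ?thesis using n by (simp add: le_divide_eq power2_eq_square mult_ac)
    qed simp
    then have "(?m - mean_defect (Suc d) * ?m\<^sup>2 / ?n) * real (card (forests R S)) \<le> 0"
      by (simp add: mult_nonpos_nonneg)
    also have "\<dots> \<le> (\<Sum>f\<in>forests R S. real (generation_size R S f (Suc d)))" by (simp add: sum_nonneg)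
    finally show ?thesis .
  next
    case False
    then have m1: "?m \<ge> 1" and nm: "2 * ?m < ?n" by auto
    have "card S \<noteq> 0" using m1 nm by linarith
    then obtain M where M: "card S = Suc M" using not0_implies_Suc by blast
    have N0: "real (card S) > 0" using M by simp
    \<comment> \<open>The inner forest has \<open>card S\<close> vertices in all, roots included;
      this is the denominator in the coefficient of the square.\<close>
    have "(\<Sum>f\<in>forests R S. - real (generation_size R S f (Suc d))) \<le>
      (0 + (-1) * (1 + real M * ?m / ?n)
        + (?c / card S) * (1 + 3 * real M * ?m / ?n + real M * (real M - 1) * ?m\<^sup>2 / ?n\<^sup>2))
      * real (card (forests R S))"
    proof (rule forests_moment_step[OF Suc.prems M])
      fix K assume K: "K \<subseteq> S"
      then have "finite K" using Suc.prems(2) finite_subset by auto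
      then have "real (card K) + real (card (S - K)) = real (card S)"
        using K Suc.prems(2) by (simp add: card_Diff_subset card_mono)
      then show "(\<Sum>h\<in>forests K (S - K). - real (generation_size K (S - K) h d))
        \<le> (0 + (-1) * real (card K) + (?c / card S) * (real (card K))\<^sup>2) * real (card (forests K (S - K)))"
        using Suc.IH[of K "S - K"] Suc.prems(2) \<open>finite K\<close> by (simp add: sum_negf left_diff_distrib)
    qed
    also have "\<dots> \<le> - ((?m - mean_defect (Suc d) * ?m\<^sup>2 / ?n)) * real (card (forests R S))"
    proof (intro mult_right_mono)
      have "1 + 3 * real M * ?m / ?n + real M * (real M - 1) * ?m\<^sup>2 / ?n\<^sup>2 \<le> ?m\<^sup>2 + 4 * ?m"
        by (rule second_moment_factor_le) (use m1 M in auto)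
      also have "\<dots> \<le> 5 * ?m\<^sup>2" using m1 by (simp add: power2_eq_square)
      finally have "(?c / card S) * (1 + 3 * real M * ?m / ?n + real M * (real M - 1) * ?m\<^sup>2 / ?n\<^sup>2)
          \<le> (?c / card S) * (5 * ?m\<^sup>2)"
        using mean_defect_ge[of d] by (intro mult_left_mono) auto
      also have "\<dots> \<le> (?c * (2 / ?n)) * (5 * ?m\<^sup>2)"
      proof (intro mult_right_mono)
        have "1 / real (card S) \<le> 2 / ?n" using nm N0 by (simp add: divide_le_eq le_divide_eq)
        then have "?c * (1 / real (card S)) \<le> ?c * (2 / ?n)"
          using mean_defect_ge[of d] by (intro mult_left_mono) auto
        then show "?c / card S \<le> ?c * (2 / ?n)" by simp
      qed simp
      finally have 1: "(?c / card S) * (1 + 3 * real M * ?m / ?n + real M * (real M - 1) * ?m\<^sup>2 / ?n\<^sup>2)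
          \<le> 10 * ?c * ?m\<^sup>2 / ?n" by simp
      have "real M = ?n - ?m - 1" using M by simp
      then have "real M * ?m = (?n - ?m - 1) * ?m" by simp
      then have "real M * ?m / ?n = (?n * ?m - ?m\<^sup>2 - ?m) / ?n"
        by (simp add: algebra_simps power2_eq_square)
      also have "\<dots> = ?m - ?m\<^sup>2 / ?n - ?m / ?n"
        using N0 m1 by (simp only: diff_divide_distrib) simp
      finally have "1 + real M * ?m / ?n = ?m - ?m\<^sup>2 / ?n + (1 - ?m / ?n)" by simp
      moreover have "?m / ?n \<le> 1" using nm m1 by (simp add: divide_le_eq)
      ultimately have 2: "1 + real M * ?m / ?n \<ge> ?m - ?m\<^sup>2 / ?n" by linarith
      have 3: "mean_defect (Suc d) * ?m\<^sup>2 / ?n = ?m\<^sup>2 / ?n + 10 * ?c * ?m\<^sup>2 / ?n"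
        by (simp add: distrib_right add_divide_distrib)
      have "0 + (-1) * x + y \<le> - (m - w)" if "y \<le> q" "x \<ge> m - p" "w = p + q" for x y p q w m :: real
        using that by linarith
      from this[OF 1 2 3] show "0 + (-1) * (1 + real M * ?m / ?n)
        + (?c / card S) * (1 + 3 * real M * ?m / ?n + real M * (real M - 1) * ?m\<^sup>2 / ?n\<^sup>2)
        \<le> - (?m - mean_defect (Suc d) * ?m\<^sup>2 / ?n)" .
    qed simp
    finally show ?thesis by (simp only: sum_negf mult_minus_left neg_le_iff_le)
  qed
qed

text \<open>When the square is expanded, the terms \<open>m\<^sup>2\<close> cancel. What remains is
  of order \<open>m + m ^ 3 / n\<close> for fixed \<open>d\<close>, negligible against
  \<open>m\<^sup>2\<close> when \<open>m\<close> is large and \<open>m / n\<close> small.\<close>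

lemma generation_size_deviation_le:
  assumes "finite R" "finite S" "R \<inter> S = {}"
  shows "(\<Sum>f\<in>forests R S. (real (generation_size R S f d) - real (card R))\<^sup>2)
    \<le> (4 * (2 ^ d - 1) * real (card R) + 2 * mean_defect d * (real (card R)) ^ 3 / (real (card R) + card S))
      * real (card (forests R S))"
proof -
  let ?m = "real (card R)" and ?n = "real (card R) + card S" and ?c = "real (card (forests R S))"
  let ?G = "\<lambda>f. real (generation_size R S f d)"
  have "(\<Sum>f\<in>forests R S. (?G f - ?m)\<^sup>2)
     = (\<Sum>f\<in>forests R S. (?G f)\<^sup>2) - 2 * ?m * (\<Sum>f\<in>forests R S. ?G f) + ?m\<^sup>2 * ?c"
    by (simp add: power2_diff sum.distrib sum_subtractf sum_distrib_left algebra_simps)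
  also have "\<dots> \<le> (?m\<^sup>2 + 4 * (2 ^ d - 1) * ?m) * ?c
      - 2 * ?m * ((?m - mean_defect d * ?m\<^sup>2 / ?n) * ?c) + ?m\<^sup>2 * ?c"
    by (intro add_mono diff_mono mult_left_mono generation_size_second_moment_le
        generation_size_mean_ge assms order_refl) auto
  also have "\<dots> = (4 * (2 ^ d - 1) * ?m + 2 * mean_defect d * ?m ^ 3 / ?n) * ?c"
    by (simp add: algebra_simps power2_eq_square power3_eq_cube)
  finally show ?thesis .
qed

section \<open>Sums of inverse levels over a random forest\<close>

lemma sum_inverse_level:
  assumes "finite S" and "R \<inter> S = {}"
  shows "(\<Sum>v\<in>{v \<in> S. level f R v \<in> {1..D}}. 1 / real (level f R v))
    = (\<Sum>d=1..D. real (generation_size R S f d) / d)"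
proof -
  have "(\<Sum>v\<in>{v \<in> S. level f R v \<in> {1..D}}. 1 / real (level f R v))
    = (\<Sum>d=1..D. \<Sum>v\<in>{w \<in> {v \<in> S. level f R v \<in> {1..D}}. level f R w = d}. 1 / real (level f R v))"
    using assms by (intro sum.group[symmetric]) auto
  also have "\<dots> = (\<Sum>d=1..D. real (generation_size R S f d) / d)"
  proof (rule sum.cong[OF refl])
    fix d assume d: "d \<in> {1..D}"
    then have "{w \<in> {v \<in> S. level f R v \<in> {1..D}}. level f R w = d} = {v \<in> R \<union> S. level f R v = d}"
      by (auto simp: level_root)
    then show "(\<Sum>v\<in>{w \<in> {v \<in> S. level f R v \<in> {1..D}}. level f R w = d}. 1 / real (level f R v))
        = real (generation_size R S f d) / d"
      by (simp add: generation_size_def)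
  qed
  finally show ?thesis .
qed

lemma sum_inverse_level_ge:
  assumes "finite S" and "R \<inter> S = {}"
  shows "(\<Sum>d=1..D. real (generation_size R S f d) / d) \<le> (\<Sum>v\<in>S. 1 / real (level f R v))"
  unfolding sum_inverse_level[OF assms, symmetric] using assms by (intro sum_mono2) auto

lemma sum_inverse_level_le:
  assumes "finite S" and "R \<inter> S = {}" and "s > 0"
  shows "(\<Sum>v\<in>S. 1 / real (level f R v))
    \<le> (\<Sum>d=1..s. real (generation_size R S f d) / d) + card S / s"
proof -
  have "(\<Sum>v\<in>S. 1 / real (level f R v)) \<le>
    (\<Sum>v\<in>S. (if level f R v \<in> {1..s} then 1 / real (level f R v) else 0) + 1 / s)"
  proof (rule sum_mono)
    fix v
    show "1 / real (level f R v) \<le> (if level f R v \<in> {1..s} then 1 / real (level f R v) else 0) + 1 / s"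
    \<comment> \<open>At level zero the left side is \<open>1 / 0 = 0\<close>.\<close>
    proof (cases "level f R v = 0 \<or> level f R v \<in> {1..s}")
      case False
      then have "1 / real (level f R v) \<le> 1 / real s" using assms(3) by (intro divide_left_mono) auto
      then show ?thesis using False by auto
    qed (auto simp: Suc_le_eq)
  qed
  also have "\<dots> = (\<Sum>v\<in>{v \<in> S. level f R v \<in> {1..s}}. 1 / real (level f R v)) + card S / s"
    using assms(1) by (simp add: sum.distrib sum.inter_filter[symmetric])
  finally show ?thesis using sum_inverse_level[OF assms(1,2)] by simp
qed

lemma sum_inverse_level_mean_le:
  assumes "finite R" "finite S" "R \<inter> S = {}" and "s > 0"
  shows "(\<Sum>f\<in>forests R S. \<Sum>v\<in>S. 1 / real (level f R v))
    \<le> (card R * harm s + s + card S / s) * real (card (forests R S))"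
proof -
  let ?c = "real (card (forests R S))"
  have "(\<Sum>f\<in>forests R S. \<Sum>v\<in>S. 1 / real (level f R v))
    \<le> (\<Sum>f\<in>forests R S. (\<Sum>d=1..s. real (generation_size R S f d) / d) + card S / s)"
    by (intro sum_mono sum_inverse_level_le assms)
  also have "\<dots> = (\<Sum>d=1..s. (\<Sum>f\<in>forests R S. real (generation_size R S f d)) / d) + card S / s * ?c"
    by (simp add: sum.distrib sum_divide_distrib mult.commute sum.swap[of _ "{Suc 0..s}"])
  also have "\<dots> \<le> (\<Sum>d=1..s. ((real (card R) + d) * ?c) / d) + card S / s * ?c"
    by (intro add_right_mono sum_mono divide_right_mono generation_size_mean_le assms) auto
  also have "(\<Sum>d=1..s. ((real (card R) + d) * ?c) / d) = (\<Sum>d=1..s. (card R * inverse (real d) + 1) * ?c)"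
    by (intro sum.cong) (auto simp: field_simps)
  also have "\<dots> = (card R * harm s + s) * ?c"
    by (simp add: sum_distrib_right[symmetric] sum.distrib sum_distrib_left[symmetric] harm_def)
  finally show ?thesis by (simp add: algebra_simps)
qed

text \<open>Chebyshev's inequality in pointwise form: either \<open>x\<close> is at least
  \<open>y / 2\<close>, or the deviation term is at least one.\<close>

lemma inverse_Suc_le_deviation:
  fixes x y :: real
  assumes "x \<ge> 0" "y > 0"
  shows "1 / (1 + x) \<le> 2 / y + 4 * (x - y)\<^sup>2 / y\<^sup>2"
proof (cases "x \<ge> y / 2")
  case True
  have "1 / (1 + x) \<le> 1 / (y / 2)" using True assms by (intro divide_left_mono) auto
  also have "\<dots> \<le> 2 / y + 4 * (x - y)\<^sup>2 / y\<^sup>2" by simp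
  finally show ?thesis .
next
  case False
  then have "(y / 2)\<^sup>2 \<le> (y - x)\<^sup>2" using assms by (intro power_mono) auto
  then have "1 \<le> 4 * (x - y)\<^sup>2 / y\<^sup>2"
    using assms by (simp add: le_divide_eq power_divide power2_commute)
  moreover have "1 / (1 + x) \<le> 1" "2 / y \<ge> 0" using assms by auto
  ultimately show ?thesis by linarith
qed

text \<open>Only the levels up to \<open>D\<close> are kept. Their sum concentrates around
  \<open>card R * harm D\<close>, and the pointwise bound is applied with
  \<open>y = r * card R * harm D\<close>. In the quadratic term \<open>r\<close> cancels, so that
  \<open>r\<close> enters through the main term alone.\<close>

lemma inverse_sum_level_mean_le:
  fixes r :: real
  assumes RS: "finite R" "finite S" "R \<inter> S = {}" and "R \<noteq> {}" and "r > 0" and "D > 0"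
  shows "(\<Sum>f\<in>forests R S. 1 / (1 + r * (\<Sum>v\<in>S. 1 / real (level f R v))))
    \<le> (2 / (r * card R * harm D)
        + 4 * (real D)\<^sup>2 * (4 * 2 ^ D + 2 * mean_defect D) * (1 / card R + card R / (real (card R) + card S)))
      * real (card (forests R S))"
proof -
  let ?c = "real (card (forests R S))" and ?H = "harm D :: real"
  let ?m = "real (card R)" and ?n = "real (card R) + card S"
  let ?C = "4 * 2 ^ D + 2 * mean_defect D"
  let ?N = "\<lambda>f d. real (generation_size R S f d)"
  define A where "A f = (\<Sum>d=1..D. ?N f d / d)" for f
  have m1: "?m \<ge> 1" using assms by (simp add: Suc_le_eq card_gt_0_iff)
  have H1: "?H \<ge> 1" using harm_mono[of 1 D, where 'a = real] assms(6) by (simp add: harm_def)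
  have A_dev: "(A f - ?m * ?H)\<^sup>2 \<le> D * (\<Sum>d=1..D. (?N f d - ?m)\<^sup>2)" for f
  proof -
    have "A f - ?m * ?H = (\<Sum>d=1..D. (?N f d - ?m) * inverse (real d))"
      unfolding A_def harm_def
      by (simp add: sum_distrib_left sum_subtractf[symmetric] divide_inverse algebra_simps)
    also have "\<bar>\<dots>\<bar> \<le> (\<Sum>d=1..D. \<bar>?N f d - ?m\<bar> * 1)"
      by (intro order_trans[OF sum_abs] sum_mono)
        (auto simp: abs_mult intro!: mult_left_le inverse_le_1_iff[THEN iffD2])
    finally have "(A f - ?m * ?H)\<^sup>2 \<le> (\<Sum>d=1..D. \<bar>?N f d - ?m\<bar> * 1)\<^sup>2"
      by (metis abs_ge_zero power2_abs power_mono)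
    also have "\<dots> \<le> (\<Sum>d=1..D. \<bar>?N f d - ?m\<bar>\<^sup>2) * (\<Sum>d=1..D. 1\<^sup>2)"
      by (rule Cauchy_Schwarz_ineq_sum)
    finally show ?thesis by (simp add: mult.commute)
  qed
  have "(\<Sum>f\<in>forests R S. 1 / (1 + r * (\<Sum>v\<in>S. 1 / real (level f R v))))
     \<le> (\<Sum>f\<in>forests R S. 2 / (r * ?m * ?H) + 4 / ?m\<^sup>2 * (D * (\<Sum>d=1..D. (?N f d - ?m)\<^sup>2)))"
  proof (rule sum_mono)
    fix f
    have A0: "A f \<ge> 0" unfolding A_def by (intro sum_nonneg) auto
    have "1 / (1 + r * (\<Sum>v\<in>S. 1 / real (level f R v))) \<le> 1 / (1 + r * A f)"
      using sum_inverse_level_ge[OF RS(2,3), of f D] A0 \<open>r > 0\<close>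
      by (intro divide_left_mono add_left_mono mult_left_mono mult_pos_pos add_pos_nonneg mult_nonneg_nonneg)
        (auto simp: A_def intro!: sum_nonneg)
    also have "\<dots> \<le> 2 / (r * ?m * ?H) + 4 * (r * A f - r * ?m * ?H)\<^sup>2 / (r * ?m * ?H)\<^sup>2"
      using A0 m1 H1 \<open>r > 0\<close>
      by (intro inverse_Suc_le_deviation mult_pos_pos mult_nonneg_nonneg) linarith+
    also have "4 * (r * A f - r * ?m * ?H)\<^sup>2 / (r * ?m * ?H)\<^sup>2 = 4 / (?m * ?H)\<^sup>2 * (A f - ?m * ?H)\<^sup>2"
    proof -
      have "r * A f - r * ?m * ?H = r * (A f - ?m * ?H)" by (simp add: algebra_simps)
      then show ?thesis using \<open>r > 0\<close> by (simp add: power_mult_distrib)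
    qed
    also have "\<dots> \<le> 4 / ?m\<^sup>2 * (D * (\<Sum>d=1..D. (?N f d - ?m)\<^sup>2))"
    proof (intro mult_mono A_dev)
      have "?m\<^sup>2 * 1 \<le> ?m\<^sup>2 * ?H\<^sup>2" using H1 by (intro mult_left_mono) auto
      then have "?m\<^sup>2 \<le> (?m * ?H)\<^sup>2" by (simp add: power_mult_distrib)
      then show "4 / (?m * ?H)\<^sup>2 \<le> 4 / ?m\<^sup>2" using m1 H1 by (intro divide_left_mono) auto
    qed auto
    finally show "1 / (1 + r * (\<Sum>v\<in>S. 1 / real (level f R v)))
      \<le> 2 / (r * ?m * ?H) + 4 / ?m\<^sup>2 * (D * (\<Sum>d=1..D. (?N f d - ?m)\<^sup>2))" by simp
  qed
  also have "\<dots> = 2 / (r * ?m * ?H) * ?c + 4 / ?m\<^sup>2 * (D * (\<Sum>d=1..D. \<Sum>f\<in>forests R S. (?N f d - ?m)\<^sup>2))"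
    by (simp add: sum.distrib sum_distrib_left sum.swap[of _ "{Suc 0..D}"] mult.commute)
  also have "\<dots> \<le> 2 / (r * ?m * ?H) * ?c + 4 / ?m\<^sup>2 * (D * (\<Sum>d=1..D. ?C * (?m + ?m ^ 3 / ?n) * ?c))"
  proof (intro add_left_mono mult_left_mono sum_mono)
    fix d assume d: "d \<in> {1..D}"
    have "(\<Sum>f\<in>forests R S. (?N f d - ?m)\<^sup>2) \<le> (4 * (2 ^ d - 1) * ?m + 2 * mean_defect d * ?m ^ 3 / ?n) * ?c"
      by (rule generation_size_deviation_le[OF RS])
    also have "\<dots> \<le> ?C * (?m + ?m ^ 3 / ?n) * ?c"
    proof (intro mult_right_mono)
      have "(2::real) ^ d \<le> 2 ^ D" using d by (intro power_increasing) auto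
      then have "4 * 2 ^ d - 4 \<le> ?C" using mean_defect_ge[of D] by linarith
      then have "4 * (2 ^ d - 1) \<le> ?C" by (simp only: right_diff_distrib mult_1_right)
      then have "4 * (2 ^ d - 1) * ?m \<le> ?C * ?m" by (rule mult_right_mono) simp
      moreover have "2 * mean_defect d * (?m ^ 3 / ?n) \<le> ?C * (?m ^ 3 / ?n)"
        using mean_defect_mono[of d D] d by (intro mult_right_mono) (auto intro: add_increasing)
      ultimately show "4 * (2 ^ d - 1) * ?m + 2 * mean_defect d * ?m ^ 3 / ?n \<le> ?C * (?m + ?m ^ 3 / ?n)"
        by (simp add: distrib_left)
    qed simp
    finally show "(\<Sum>f\<in>forests R S. (?N f d - ?m)\<^sup>2) \<le> ?C * (?m + ?m ^ 3 / ?n) * ?c" .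
  qed auto
  also have "\<dots> = (2 / (r * ?m * ?H) + 4 * (real D)\<^sup>2 * ?C * ((?m + ?m ^ 3 / ?n) / ?m\<^sup>2)) * ?c"
  proof -
    have "a * c + 4 / m\<^sup>2 * (D * (\<Sum>d=1..D. C * W * c)) = (a + 4 * (real D)\<^sup>2 * C * (W / m\<^sup>2)) * c"
      for a c m C W :: real
      by (simp add: distrib_right power2_eq_square)
    then show ?thesis .
  qed
  also have "(?m + ?m ^ 3 / ?n) / ?m\<^sup>2 = 1 / ?m + ?m / ?n"
    using m1 by (simp add: add_divide_distrib power2_eq_square power3_eq_cube)
  finally show ?thesis .
qed

section \<open>Superharmonic functions of a finite Markov chain\<close>

definition gen_apply :: "'s set \<Rightarrow> ('s \<Rightarrow> 's \<Rightarrow> real) \<Rightarrow> ('s \<Rightarrow> real) \<Rightarrow> 's \<Rightarrow> real" where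
  "gen_apply S q h x = (\<Sum>y\<in>S. generator S q x y * h y)"

lemma gen_apply_eq:
  assumes "finite S" "x \<in> S"
  shows "gen_apply S q h x = (\<Sum>y\<in>S. q x y * (h y - h x))"
proof -
  have "gen_apply S q h x = generator S q x x * h x + (\<Sum>y\<in>S - {x}. generator S q x y * h y)"
    unfolding gen_apply_def using assms by (rule sum.remove)
  also have "(\<Sum>y\<in>S - {x}. generator S q x y * h y) = (\<Sum>y\<in>S - {x}. q x y * h y)"
    by (intro sum.cong) (auto simp: generator_def)
  also have "generator S q x x * h x = - (\<Sum>y\<in>S - {x}. q x y * h x)"
    by (simp add: generator_def sum_distrib_right)
  also have "- (\<Sum>y\<in>S - {x}. q x y * h x) + (\<Sum>y\<in>S - {x}. q x y * h y) = (\<Sum>y\<in>S - {x}. q x y * (h y - h x))"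
    by (simp add: sum_subtractf right_diff_distrib)
  also have "\<dots> = (\<Sum>y\<in>S. q x y * (h y - h x))"
    using sum.remove[OF assms, of "\<lambda>y. q x y * (h y - h x)"] by simp
  finally show ?thesis .
qed

section \<open>The transition function as a matrix exponential\<close>

lemma kernel_pow_bound:
  assumes "finite S" "y \<in> S" and Q: "\<And>z w. z \<in> S \<Longrightarrow> w \<in> S \<Longrightarrow> \<bar>Q z w\<bar> \<le> B"
  shows "\<bar>kernel_pow S Q k x y\<bar> \<le> (real (card S) * B) ^ k"
  using assms(2)
proof (induction k arbitrary: y)
  case (Suc k)
  have B0: "B \<ge> 0" using Q[OF Suc.prems Suc.prems] by linarith
  have "\<bar>kernel_pow S Q (Suc k) x y\<bar> \<le> (\<Sum>z\<in>S. \<bar>kernel_pow S Q k x z\<bar> * \<bar>Q z y\<bar>)"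
    by (simp add: abs_mult[symmetric])
  also have "\<dots> \<le> (\<Sum>z\<in>S. (real (card S) * B) ^ k * B)"
    using Suc Q B0 by (intro sum_mono mult_mono) auto
  finally show ?case by (simp add: mult_ac)
qed auto

text \<open>Kolmogorov's forward equation by termwise differentiation; the series converges
  everywhere because the powers of the generator grow at most geometrically.\<close>

lemma trans_prob_has_derivative:
  assumes S: "finite S" "y \<in> S"
  shows "((\<lambda>t. trans_prob S q t x y) has_real_derivative
    (\<Sum>z\<in>S. trans_prob S q t x z * generator S q z y)) (at t)"
proof -
  let ?Q = "generator S q"
  define B where "B = (\<Sum>z\<in>S. \<Sum>w\<in>S. \<bar>?Q z w\<bar>)"
  have B: "\<bar>?Q z w\<bar> \<le> B" if "z \<in> S" "w \<in> S" for z w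
  proof -
    have "\<bar>?Q z w\<bar> \<le> (\<Sum>w\<in>S. \<bar>?Q z w\<bar>)" using S that by (intro member_le_sum) auto
    also have "\<dots> \<le> B" unfolding B_def using S that by (intro member_le_sum) (auto intro: sum_nonneg)
    finally show ?thesis .
  qed
  define c where "c z k = kernel_pow S ?Q k x z / fact k" for z k
  have summ: "summable (\<lambda>k. c z k * t ^ k)" if "z \<in> S" for t z
  proof (rule summable_comparison_test)
    let ?b = "real (card S) * B"
    show "\<exists>N. \<forall>k\<ge>N. norm (c z k * t ^ k) \<le> inverse (fact k) * (\<bar>t\<bar> * ?b) ^ k"
    proof (intro exI allI impI)
      fix k
      have "\<bar>kernel_pow S ?Q k x z\<bar> \<le> ?b ^ k"
        by (rule kernel_pow_bound[OF S(1) that]) (rule B)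
      then have "\<bar>kernel_pow S ?Q k x z\<bar> * (\<bar>t\<bar> ^ k / fact k) \<le> ?b ^ k * (\<bar>t\<bar> ^ k / fact k)"
        by (intro mult_right_mono) auto
      then show "norm (c z k * t ^ k) \<le> inverse (fact k) * (\<bar>t\<bar> * ?b) ^ k"
        by (simp add: c_def abs_mult power_abs power_mult_distrib divide_inverse mult_ac)
    qed
    show "summable (\<lambda>k. inverse (fact k) * (\<bar>t\<bar> * ?b) ^ k)"
      by (rule summable_exp)
  qed
  have tp: "trans_prob S q t x z = (\<Sum>k. c z k * t ^ k)" for t z
    unfolding trans_prob_def c_def by (simp add: mult_ac)
  have "((\<lambda>t. \<Sum>k. c y k * t ^ k) has_real_derivative (\<Sum>k. diffs (c y) k * t ^ k)) (at t)"
    by (rule termdiffs_strong_converges_everywhere) (rule summ[OF S(2)])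
  also have "(\<Sum>k. diffs (c y) k * t ^ k) = (\<Sum>k. \<Sum>z\<in>S. c z k * t ^ k * ?Q z y)"
  proof (intro suminf_cong)
    fix k
    have "diffs (c y) k = kernel_pow S ?Q (Suc k) x y / fact k"
      unfolding diffs_def c_def by (simp del: kernel_pow.simps of_nat_Suc add: nonzero_eq_divide_eq)
    then show "diffs (c y) k * t ^ k = (\<Sum>z\<in>S. c z k * t ^ k * ?Q z y)"
      by (simp add: c_def sum_distrib_left sum_distrib_right sum_divide_distrib mult_ac)
  qed
  also have "\<dots> = (\<Sum>z\<in>S. (\<Sum>k. c z k * t ^ k) * ?Q z y)"
    by (subst suminf_sum) (auto intro!: summable_mult2 summ simp: suminf_mult2[symmetric] summ)
  finally show ?thesis unfolding tp .
qed

lemma trans_prob_zero: "trans_prob S q 0 x y = of_bool (x = y)"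
proof -
  have "(\<Sum>k. 0 ^ k / fact k * kernel_pow S (generator S q) k x y)
      = (\<Sum>k\<in>{0}. 0 ^ k / fact k * kernel_pow S (generator S q) k x y)"
    by (rule suminf_finite) auto
  then show ?thesis unfolding trans_prob_def by simp
qed

lemma trans_prob_absorbing:
  assumes "finite S" "y \<in> S" and q: "\<And>y. y \<in> S \<Longrightarrow> q x y = 0"
  shows "trans_prob S q t x y = of_bool (x = y)"
proof -
  have g: "generator S q x y = 0" if "y \<in> S" for y
    using that q by (auto simp: generator_def)
  have k: "kernel_pow S (generator S q) k x y = 0" if "k > 0" "y \<in> S" for k y
    using that
  proof (induction k arbitrary: y)
    case (Suc k)
    show ?case
    proof (cases "k = 0")
      case True
      have "(\<Sum>z\<in>S. of_bool (x = z) * generator S q z y) = (\<Sum>z\<in>S. 0)"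
        using g[OF Suc.prems(2)] by (intro sum.cong) auto
      then show ?thesis using True by simp
    next
      case False
      then show ?thesis using Suc by simp
    qed
  qed simp
  have "(\<Sum>k. t ^ k / fact k * kernel_pow S (generator S q) k x y)
      = (\<Sum>k\<in>{0}. t ^ k / fact k * kernel_pow S (generator S q) k x y)"
    by (rule suminf_finite) (use assms(2) in \<open>auto simp: k\<close>)
  then show ?thesis unfolding trans_prob_def by simp
qed


section \<open>Decay of means, absorption and the terminal state\<close>

context
  fixes M :: "'w measure" and S :: "'s set" and q :: "'s \<Rightarrow> 's \<Rightarrow> real" and X :: "real \<Rightarrow> 'w \<Rightarrow> 's" and x0 :: 's
  assumes chain: "markov_chain M S q X" and init: "AE \<omega> in M. X 0 \<omega> = x0" and x0: "x0 \<in> S"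
begin

lemma chain_prob_space: "prob_space M" and chain_finite: "finite S"
  using chain unfolding markov_chain_def by auto

interpretation prob_space M by (rule chain_prob_space)

lemma chain_event [measurable]:
  assumes "t \<ge> 0"
  shows "{\<omega> \<in> space M. X t \<omega> \<in> A} \<in> sets M"
proof -
  have m: "X t \<in> measurable M (count_space S)"
    using chain assms unfolding markov_chain_def by auto
  have "{\<omega> \<in> space M. X t \<omega> \<in> A} = X t -` (A \<inter> S) \<inter> space M"
    using measurable_space[OF m] by auto
  also have "\<dots> \<in> sets M" using m by (rule measurable_sets) auto
  finally show ?thesis .
qed

lemma chain_event_eq: "t \<ge> 0 \<Longrightarrow> {\<omega> \<in> space M. X t \<omega> = y} \<in> sets M"
  using chain_event[of t "{y}"] by simp

lemma chain_space:
  assumes "t \<ge> 0" "\<omega> \<in> space M"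
  shows "X t \<omega> \<in> S"
proof -
  have m: "X t \<in> measurable M (count_space S)"
    using chain assms unfolding markov_chain_def by auto
  show ?thesis using measurable_space[OF m assms(2)] by simp
qed

lemma chain_transition:
  assumes "0 \<le> s" "s \<le> t" "x \<in> S" "y \<in> S"
  shows "prob {\<omega> \<in> space M. X s \<omega> = x \<and> X t \<omega> = y} = prob {\<omega> \<in> space M. X s \<omega> = x} * trans_prob S q (t - s) x y"
proof -
  have ball: "(\<forall>i\<le>Suc 0. P i) \<longleftrightarrow> P 0 \<and> P 1" for P :: "nat \<Rightarrow> bool"
    by (auto simp: le_Suc_eq)
  have "\<forall>(k::nat) (\<tau> :: nat \<Rightarrow> real) (x :: nat \<Rightarrow> 's).
        0 \<le> \<tau> 0 \<longrightarrow> (\<forall>i\<le>k. \<tau> i \<le> \<tau> (Suc i)) \<longrightarrow> (\<forall>i\<le>Suc k. x i \<in> S) \<longrightarrow>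
        measure M {\<omega>\<in>space M. \<forall>i\<le>Suc k. X (\<tau> i) \<omega> = x i} =
        measure M {\<omega>\<in>space M. \<forall>i\<le>k. X (\<tau> i) \<omega> = x i} *
          trans_prob S q (\<tau> (Suc k) - \<tau> k) (x k) (x (Suc k))"
    using chain unfolding markov_chain_def by blast
  from this[rule_format, of "\<lambda>i. if i = 0 then s else t" 0 "\<lambda>i. if i = 0 then x else y"]
  show ?thesis using assms by (simp add: ball)
qed

lemma chain_prob:
  assumes "0 \<le> t" "y \<in> S"
  shows "prob {\<omega> \<in> space M. X t \<omega> = y} = trans_prob S q t x0 y"
proof -
  have "prob {\<omega> \<in> space M. X 0 \<omega> = x0} = 1"
    using init by (subst prob_Collect_eq_1) (auto simp: chain_event_eq)
  moreover have "prob {\<omega> \<in> space M. X 0 \<omega> = x0 \<and> X t \<omega> = y} = prob {\<omega> \<in> space M. X t \<omega> = y}"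
  proof (rule finite_measure_eq_AE)
    have "{\<omega> \<in> space M. X 0 \<omega> = x0 \<and> X t \<omega> = y} = {\<omega> \<in> space M. X 0 \<omega> = x0} \<inter> {\<omega> \<in> space M. X t \<omega> = y}"
      by auto
    then show "{\<omega> \<in> space M. X 0 \<omega> = x0 \<and> X t \<omega> = y} \<in> events"
      using chain_event_eq assms by auto
  qed (use init chain_event_eq assms in auto)
  ultimately show ?thesis using chain_transition[of 0 t x0 y] assms x0 by simp
qed

lemma chain_prob_set:
  assumes "0 \<le> t" "A \<subseteq> S"
  shows "prob {\<omega> \<in> space M. X t \<omega> \<in> A} = (\<Sum>y\<in>A. trans_prob S q t x0 y)"
proof -
  have "finite A" using assms chain_finite finite_subset by auto
  have "{\<omega> \<in> space M. X t \<omega> \<in> A} = (\<Union>y\<in>A. {\<omega> \<in> space M. X t \<omega> = y})" by auto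
  also have "prob \<dots> = (\<Sum>y\<in>A. prob {\<omega> \<in> space M. X t \<omega> = y})"
    using \<open>finite A\<close> assms by (intro finite_measure_finite_Union) (auto simp: chain_event_eq disjoint_family_on_def)
  also have "\<dots> = (\<Sum>y\<in>A. trans_prob S q t x0 y)"
    using assms by (intro sum.cong chain_prob) auto
  finally show ?thesis .
qed

text \<open>Positivity of the matrix exponential is read off from the process: the entry is the
  probability of an event.\<close>

lemma chain_trans_nonneg: "0 \<le> t \<Longrightarrow> y \<in> S \<Longrightarrow> 0 \<le> trans_prob S q t x0 y"
  using chain_prob[of t y] by (metis measure_nonneg)

text \<open>Gronwall's argument: by the forward equation, \<open>exp (c * t)\<close> times the mean
  of \<open>h\<close> at time \<open>t\<close> has a nonpositive derivative. The case
  \<open>c = 0\<close> is that of superharmonic functions.\<close>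

lemma chain_decay:
  assumes "\<And>z. z \<in> S \<Longrightarrow> gen_apply S q h z \<le> - c * h z" and "t \<ge> 0"
  shows "(\<Sum>y\<in>S. trans_prob S q t x0 y * h y) \<le> exp (- c * t) * h x0"
proof -
  let ?E = "\<lambda>t. \<Sum>y\<in>S. trans_prob S q t x0 y * h y"
  have dE: "(?E has_real_derivative (\<Sum>z\<in>S. trans_prob S q s x0 z * gen_apply S q h z)) (at s)" for s
  proof -
    have "(?E has_real_derivative
       (\<Sum>y\<in>S. (\<Sum>z\<in>S. trans_prob S q s x0 z * generator S q z y) * h y)) (at s)"
      by (intro DERIV_sum DERIV_cmult_right trans_prob_has_derivative chain_finite)
    also have "(\<Sum>y\<in>S. (\<Sum>z\<in>S. trans_prob S q s x0 z * generator S q z y) * h y)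
      = (\<Sum>z\<in>S. trans_prob S q s x0 z * gen_apply S q h z)"
      unfolding gen_apply_def sum_distrib_left sum_distrib_right
      by (subst sum.swap) (simp add: mult_ac)
    finally show ?thesis .
  qed
  have "exp (c * t) * ?E t \<le> exp (c * 0) * ?E 0"
  proof (rule DERIV_nonpos_imp_nonincreasing[where f = "\<lambda>t. exp (c * t) * ?E t", OF assms(2)])
    fix s :: real assume s: "0 \<le> s"
    let ?D = "exp (c * s) * (c * ?E s + (\<Sum>z\<in>S. trans_prob S q s x0 z * gen_apply S q h z))"
    have "((\<lambda>t. exp (c * t) * ?E t) has_real_derivative ?D) (at s)"
      by (rule derivative_eq_intros dE refl)+ (simp add: algebra_simps)
    moreover have "(\<Sum>z\<in>S. trans_prob S q s x0 z * gen_apply S q h z)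
       \<le> (\<Sum>z\<in>S. trans_prob S q s x0 z * (- c * h z))"
      using s by (intro sum_mono mult_left_mono assms(1) chain_trans_nonneg)
    then have "?D \<le> 0"
      by (intro mult_nonneg_nonpos) (simp_all add: sum_distrib_left sum_negf mult_ac)
    ultimately show "\<exists>y. ((\<lambda>t. exp (c * t) * ?E t) has_real_derivative y) (at s) \<and> y \<le> 0" by blast
  qed
  also have "\<dots> = h x0"
    using x0 chain_finite by (simp add: trans_prob_zero of_bool_def if_distrib[where f = "\<lambda>x. x * _"] cong: if_cong)
  finally show ?thesis by (simp add: exp_minus field_simps)
qed

lemma chain_right_continuous:
  assumes "\<omega> \<in> space M" "t \<ge> 0"
  obtains u where "u > t" "u \<in> \<rat>" "X u \<omega> = X t \<omega>"
proof -
  have "\<forall>\<^sub>F u in at_right t. X u \<omega> = X t \<omega>"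
    using chain assms unfolding markov_chain_def by blast
  then obtain b where "b > t" "\<And>u. t < u \<Longrightarrow> u < b \<Longrightarrow> X u \<omega> = X t \<omega>"
    unfolding eventually_at_right_field by blast
  moreover obtain u where "u \<in> \<rat>" "t < u" "u < b" using Rats_dense_in_real[OF \<open>b > t\<close>] by blast
  ultimately show thesis using that by blast
qed

text \<open>At a single later time this follows from the transition probabilities. The rational
  times involve only countably many null sets, and right-continuity extends the claim to all
  times.\<close>

lemma chain_absorbed:
  assumes s: "s \<in> S" and q: "\<And>y. y \<in> S \<Longrightarrow> q s y = 0" and "k \<ge> 0"
  shows "AE \<omega> in M. X k \<omega> = s \<longrightarrow> (\<forall>t\<ge>k. X t \<omega> = s)"
proof -
  have "AE \<omega> in M. X k \<omega> = s \<longrightarrow> X u \<omega> = s" if "u \<ge> k" for u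
  proof -
    have "AE \<omega> in M. \<not> (X k \<omega> = s \<and> X u \<omega> = y)" if "y \<in> S - {s}" for y
    proof (rule AE_I)
      have "{\<omega> \<in> space M. X k \<omega> = s \<and> X u \<omega> = y} = {\<omega> \<in> space M. X k \<omega> = s} \<inter> {\<omega> \<in> space M. X u \<omega> = y}"
        by auto
      then show "{\<omega> \<in> space M. X k \<omega> = s \<and> X u \<omega> = y} \<in> sets M"
        using chain_event_eq[of k] chain_event_eq[of u] \<open>u \<ge> k\<close> \<open>k \<ge> 0\<close> by auto
      have "prob {\<omega> \<in> space M. X k \<omega> = s \<and> X u \<omega> = y} = 0"
        using chain_transition[of k u s y] trans_prob_absorbing[of S y q s "u - k"] \<open>u \<ge> k\<close> \<open>k \<ge> 0\<close> that s q chain_finite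
        by auto
      then show "emeasure M {\<omega> \<in> space M. X k \<omega> = s \<and> X u \<omega> = y} = 0"
        by (simp add: emeasure_eq_measure)
    qed auto
    then have "AE \<omega> in M. \<forall>y\<in>S - {s}. \<not> (X k \<omega> = s \<and> X u \<omega> = y)"
      using chain_finite by (intro AE_finite_allI) auto
    then show ?thesis
      by (rule AE_mp) (use chain_space[of u] \<open>u \<ge> k\<close> \<open>k \<ge> 0\<close> in \<open>auto intro!: AE_I2\<close>)
  qed
  then have "AE \<omega> in M. \<forall>u\<in>\<rat> \<inter> {k..}. X k \<omega> = s \<longrightarrow> X u \<omega> = s"
    by (subst AE_ball_countable) (auto intro: countable_Int1 countable_rat)
  then show ?thesis
  proof (rule AE_mp, intro AE_I2 impI allI)
    fix \<omega> t assume \<omega>: "\<omega> \<in> space M" and all: "\<forall>u\<in>\<rat> \<inter> {k..}. X k \<omega> = s \<longrightarrow> X u \<omega> = s"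
      and Xk: "X k \<omega> = s" and t: "k \<le> t"
    obtain u where "u > t" "u \<in> \<rat>" "X u \<omega> = X t \<omega>"
      by (rule chain_right_continuous[OF \<omega>, of t]) (use t \<open>k \<ge> 0\<close> in auto)
    then show "X t \<omega> = s" using all Xk t by force
  qed
qed

text \<open>By right-continuity, being eventually constant can be tested at rational times.\<close>

lemma chain_limit_event: "{\<omega> \<in> space M. \<forall>\<^sub>F t in at_top. X t \<omega> = s} \<in> sets M"
proof -
  have "(\<forall>\<^sub>F t in at_top. X t \<omega> = s) \<longleftrightarrow> (\<exists>k::nat. \<forall>u::rat. real_of_rat u \<ge> real k \<longrightarrow> X (real_of_rat u) \<omega> = s)"
    if \<omega>: "\<omega> \<in> space M" for \<omega>
  proof
    assume "\<forall>\<^sub>F t in at_top. X t \<omega> = s"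
    then obtain N where "\<And>t. t \<ge> N \<Longrightarrow> X t \<omega> = s" unfolding eventually_at_top_linorder by blast
    then show "\<exists>k::nat. \<forall>u::rat. real_of_rat u \<ge> real k \<longrightarrow> X (real_of_rat u) \<omega> = s"
      using real_arch_simple[of N] order_trans by blast
  next
    assume "\<exists>k::nat. \<forall>u::rat. real_of_rat u \<ge> real k \<longrightarrow> X (real_of_rat u) \<omega> = s"
    then obtain k where k: "\<And>u. real_of_rat u \<ge> real k \<Longrightarrow> X (real_of_rat u) \<omega> = s" by blast
    have "X t \<omega> = s" if "t \<ge> real k" for t
    proof -
      have t0: "t \<ge> 0" using that by linarith
      obtain u where "u > t" "u \<in> \<rat>" "X u \<omega> = X t \<omega>"
        using chain_right_continuous[OF \<omega> t0] by blast
      then show ?thesis using k that by (auto elim!: Rats_cases)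
    qed
    then show "\<forall>\<^sub>F t in at_top. X t \<omega> = s" unfolding eventually_at_top_linorder by blast
  qed
  then have "{\<omega> \<in> space M. \<forall>\<^sub>F t in at_top. X t \<omega> = s} =
    {\<omega> \<in> space M. \<exists>k::nat. \<forall>u::rat. real_of_rat u \<ge> real k \<longrightarrow> X (real_of_rat u) \<omega> = s}" by auto
  also have "\<dots> \<in> sets M"
  proof (intro sets.sets_Collect_countable_Ex sets.sets_Collect_countable_All)
    fix k u
    show "{\<omega> \<in> space M. real_of_rat u \<ge> real k \<longrightarrow> X (real_of_rat u) \<omega> = s} \<in> sets M"
      using chain_event_eq[OF order_trans[OF of_nat_0_le_iff], of k "real_of_rat u" s]
      by (cases "real_of_rat u \<ge> real k") auto
  qed
  finally show ?thesis .
qed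

text \<open>If no limit exists, the description operator yields the junk value \<open>THE s. False\<close>, which
  does not depend on the sample point.\<close>

lemma chain_terminal_event:
  "{\<omega> \<in> space M. (THE s. \<forall>\<^sub>F t in at_top. X t \<omega> = s) \<in> B} \<in> sets M"
proof -
  let ?L = "\<lambda>s. {\<omega> \<in> space M. \<forall>\<^sub>F t in at_top. X t \<omega> = s}"
  let ?t = "\<lambda>\<omega>. THE s. \<forall>\<^sub>F t in at_top. X t \<omega> = s"
  have uniq: "s = s'" if "\<forall>\<^sub>F t in at_top. X t \<omega> = s" "\<forall>\<^sub>F t in at_top. X t \<omega> = s'" for \<omega> s s'
  proof -
    have "\<forall>\<^sub>F t in at_top :: real filter. s = s'" using that by eventually_elim auto
    then show ?thesis by simp
  qed
  have lim: "?t \<omega> = s" if "\<omega> \<in> ?L s" for \<omega> s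
    using that uniq by (intro the_equality) auto
  have nolim: "?t \<omega> = (THE s. False)" if "\<omega> \<in> space M - (\<Union>s\<in>S. ?L s)" for \<omega>
  proof -
    have "\<not> (\<forall>\<^sub>F t in at_top. X t \<omega> = s)" for s
    proof
      assume ev: "\<forall>\<^sub>F t in at_top. X t \<omega> = s"
      then obtain N where "\<And>t. t \<ge> N \<Longrightarrow> X t \<omega> = s" unfolding eventually_at_top_linorder by blast
      then have "X (max N 0) \<omega> = s" by simp
      then have "s \<in> S" using chain_space[of "max N 0" \<omega>] that by auto
      then show False using ev that by auto
    qed
    then show ?thesis by simp
  qed
  have "{\<omega> \<in> space M. ?t \<omega> \<in> B} = (\<Union>s\<in>S \<inter> B. ?L s) \<union>
      (if (THE s. False) \<in> B then space M - (\<Union>s\<in>S. ?L s) else {})" (is "?l = ?r")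
  proof (intro equalityI subsetI)
    fix \<omega> assume \<omega>: "\<omega> \<in> ?l"
    show "\<omega> \<in> ?r"
    proof (cases "\<omega> \<in> (\<Union>s\<in>S. ?L s)")
      case True
      then obtain s where "s \<in> S" "\<omega> \<in> ?L s" by blast
      then show ?thesis using \<omega> lim[of \<omega> s] by auto
    next
      case False
      then show ?thesis using \<omega> nolim[of \<omega>] by auto
    qed
  next
    fix \<omega> assume \<omega>: "\<omega> \<in> ?r"
    show "\<omega> \<in> ?l"
    proof (cases "\<omega> \<in> (\<Union>s\<in>S. ?L s)")
      case True
      then have "\<omega> \<in> (\<Union>s\<in>S \<inter> B. ?L s)" using \<omega> by (auto split: if_splits)
      then obtain s where "s \<in> S \<inter> B" "\<omega> \<in> ?L s" by blast
      then show ?thesis using lim[of \<omega> s] by auto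
    next
      case False
      then show ?thesis using \<omega> nolim[of \<omega>] by (auto split: if_splits)
    qed
  qed
  also have "\<dots> \<in> sets M"
    using chain_finite by (auto intro!: sets.Un sets.finite_UN sets.Diff chain_limit_event)
  finally show ?thesis .
qed

text \<open>\<open>I\<close> dominates the indicator of not being absorbed and its mean decays
  exponentially, which forces absorption in \<open>A\<close>. \<open>H\<close> dominates the
  indicator of \<open>B\<close> at absorbed states and its mean never exceeds \<open>H x0\<close>.
  The time \<open>k\<close> at which both are evaluated tends to infinity.\<close>

lemma chain_terminal_prob_le:
  fixes H I :: "'s \<Rightarrow> real"
  assumes A: "A \<subseteq> S" and abs: "\<And>x y. x \<in> A \<Longrightarrow> y \<in> S \<Longrightarrow> q x y = 0"
    and I: "\<And>x. x \<in> S \<Longrightarrow> I x \<ge> 0" "\<And>x. x \<in> S - A \<Longrightarrow> I x \<ge> 1"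
      "\<And>x. x \<in> S \<Longrightarrow> gen_apply S q I x \<le> - I x"
    and H: "\<And>x. x \<in> S \<Longrightarrow> H x \<ge> 0" "\<And>x. x \<in> A \<inter> B \<Longrightarrow> H x \<ge> 1"
      "\<And>x. x \<in> S \<Longrightarrow> gen_apply S q H x \<le> 0"
  shows "prob {\<omega> \<in> space M. (THE s. \<forall>\<^sub>F t in at_top. X t \<omega> = s) \<in> B} \<le> H x0"
proof -
  let ?t = "\<lambda>\<omega>. THE s. \<forall>\<^sub>F t in at_top. X t \<omega> = s"
  have bound: "prob {\<omega> \<in> space M. ?t \<omega> \<in> B} \<le> H x0 + exp (- real k) * I x0" for k :: nat
  proof -
    let ?K = "real k"
    have "AE \<omega> in M. \<forall>s\<in>A. X ?K \<omega> = s \<longrightarrow> (\<forall>t\<ge>?K. X t \<omega> = s)"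
      using A finite_subset[OF A chain_finite] abs
      by (intro AE_finite_allI chain_absorbed) auto
    \<comment> \<open>At time \<open>k\<close> the chain is either frozen in its terminal state or
      still outside \<open>A\<close>.\<close>
    then have "AE \<omega> in M. ?t \<omega> \<in> B \<longrightarrow> X ?K \<omega> \<in> (A \<inter> B) \<union> (S - A)"
    proof (rule AE_mp, intro AE_I2 impI)
      fix \<omega> assume \<omega>: "\<omega> \<in> space M" and all: "\<forall>s\<in>A. X ?K \<omega> = s \<longrightarrow> (\<forall>t\<ge>?K. X t \<omega> = s)"
        and B: "?t \<omega> \<in> B"
      have "?t \<omega> = X ?K \<omega>" if "X ?K \<omega> \<in> A"
      proof (rule the_equality)
        have *: "\<forall>t\<ge>?K. X t \<omega> = X ?K \<omega>" using all that by blast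
        then show ev: "\<forall>\<^sub>F t in at_top. X t \<omega> = X ?K \<omega>"
          unfolding eventually_at_top_linorder by blast
        show "s = X ?K \<omega>" if "\<forall>\<^sub>F t in at_top. X t \<omega> = s" for s
        proof -
          have "\<forall>\<^sub>F t in at_top :: real filter. s = X ?K \<omega>" using that ev by eventually_elim auto
          then show ?thesis by simp
        qed
      qed
      then show "X ?K \<omega> \<in> (A \<inter> B) \<union> (S - A)" using B chain_space[of ?K \<omega>] \<omega> by auto
    qed
    then have "prob {\<omega> \<in> space M. ?t \<omega> \<in> B} \<le> prob {\<omega> \<in> space M. X ?K \<omega> \<in> (A \<inter> B) \<union> (S - A)}"
      by (intro finite_measure_mono_AE chain_event) auto
    also have "\<dots> = (\<Sum>y\<in>(A \<inter> B) \<union> (S - A). trans_prob S q ?K x0 y)"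
      using A by (intro chain_prob_set) auto
    also have "\<dots> = (\<Sum>y\<in>A \<inter> B. trans_prob S q ?K x0 y) + (\<Sum>y\<in>S - A. trans_prob S q ?K x0 y)"
      using A chain_finite finite_subset[OF A] by (intro sum.union_disjoint) auto
    also have "(\<Sum>y\<in>A \<inter> B. trans_prob S q ?K x0 y) \<le> (\<Sum>y\<in>A \<inter> B. trans_prob S q ?K x0 y * H y)"
    proof (rule sum_mono)
      fix y assume "y \<in> A \<inter> B"
      then show "trans_prob S q ?K x0 y \<le> trans_prob S q ?K x0 y * H y"
        using mult_left_mono[OF H(2), of y "trans_prob S q ?K x0 y"] chain_trans_nonneg[of ?K y] A by auto
    qed
    also have "\<dots> \<le> (\<Sum>y\<in>S. trans_prob S q ?K x0 y * H y)"
      using A H(1) chain_finite chain_trans_nonneg[of ?K] by (intro sum_mono2) auto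
    also have "\<dots> \<le> exp (- 0 * ?K) * H x0"
      by (rule chain_decay) (use H(3) in auto)
    also have "(\<Sum>y\<in>S - A. trans_prob S q ?K x0 y) \<le> (\<Sum>y\<in>S - A. trans_prob S q ?K x0 y * I y)"
    proof (rule sum_mono)
      fix y assume "y \<in> S - A"
      then show "trans_prob S q ?K x0 y \<le> trans_prob S q ?K x0 y * I y"
        using mult_left_mono[OF I(2), of y "trans_prob S q ?K x0 y"] chain_trans_nonneg[of ?K y] by auto
    qed
    also have "\<dots> \<le> (\<Sum>y\<in>S. trans_prob S q ?K x0 y * I y)"
      using I(1) chain_finite chain_trans_nonneg[of ?K] by (intro sum_mono2) auto
    also have "\<dots> \<le> exp (- 1 * ?K) * I x0"
      by (rule chain_decay) (use I(3) in auto)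
    finally show ?thesis by simp
  qed
  have "(\<lambda>k. exp (- real k)) \<longlonglongrightarrow> 0"
    using filterlim_compose[OF exp_at_bot filterlim_compose[OF filterlim_uminus_at_bot_at_top filterlim_real_sequentially]]
    by simp
  then have "(\<lambda>k. H x0 + exp (- real k) * I x0) \<longlonglongrightarrow> H x0 + 0 * I x0"
    by (intro tendsto_intros)
  then show ?thesis using bound by (intro LIMSEQ_le_const[of _ "H x0"]) auto
qed

end

section \<open>Burning a path in a tree\<close>

lemma initial_config_in: "initial_config T \<in> T \<rightarrow>\<^sub>E UNIV"
  unfolding initial_config_def by auto

lemma cluster_subset:
  assumes "e \<in> T"
  shows "cluster T s e \<subseteq> T"
proof
  fix f assume "f \<in> cluster T s e"
  then have "(e, f) \<in> {(a, b). a \<in> inflammable_edges T s \<and> b \<in> inflammable_edges T s \<and> a \<inter> b \<noteq> {}}\<^sup>*"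
    unfolding cluster_def by simp
  then show "f \<in> T"
    using assms by (induction rule: rtrancl_induct) (auto simp: inflammable_edges_def)
qed

lemma burn_in:
  assumes "e \<in> T" "s \<in> T \<rightarrow>\<^sub>E UNIV"
  shows "burn T e s \<in> T \<rightarrow>\<^sub>E UNIV"
  using assms cluster_subset[OF assms(1), of s] unfolding burn_def by (auto simp: PiE_def extensional_def)

lemma gen_apply_fire_rate:
  assumes T: "finite T" and s: "s \<in> T \<rightarrow>\<^sub>E UNIV"
  shows "gen_apply (T \<rightarrow>\<^sub>E UNIV) (fire_rate T r) h s =
    (\<Sum>e\<in>inflammable_edges T s. h (s(e := Fireproof)) - h s)
    + r * (\<Sum>e\<in>inflammable_edges T s. h (burn T e s) - h s)"
proof -
  let ?S = "T \<rightarrow>\<^sub>E (UNIV :: estate set)" and ?I = "inflammable_edges T s"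
  have "finite (UNIV :: estate set)"
  proof -
    have "(UNIV :: estate set) = {Inflammable, Fireproof, Burnt}" using estate.exhaust by auto
    then show ?thesis by (metis finite.emptyI finite.insertI)
  qed
  then have S: "finite ?S" using T by (intro finite_PiE) auto
  have pick: "(\<Sum>y\<in>?S. c * of_bool (y = z) * (h y - h s)) = c * (h z - h s)" if "z \<in> ?S" for z c
    using sum.remove[OF S that, of "\<lambda>y. c * of_bool (y = z) * (h y - h s)"] by simp
  have "gen_apply ?S (fire_rate T r) h s = (\<Sum>y\<in>?S. fire_rate T r s y * (h y - h s))"
    by (rule gen_apply_eq[OF S s])
  also have "\<dots> = (\<Sum>e\<in>?I. \<Sum>y\<in>?S. 1 * of_bool (y = s(e := Fireproof)) * (h y - h s))
      + (\<Sum>e\<in>?I. \<Sum>y\<in>?S. r * of_bool (y = burn T e s) * (h y - h s))"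
    unfolding fire_rate_def distrib_right sum.distrib sum_distrib_right
    by (subst (1 2) sum.swap) simp
  also have "(\<Sum>e\<in>?I. \<Sum>y\<in>?S. 1 * of_bool (y = s(e := Fireproof)) * (h y - h s))
      = (\<Sum>e\<in>?I. 1 * (h (s(e := Fireproof)) - h s))"
    using s by (intro sum.cong refl pick) (auto simp: inflammable_edges_def PiE_def extensional_def)
  also have "(\<Sum>e\<in>?I. \<Sum>y\<in>?S. r * of_bool (y = burn T e s) * (h y - h s))
      = (\<Sum>e\<in>?I. r * (h (burn T e s) - h s))"
    using s by (intro sum.cong refl pick burn_in) (auto simp: inflammable_edges_def)
  finally show ?thesis by (simp add: sum_distrib_left fun_upd_def)
qed

lemma burn_inflammableD: "burn T e s g = Inflammable \<Longrightarrow> s g = Inflammable"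
  unfolding burn_def by (auto split: if_splits)

lemma burn_keeps_burnt: "s g = Burnt \<Longrightarrow> burn T e s g = Burnt"
  unfolding burn_def by auto

text \<open>Fireproofing alone removes inflammable edges at a rate equal to their number, and fires
  can only remove more. This is the function that forces absorption.\<close>

lemma gen_apply_card_inflammable:
  assumes T: "finite T" and s: "s \<in> T \<rightarrow>\<^sub>E UNIV" and "r \<ge> 0"
  shows "gen_apply (T \<rightarrow>\<^sub>E UNIV) (fire_rate T r) (\<lambda>s. real (card (inflammable_edges T s))) s
    \<le> - real (card (inflammable_edges T s))"
proof -
  let ?I = "inflammable_edges T s"
  have fin: "finite ?I" using T by (simp add: inflammable_edges_def)
  have "(\<Sum>e\<in>?I. real (card (inflammable_edges T (s(e := Fireproof)))) - real (card ?I)) = (\<Sum>e\<in>?I. -1)"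
  proof (rule sum.cong[OF refl])
    fix e assume e: "e \<in> ?I"
    have "inflammable_edges T (s(e := Fireproof)) = ?I - {e}"
      by (auto simp: inflammable_edges_def)
    moreover have "card ?I > 0" using e fin by (auto simp: card_gt_0_iff)
    ultimately show "real (card (inflammable_edges T (s(e := Fireproof)))) - real (card ?I) = -1"
      using e fin by (simp add: of_nat_diff)
  qed
  moreover have "(\<Sum>e\<in>?I. real (card (inflammable_edges T (burn T e s))) - real (card ?I)) \<le> (\<Sum>e\<in>?I. 0)"
  proof (rule sum_mono)
    fix e
    have "inflammable_edges T (burn T e s) \<subseteq> ?I"
      by (auto simp: inflammable_edges_def dest: burn_inflammableD)
    then show "real (card (inflammable_edges T (burn T e s))) - real (card ?I) \<le> 0"
      using fin by (simp add: card_mono)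
  qed
  then have "r * (\<Sum>e\<in>?I. real (card (inflammable_edges T (burn T e s))) - real (card ?I)) \<le> 0"
    using assms(3) by (intro mult_nonneg_nonpos) auto
  ultimately show ?thesis unfolding gen_apply_fire_rate[OF T s] by simp
qed

text \<open>A tree rooted at \<open>u0\<close> with parent function \<open>F\<close>, and a subtree \<open>R\<close> containing the root (in the
  application, the path from \<open>u0\<close> to another vertex); \<open>L\<close> is the distance to \<open>R\<close>.\<close>

locale spine =
  fixes V R :: "nat set" and u0 :: nat and F L :: "nat \<Rightarrow> nat"
  assumes finite_V: "finite V" and R_V: "R \<subseteq> V" and u0_R: "u0 \<in> R"
    and F_V: "v \<in> V - {u0} \<Longrightarrow> F v \<in> V"
    and F_R: "v \<in> R - {u0} \<Longrightarrow> F v \<in> R"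
    and L_R: "v \<in> R \<Longrightarrow> L v = 0"
    and L_F: "v \<in> V - R \<Longrightarrow> L v = Suc (L (F v))"
    and inj_edge: "inj_on (\<lambda>v. {v, F v}) (V - {u0})"
begin

abbreviation W :: "nat set" where "W \<equiv> V - {u0}"

definition up :: "nat \<Rightarrow> edge" where "up v = {v, F v}"

definition T :: "edge set" where "T = up ` W"

text \<open>Off \<open>R\<close> this equals \<open>L v\<close>; written through the parent, it also
  assigns length one to the edges inside \<open>R\<close>, where \<open>L v\<close> is zero.\<close>

definition link_length :: "nat \<Rightarrow> nat" where "link_length v = Suc (L (F v))"

text \<open>The edges from \<open>{v, F v}\<close> to \<open>R\<close>. A fire started at \<open>{v, F v}\<close> reaches \<open>R\<close> if and only if
  all of them are inflammable.\<close>

definition link :: "nat \<Rightarrow> edge set" where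
  "link v = (\<lambda>i. up ((F ^^ i) v)) ` {..<link_length v}"

lemma finite_T: "finite T"
  unfolding T_def using finite_V by simp

lemma inj_up: "inj_on up W"
  using inj_edge unfolding up_def .

lemma link_root: "v \<in> W \<Longrightarrow> F v \<in> R \<Longrightarrow> link v = {up v}"
  unfolding link_def link_length_def by (auto simp: L_R)

lemma F_notin_R:
  assumes "v \<in> W" "F v \<notin> R"
  shows "v \<notin> R" "F v \<in> W" "L v = Suc (L (F v))" "L (F v) = Suc (L (F (F v)))"
  using assms F_R[of v] F_V[of v] u0_R L_F[of v] L_F[of "F v"] by auto

lemma link_rec:
  assumes "v \<in> W" "F v \<notin> R"
  shows "link v = insert (up v) (link (F v))"
proof -
  have "link v = (\<lambda>i. up ((F ^^ i) v)) ` insert 0 (Suc ` {..<link_length (F v)})"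
    unfolding link_def link_length_def F_notin_R(4)[OF assms] by (simp add: lessThan_Suc_eq_insert_0)
  also have "\<dots> = insert (up v) (link (F v))"
    unfolding link_def by (simp add: image_image funpow_swap1)
  finally show ?thesis .
qed

lemma link_induct [consumes 1, case_names root step]:
  assumes "v \<in> W" and "\<And>v. v \<in> W \<Longrightarrow> F v \<in> R \<Longrightarrow> P v"
    and "\<And>v. v \<in> W \<Longrightarrow> F v \<notin> R \<Longrightarrow> P (F v) \<Longrightarrow> P v"
  shows "P v"
  using assms(1)
proof (induction "L (F v)" arbitrary: v rule: less_induct)
  case less
  show ?case
  proof (cases "F v \<in> R")
    case False
    show ?thesis
      by (rule assms(3)[OF less.prems False], rule less.hyps) (use F_notin_R[OF less.prems False] in auto)
  qed (use assms(2) less.prems in auto)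
qed

lemma finite_link: "finite (link v)"
  unfolding link_def by simp

lemma up_in_link: "up v \<in> link v"
  unfolding link_def link_length_def by (rule image_eqI[of _ _ 0]) auto

lemma link_subset_T: "v \<in> W \<Longrightarrow> link v \<subseteq> T"
  by (induction rule: link_induct) (auto simp: link_root link_rec T_def F_notin_R)

lemma link_vertex:
  assumes "v \<in> W" "g \<in> link v"
  shows "\<exists>w\<in>W. g = up w \<and> L w \<le> L v"
  using assms by (induction rule: link_induct) (auto simp: link_root link_rec F_notin_R(3) intro: le_SucI)

text \<open>The distance to \<open>R\<close> strictly decreases along the link, so no edge occurs
  twice.\<close>

lemma card_link: "v \<in> W \<Longrightarrow> card (link v) = link_length v"
proof (induction rule: link_induct)
  case (root v)
  then show ?case by (simp add: link_root link_length_def L_R)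
next
  case (step v)
  note Fv = F_notin_R[OF step(1,2)]
  have "up v \<notin> link (F v)"
  proof
    assume "up v \<in> link (F v)"
    then obtain w where w: "w \<in> W" "up v = up w" "L w \<le> L (F v)" using link_vertex Fv by blast
    then have "v = w" using inj_up step(1) by (auto dest: inj_onD)
    then show False using w Fv by simp
  qed
  then show ?case using step Fv by (simp add: link_rec finite_link link_length_def)
qed

lemma link_touches: "v \<in> W \<Longrightarrow> \<exists>g\<in>link v. g \<inter> R \<noteq> {}"
  by (induction rule: link_induct) (auto simp: link_root link_rec up_def)

text \<open>Edges sharing a vertex are equal, parent and child, or siblings. In each case the link
  of \<open>w\<close>, apart from its own edge, runs inside the link of \<open>v\<close>.\<close>

lemma link_adjacent:
  assumes v: "v \<in> W" and w: "w \<in> W" and adj: "up v \<inter> up w \<noteq> {}"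
  shows "link w \<subseteq> insert (up w) (link v)"
proof (cases "F w \<in> R")
  case True
  then show ?thesis using w by (simp add: link_root)
next
  case False
  note Fw = F_notin_R[OF w False]
  consider "v = w" | "v = F w" | "w = F v" | "F v = F w"
    using adj unfolding up_def by auto
  then show ?thesis
  proof cases
    case 3
    then show ?thesis using Fw link_rec[OF v] by auto
  next
    case 4
    then show ?thesis using False link_rec[OF v] link_rec[OF w] by auto
  qed (use link_rec[OF w False] in auto)
qed

lemma link_target:
  assumes "v \<in> W" "up v \<inter> R \<noteq> {}"
  shows "link v = {up v}"
proof -
  have "F v \<in> R" using assms F_R[of v] unfolding up_def by auto
  then show ?thesis using assms(1) by (rule link_root[rotated])
qed

section \<open>Which fires reach the spine\<close>

definition linked :: "config \<Rightarrow> nat set" where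
  "linked s = {v \<in> W. \<forall>g\<in>link v. s g = Inflammable}"

definition touched :: "config \<Rightarrow> bool" where
  "touched s \<longleftrightarrow> (\<exists>g\<in>T. g \<inter> R \<noteq> {} \<and> s g = Burnt)"

definition potential :: "config \<Rightarrow> real" where
  "potential s = (\<Sum>v\<in>linked s. 1 / real (link_length v))"

abbreviation contact :: "config \<Rightarrow> (edge \<times> edge) set" where
  "contact s \<equiv> {(a, b). a \<in> inflammable_edges T s \<and> b \<in> inflammable_edges T s \<and> a \<inter> b \<noteq> {}}"

lemma finite_linked: "finite (linked s)"
  unfolding linked_def using finite_V by simp

lemma linked_up: "v \<in> linked s \<Longrightarrow> up v \<in> inflammable_edges T s"
  using up_in_link unfolding linked_def inflammable_edges_def T_def by auto

lemma contact_sym: "(a, b) \<in> (contact s)\<^sup>* \<Longrightarrow> (b, a) \<in> (contact s)\<^sup>*"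
proof -
  have "sym (contact s)" by (auto simp: sym_def)
  then show "(a, b) \<in> (contact s)\<^sup>* \<Longrightarrow> (b, a) \<in> (contact s)\<^sup>*" by (meson sym_rtrancl symD)
qed

lemma linked_contact:
  assumes "v \<in> W" "v \<in> linked s" "g \<in> link v"
  shows "(up v, g) \<in> (contact s)\<^sup>*"
  using assms
proof (induction rule: link_induct)
  case (step v)
  note Fv = F_notin_R[OF step(1,2)]
  have lF: "F v \<in> linked s" using step.prems(1) link_rec[OF step(1,2)] Fv unfolding linked_def by auto
  have "(up v, up (F v)) \<in> contact s"
    using linked_up[OF step.prems(1)] linked_up[OF lF] by (auto simp: up_def)
  moreover have "g = up v \<or> (up (F v), g) \<in> (contact s)\<^sup>*"
    using step.prems(2) step.IH lF link_rec[OF step(1,2)] by auto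
  ultimately show ?case by (auto intro: converse_rtrancl_into_rtrancl)
qed (auto simp: link_root)

text \<open>An inflammable link is connected, so a fire that takes one of its edges takes all of
  them, including the one at \<open>R\<close>.\<close>

lemma burnt_link_touched:
  assumes v: "v \<in> linked s" and g: "g \<in> link v" "g \<in> cluster T s e"
  shows "touched (burn T e s)"
proof -
  have vW: "v \<in> W" using v by (simp add: linked_def)
  obtain f where f: "f \<in> link v" "f \<inter> R \<noteq> {}" using link_touches[OF vW] by blast
  have "(e, g) \<in> (contact s)\<^sup>*" using g(2) by (simp add: cluster_def)
  also have "(g, up v) \<in> (contact s)\<^sup>*" by (rule contact_sym[OF linked_contact[OF vW v g(1)]])
  also have "(up v, f) \<in> (contact s)\<^sup>*" by (rule linked_contact[OF vW v f(1)])
  finally have "f \<in> cluster T s e" by (simp add: cluster_def)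
  then show ?thesis using f link_subset_T[OF vW] unfolding touched_def burn_def by auto
qed

lemma linked_burn_touched: "v \<in> linked s \<Longrightarrow> touched (burn T (up v) s)"
  by (rule burnt_link_touched[of v s "up v"]) (auto simp: up_in_link cluster_def)

lemma linked_burn_subset: "linked (burn T e s) \<subseteq> linked s"
  unfolding linked_def using burn_inflammableD by blast

text \<open>The equality, rather than an inclusion, serves the escape bound, which would grow if the
  potential dropped.\<close>

lemma linked_burn_eq:
  assumes "\<not> touched (burn T e s)"
  shows "linked (burn T e s) = linked s"
proof
  show "linked s \<subseteq> linked (burn T e s)"
  proof
    fix v assume v: "v \<in> linked s"
    have "burn T e s g = Inflammable" if "g \<in> link v" for g
    proof -
      have "g \<notin> cluster T s e" using burnt_link_touched[OF v that] assms by blast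
      then show ?thesis using v that unfolding linked_def burn_def by auto
    qed
    then show "v \<in> linked (burn T e s)" using v unfolding linked_def by auto
  qed
qed (rule linked_burn_subset)

text \<open>Since adjacent edges have nearly the same link, being linked spreads through a cluster
  of inflammable edges.\<close>

lemma contact_linked:
  assumes "(up v, f) \<in> (contact s)\<^sup>*" "v \<in> linked s"
  shows "\<exists>w\<in>linked s. f = up w"
  using assms(1)
proof (induction rule: rtrancl_induct)
  case (step y z)
  then obtain w where w: "w \<in> linked s" "y = up w" by blast
  from step(2) obtain x where x: "x \<in> W" "z = up x" and z: "s z = Inflammable"
    unfolding T_def inflammable_edges_def by auto
  have "link x \<subseteq> insert (up x) (link w)"
    by (rule link_adjacent) (use w x step(2) in \<open>auto simp: linked_def\<close>)
  then have "x \<in> linked s" using w(1) x z unfolding linked_def by auto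
  then show ?case using x by blast
qed (use assms(2) in auto)

text \<open>The fire is traced backwards: the burning edge at \<open>R\<close> is its own link, and
  being linked spreads from it through the cluster to the edge set on fire.\<close>

lemma burn_touched_linked:
  assumes v: "v \<in> W" "up v \<in> inflammable_edges T s" and t: "touched (burn T (up v) s)" "\<not> touched s"
  shows "v \<in> linked s"
proof -
  obtain g where g: "g \<in> T" "g \<inter> R \<noteq> {}" "burn T (up v) s g = Burnt" using t(1) unfolding touched_def by blast
  then have "g \<in> cluster T s (up v)" using t(2) unfolding touched_def burn_def by (auto split: if_splits)
  then have c: "(up v, g) \<in> (contact s)\<^sup>*" unfolding cluster_def by simp
  then have "g \<in> inflammable_edges T s"
    using v(2) by (induction rule: rtrancl_induct) auto
  moreover obtain w where w: "w \<in> W" "g = up w" using g(1) T_def by auto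
  ultimately have "w \<in> linked s" using link_target[of w] g(2) unfolding linked_def inflammable_edges_def by auto
  with contact_sym[OF c] w obtain x where x: "x \<in> linked s" "up v = up x"
    using contact_linked by blast
  then have "v = x" using inj_up v(1) by (auto dest: inj_onD simp: linked_def)
  then show ?thesis using x by simp
qed

definition loss :: "config \<Rightarrow> edge \<Rightarrow> real" where
  "loss s e = (\<Sum>v\<in>linked s. of_bool (e \<in> link v) / real (link_length v))"

lemma loss_nonneg: "loss s e \<ge> 0"
  unfolding loss_def by (intro sum_nonneg) auto

lemma potential_nonneg: "potential s \<ge> 0"
  unfolding potential_def by (intro sum_nonneg) auto

lemma potential_fireproof: "potential (s(e := Fireproof)) = potential s - loss s e"
proof -
  have "linked (s(e := Fireproof)) = {v \<in> linked s. e \<notin> link v}"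
    unfolding linked_def by (auto split: if_splits)
  then have "potential (s(e := Fireproof)) = (\<Sum>v\<in>linked s. of_bool (e \<notin> link v) / real (link_length v))"
    unfolding potential_def using finite_linked by (auto simp: sum.inter_filter intro!: sum.cong)
  moreover have "potential s = (\<Sum>v\<in>linked s. of_bool (e \<notin> link v) / real (link_length v)) + loss s e"
    unfolding potential_def loss_def sum.distrib[symmetric] by (intro sum.cong) auto
  ultimately show ?thesis by simp
qed

text \<open>Double counting: a linked \<open>v\<close> loses \<open>1 / link_length v\<close> at
  each of the \<open>link_length v\<close> edges of its link, all of which are inflammable.\<close>

lemma sum_loss: "(\<Sum>e\<in>inflammable_edges T s. loss s e) = card (linked s)"
proof -
  have fin: "finite (inflammable_edges T s)" using finite_T by (simp add: inflammable_edges_def)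
  have "(\<Sum>e\<in>inflammable_edges T s. loss s e)
     = (\<Sum>v\<in>linked s. \<Sum>e\<in>inflammable_edges T s. of_bool (e \<in> link v) / real (link_length v))"
    unfolding loss_def by (rule sum.swap)
  also have "\<dots> = (\<Sum>v\<in>linked s. 1)"
  proof (rule sum.cong[OF refl])
    fix v assume v: "v \<in> linked s"
    then have vW: "v \<in> W" by (simp add: linked_def)
    have "{e \<in> inflammable_edges T s. e \<in> link v} = link v"
      using v link_subset_T[OF vW] unfolding linked_def inflammable_edges_def by auto
    then have "(\<Sum>e\<in>inflammable_edges T s. of_bool (e \<in> link v) :: real) = link_length v"
      using fin card_link[OF vW] by (simp add: of_bool_def sum.inter_filter[symmetric])
    then show "(\<Sum>e\<in>inflammable_edges T s. of_bool (e \<in> link v) / real (link_length v)) = 1"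
      by (simp add: sum_divide_distrib[symmetric] link_length_def)
  qed
  finally show ?thesis by simp
qed

lemma touched_fireproof:
  assumes "e \<in> inflammable_edges T s"
  shows "touched (s(e := Fireproof)) \<longleftrightarrow> touched s"
proof -
  have "(s(e := Fireproof)) g = Burnt \<longleftrightarrow> s g = Burnt" for g
    using assms by (auto simp: inflammable_edges_def)
  then show ?thesis unfolding touched_def by simp
qed

lemma touched_burn: "touched s \<Longrightarrow> touched (burn T e s)"
  unfolding touched_def using burn_keeps_burnt by blast

lemma sum_inflammable_linked:
  fixes c :: real
  shows "(\<Sum>e\<in>inflammable_edges T s. if e \<in> up ` linked s then c else 0) = card (linked s) * c"
proof -
  have fin: "finite (inflammable_edges T s)" using finite_T by (simp add: inflammable_edges_def)
  have "{e \<in> inflammable_edges T s. e \<in> up ` linked s} = up ` linked s"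
    using linked_up by blast
  moreover have "card (up ` linked s) = card (linked s)"
    by (rule card_image) (rule inj_on_subset[OF inj_up], auto simp: linked_def)
  ultimately show ?thesis using fin by (simp add: sum.inter_filter[symmetric])
qed

section \<open>The two superharmonic functions\<close>

definition touch_bound :: "real \<Rightarrow> config \<Rightarrow> real" where
  "touch_bound r s = (if touched s then 1 else r * potential s)"

definition escape_bound :: "real \<Rightarrow> config \<Rightarrow> real" where
  "escape_bound r s = (if touched s then 0 else 1 / (1 + r * potential s))"

text \<open>While \<open>R\<close> is untouched, fireproofing lowers the bound at rate
  \<open>r * card (linked s)\<close>. A fire raises it by at most one, and only if it starts at a
  linked edge, which happens at the same rate.\<close>

lemma touch_bound_superharmonic:
  assumes s: "s \<in> T \<rightarrow>\<^sub>E UNIV" and r: "r \<ge> 0"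
  shows "gen_apply (T \<rightarrow>\<^sub>E UNIV) (fire_rate T r) (touch_bound r) s \<le> 0"
proof (cases "touched s")
  case True
  then show ?thesis unfolding gen_apply_fire_rate[OF finite_T s] touch_bound_def
    by (simp add: touched_fireproof touched_burn)
next
  case False
  let ?I = "inflammable_edges T s"
  have "(\<Sum>e\<in>?I. touch_bound r (s(e := Fireproof)) - touch_bound r s) = (\<Sum>e\<in>?I. - (r * loss s e))"
    using False by (intro sum.cong) (auto simp: touch_bound_def touched_fireproof potential_fireproof algebra_simps)
  also have "\<dots> = - (r * card (linked s))"
    by (simp add: sum_negf sum_distrib_left[symmetric] sum_loss)
  finally have 1: "(\<Sum>e\<in>?I. touch_bound r (s(e := Fireproof)) - touch_bound r s) = - (r * card (linked s))" .
  have "(\<Sum>e\<in>?I. touch_bound r (burn T e s) - touch_bound r s)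
      \<le> (\<Sum>e\<in>?I. if e \<in> up ` linked s then 1 else 0)"
  proof (rule sum_mono)
    fix e assume e: "e \<in> ?I"
    then obtain v where v: "v \<in> W" "e = up v" unfolding inflammable_edges_def T_def by auto
    have pot: "potential (burn T e s) \<le> potential s"
      unfolding potential_def by (intro sum_mono2 finite_linked linked_burn_subset) auto
    have "0 \<le> r * potential s" using r potential_nonneg by simp
    show "touch_bound r (burn T e s) - touch_bound r s \<le> (if e \<in> up ` linked s then 1 else 0)"
    proof (cases "touched (burn T e s)")
      case True
      then have "v \<in> linked s" using burn_touched_linked v e False by blast
      then show ?thesis using v True False \<open>0 \<le> r * potential s\<close> by (simp add: touch_bound_def)
    next
      case False
      have "r * potential (burn T e s) \<le> r * potential s" using pot r by (rule mult_left_mono)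
      then show ?thesis using \<open>\<not> touched s\<close> False by (simp add: touch_bound_def)
    qed
  qed
  also have "\<dots> = card (linked s)" using sum_inflammable_linked[of s 1] by simp
  finally have "r * (\<Sum>e\<in>?I. touch_bound r (burn T e s) - touch_bound r s) \<le> r * card (linked s)"
    using r by (rule mult_left_mono)
  with 1 show ?thesis unfolding gen_apply_fire_rate[OF finite_T s] by simp
qed

text \<open>The balance is reversed: fireproofing \<open>e\<close> raises the value \<open>h\<close>
  by at most \<open>r * loss s e * h\<close>, in total at rate
  \<open>r * card (linked s) * h\<close>, while a fire at a linked edge destroys all of
  \<open>h\<close>, at the same total rate.\<close>

lemma escape_bound_superharmonic:
  assumes s: "s \<in> T \<rightarrow>\<^sub>E UNIV" and r: "r \<ge> 0"
  shows "gen_apply (T \<rightarrow>\<^sub>E UNIV) (fire_rate T r) (escape_bound r) s \<le> 0"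
proof (cases "touched s")
  case True
  then show ?thesis unfolding gen_apply_fire_rate[OF finite_T s] escape_bound_def
    by (simp add: touched_fireproof touched_burn)
next
  case False
  let ?I = "inflammable_edges T s" and ?h = "escape_bound r s"
  have h: "?h = 1 / (1 + r * potential s)" using False by (simp add: escape_bound_def)
  have rp: "0 \<le> r * potential s'" for s' using r potential_nonneg by simp
  have h0: "?h \<ge> 0" unfolding h using rp[of s] by simp
  have "(\<Sum>e\<in>?I. escape_bound r (s(e := Fireproof)) - ?h) \<le> (\<Sum>e\<in>?I. r * loss s e * ?h)"
  proof (rule sum_mono)
    fix e assume e: "e \<in> ?I"
    let ?p = "r * potential (s(e := Fireproof))" and ?a = "r * loss s e"
    have eq: "r * potential s = ?p + ?a" by (simp add: potential_fireproof algebra_simps)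
    have a: "?a \<ge> 0" using r loss_nonneg by simp
    note p = rp[of "s(e := Fireproof)"]
    \<comment> \<open>The exact increment carries a further factor, the value after the
      fireproofing, which is at most one.\<close>
    have "1 / (1 + ?p) - 1 / (1 + (?p + ?a)) = ?a / (1 + (?p + ?a)) * (1 / (1 + ?p))"
      using p a by (simp add: field_simps)
    also have "\<dots> \<le> ?a / (1 + (?p + ?a)) * 1"
      using p a by (intro mult_left_mono) auto
    finally show "escape_bound r (s(e := Fireproof)) - ?h \<le> ?a * ?h"
      using False e unfolding h eq by (simp add: escape_bound_def touched_fireproof)
  qed
  also have "\<dots> = r * card (linked s) * ?h"
    by (simp add: sum_distrib_left[symmetric] sum_distrib_right[symmetric] sum_loss)
  finally have 1: "(\<Sum>e\<in>?I. escape_bound r (s(e := Fireproof)) - ?h) \<le> r * card (linked s) * ?h" .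
  have "(\<Sum>e\<in>?I. escape_bound r (burn T e s) - ?h) \<le> (\<Sum>e\<in>?I. if e \<in> up ` linked s then - ?h else 0)"
  proof (rule sum_mono)
    fix e assume "e \<in> ?I"
    show "escape_bound r (burn T e s) - ?h \<le> (if e \<in> up ` linked s then - ?h else 0)"
    proof (cases "touched (burn T e s)")
      case True
      then show ?thesis using h0 by (simp add: escape_bound_def)
    next
      case F: False
      then have "e \<notin> up ` linked s" using linked_burn_touched by auto
      then show ?thesis using F False linked_burn_eq[OF F] by (simp add: escape_bound_def potential_def)
    qed
  qed
  also have "\<dots> = - (real (card (linked s)) * ?h)" using sum_inflammable_linked[of s "- ?h"] by simp
  finally have "r * (\<Sum>e\<in>?I. escape_bound r (burn T e s) - ?h) \<le> r * (- (real (card (linked s)) * ?h))"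
    using r by (rule mult_left_mono)
  with 1 show ?thesis unfolding gen_apply_fire_rate[OF finite_T s] by simp
qed

lemma potential_terminal: "inflammable_edges T s = {} \<Longrightarrow> potential s = 0"
  using linked_up unfolding potential_def by (metis empty_iff equals0I sum.empty)

lemma bounds_nonneg: "r \<ge> 0 \<Longrightarrow> touch_bound r s \<ge> 0" "r \<ge> 0 \<Longrightarrow> escape_bound r s \<ge> 0"
  using potential_nonneg[of s] by (auto simp: touch_bound_def escape_bound_def)

lemma potential_initial: "potential (initial_config T) = (\<Sum>v\<in>W. 1 / real (link_length v))"
proof -
  have "linked (initial_config T) = W"
    unfolding linked_def initial_config_def using link_subset_T by auto
  then show ?thesis by (simp add: potential_def)
qed

lemma not_touched_initial: "\<not> touched (initial_config T)"
  unfolding touched_def initial_config_def by auto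

end

section \<open>Trees as a path with a forest attached to it\<close>

definition path_edges :: "nat list \<Rightarrow> edge set" where
  "path_edges p = (\<lambda>i. {p ! i, p ! Suc i}) ` {i. Suc i < length p}"

definition parent_edges :: "nat set \<Rightarrow> (nat \<Rightarrow> nat) \<Rightarrow> edge set" where
  "parent_edges S f = (\<lambda>w. {w, f w}) ` S"

lemma adj_sym: "(a, b) \<in> (adj E)\<^sup>* \<Longrightarrow> (b, a) \<in> (adj E)\<^sup>*"
proof -
  have "sym (adj E)" by (auto simp: sym_def adj_def insert_commute)
  then show "(a, b) \<in> (adj E)\<^sup>* \<Longrightarrow> (b, a) \<in> (adj E)\<^sup>*" by (meson sym_rtrancl symD)
qed

lemma path_edges_subset_iff:
  "path_edges p \<subseteq> E \<longleftrightarrow> (\<forall>i. Suc i < length p \<longrightarrow> {p ! i, p ! Suc i} \<in> E)"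
  unfolding path_edges_def by auto

lemma path_edges_take: "path_edges (take k p) \<subseteq> path_edges p"
  unfolding path_edges_def by force

lemma path_edges_snoc:
  assumes "p \<noteq> []"
  shows "path_edges (p @ [x]) = insert {last p, x} (path_edges p)"
proof -
  have "{i. Suc i < length (p @ [x])} = insert (length p - 1) {i. Suc i < length p}"
    using assms by auto
  then show ?thesis using assms unfolding path_edges_def
    by (auto simp: nth_append last_conv_nth image_iff)
qed

lemma rtrancl_adj_path:
  assumes "(u, v) \<in> (adj E)\<^sup>*"
  shows "\<exists>p. p \<noteq> [] \<and> hd p = u \<and> last p = v \<and> distinct p \<and> path_edges p \<subseteq> E"
  using assms
proof (induction rule: rtrancl_induct)
  case base
  show ?case by (rule exI[of _ "[u]"]) (auto simp: path_edges_def)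
next
  case (step y z)
  then obtain p where p: "p \<noteq> []" "hd p = u" "last p = y" "distinct p" "path_edges p \<subseteq> E" by blast
  show ?case
  proof (cases "z \<in> set p")
    case True
    then obtain i where i: "i < length p" "p ! i = z" by (auto simp: in_set_conv_nth)
    let ?q = "take (Suc i) p"
    have "last ?q = z" using i by (simp add: take_Suc_conv_app_nth)
    moreover have "hd ?q = u" using p by (cases p) auto
    ultimately show ?thesis using p path_edges_take[of "Suc i" p] by (intro exI[of _ ?q]) auto
  next
    case False
    then show ?thesis using p step(2) by (intro exI[of _ "p @ [z]"]) (auto simp: path_edges_snoc adj_def)
  qed
qed

lemma path_rtrancl:
  assumes "path_edges p \<subseteq> E" "i < length p"
  shows "(p ! 0, p ! i) \<in> (adj E)\<^sup>*"
  using assms(2)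
proof (induction i)
  case (Suc i)
  then have "(p ! i, p ! Suc i) \<in> adj E" using assms(1) by (auto simp: path_edges_subset_iff adj_def)
  then show ?case using Suc by (auto intro: rtrancl_into_rtrancl)
qed simp

text \<open>A missing edge would close the path that joins its ends in \<open>E\<close> to a cycle
  of \<open>T\<close>; the path has at least three vertices because it avoids that edge.\<close>

lemma tree_minimal_connected:
  assumes T: "is_tree V T" and E: "E \<subseteq> T" "is_connected V E"
  shows "E = T"
proof (rule ccontr)
  assume "E \<noteq> T"
  then obtain e where e: "e \<in> T" "e \<notin> E" using E(1) by blast
  then have "e \<subseteq> V" "card e = 2" using T unfolding is_tree_def simple_graph_def by auto
  then obtain a b where ab: "e = {a, b}" "a \<noteq> b" "a \<in> V" "b \<in> V" by (auto simp: card_2_iff)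
  then have "(a, b) \<in> (adj E)\<^sup>*" using E(2) unfolding is_connected_def by blast
  then obtain p where p: "p \<noteq> []" "hd p = a" "last p = b" "distinct p" "path_edges p \<subseteq> E"
    using rtrancl_adj_path by blast
  have p0: "p ! 0 = a" and pl: "p ! (length p - 1) = b" using p by (auto simp: hd_conv_nth last_conv_nth)
  have len: "length p \<ge> 3"
  proof (rule ccontr)
    assume "\<not> length p \<ge> 3"
    moreover have "length p \<noteq> 0" using p by auto
    ultimately have "length p = 1 \<or> length p = 2" by linarith
    then show False
    proof
      assume "length p = 1"
      then show False using p0 pl ab by auto
    next
      assume "length p = 2"
      then have "{p ! 0, p ! 1} \<in> E" using p(5) by (auto simp: path_edges_subset_iff)
      then show False using p0 pl \<open>length p = 2\<close> ab e by auto
    qed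
  qed
  have "is_cycle T p"
    unfolding is_cycle_def
  proof (intro conjI len p(4) allI impI)
    fix i assume i: "i < length p"
    show "{p ! i, p ! ((i + 1) mod length p)} \<in> T"
    proof (cases "Suc i < length p")
      case True
      then show ?thesis using p(5) E(1) by (auto simp: path_edges_subset_iff)
    next
      case False
      then have "i + 1 = length p" using i by linarith
      then have "i = length p - 1" "(i + 1) mod length p = 0" by simp_all
      then show ?thesis using p0 pl ab e by (simp add: insert_commute)
    qed
  qed
  then show False using T unfolding is_tree_def by blast
qed

text \<open>Off the path, the parent is a neighbour closer to the path. The path and the parent
  edges already connect \<open>V\<close>, so by minimality they exhaust \<open>T\<close>.\<close>

lemma tree_path_forest:
  assumes T: "is_tree V T" and u: "u \<in> V" and v: "v \<in> V"
  shows "\<exists>p f. p \<noteq> [] \<and> hd p = u \<and> last p = v \<and> distinct p \<and> set p \<subseteq> V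
    \<and> f \<in> forests (set p) (V - set p) \<and> T = path_edges p \<union> parent_edges (V - set p) f"
proof -
  have sg: "\<And>a b. {a, b} \<in> T \<Longrightarrow> a \<in> V \<and> b \<in> V" and con: "is_connected V T"
    using T unfolding is_tree_def simple_graph_def by auto
  have "(u, v) \<in> (adj T)\<^sup>*" using con u v unfolding is_connected_def by blast
  then obtain p where p: "p \<noteq> []" "hd p = u" "last p = v" "distinct p" "path_edges p \<subseteq> T"
    using rtrancl_adj_path by blast
  have p0: "p ! 0 = u" using p by (simp add: hd_conv_nth)
  have pV: "set p \<subseteq> V"
  proof
    fix x assume "x \<in> set p"
    then obtain i where i: "i < length p" "p ! i = x" by (auto simp: in_set_conv_nth)
    show "x \<in> V"
    proof (cases i)
      case 0
      then show ?thesis using i p0 u by simp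
    next
      case (Suc j)
      then have "{p ! j, p ! i} \<in> T" using p(5) i by (auto simp: path_edges_subset_iff)
      then show ?thesis using sg i by blast
    qed
  qed
  let ?R = "set p"
  define reach where "reach w k \<longleftrightarrow> (\<exists>x\<in>?R. (w, x) \<in> adj T ^^ k)" for w k
  define L where "L w = (LEAST k. reach w k)" for w
  have uR: "u \<in> ?R" using p by auto
  have ex: "\<exists>k. reach w k" if "w \<in> V" for w
  proof -
    have "(w, u) \<in> (adj T)\<^sup>*" using con that u unfolding is_connected_def by blast
    then show ?thesis using uR unfolding reach_def rtrancl_power by blast
  qed
  have L0: "L w = 0" if "w \<in> ?R" for w
    unfolding L_def by (rule Least_equality) (use that in \<open>auto simp: reach_def\<close>)
  have step: "\<exists>x. {w, x} \<in> T \<and> L w = Suc (L x)" if w: "w \<in> V - ?R" for w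
  proof -
    have rw: "reach w (L w)" unfolding L_def using ex[of w] w by (auto intro: LeastI_ex)
    have "L w \<noteq> 0"
    proof
      assume "L w = 0"
      then show False using rw w unfolding reach_def by auto
    qed
    then obtain k where k: "L w = Suc k" using not0_implies_Suc by blast
    then obtain x y where x: "(w, x) \<in> adj T" "(x, y) \<in> adj T ^^ k" "y \<in> ?R"
      using rw unfolding reach_def by (metis relpow_Suc_D2)
    have rx: "reach x k" unfolding reach_def using x by blast
    then have "L x \<le> k" unfolding L_def by (rule Least_le)
    moreover have "L w \<le> Suc (L x)"
    proof -
      have "reach x (L x)" unfolding L_def using rx by (rule LeastI)
      then have "reach w (Suc (L x))" unfolding reach_def using x(1) by (meson relpow_Suc_I2)
      then show ?thesis unfolding L_def[of w] by (rule Least_le)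
    qed
    ultimately show ?thesis using k x(1) by (intro exI[of _ x]) (auto simp: adj_def)
  qed
  define f where "f = restrict (\<lambda>w. SOME x. {w, x} \<in> T \<and> L w = Suc (L x)) (V - ?R)"
  have f: "{w, f w} \<in> T" "L w = Suc (L (f w))" if "w \<in> V - ?R" for w
    using someI_ex[OF step[OF that]] that unfolding f_def by auto
  have ff: "f \<in> forests ?R (V - ?R)"
  proof (rule forestsI[where L = L])
    show "f \<in> V - ?R \<rightarrow>\<^sub>E ?R \<union> (V - ?R)"
      using f(1) sg unfolding f_def by (auto simp: PiE_def)
  qed (use L0 f in auto)
  let ?E = "path_edges p \<union> parent_edges (V - ?R) f"
  have "?E \<subseteq> T" using p(5) f(1) by (auto simp: parent_edges_def)
  moreover have "is_connected V ?E"
  proof -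
    have "(u, w) \<in> (adj ?E)\<^sup>*" if "w \<in> V" for w
      using that
    proof (induction "L w" arbitrary: w rule: less_induct)
      case less
      show ?case
      proof (cases "w \<in> ?R")
        case True
        then obtain i where "i < length p" "p ! i = w" by (auto simp: in_set_conv_nth)
        then show ?thesis using path_rtrancl[of p ?E i] p0 by auto
      next
        case False
        then have w: "w \<in> V - ?R" using less.prems by blast
        have "f w \<in> V" using f(1)[OF w] sg by blast
        then have "(u, f w) \<in> (adj ?E)\<^sup>*" using f(2)[OF w] by (intro less.hyps) auto
        moreover have "(f w, w) \<in> adj ?E" using w by (auto simp: adj_def parent_edges_def insert_commute)
        ultimately show ?thesis by (rule rtrancl_into_rtrancl)
      qed
    qed
    then show ?thesis unfolding is_connected_def using adj_sym rtrancl_trans by metis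
  qed
  ultimately have "?E = T" using tree_minimal_connected[OF T] by blast
  then show ?thesis using p pV ff by blast
qed

text \<open>Two parent functions could differ only by exchanging child and parent on some edge. For
  the parent \<open>w = f v\<close>, induction on the level would give \<open>f w = g w = v\<close>,
  against the order of levels.\<close>

lemma parent_edges_inj:
  assumes f: "f \<in> forests R S" and g: "g \<in> forests R S" and RS: "R \<inter> S = {}"
    and eq: "parent_edges S f = parent_edges S g"
  shows "f = g"
proof -
  have "f v = g v" if "v \<in> S" for v
    using that
  proof (induction "level f R v" arbitrary: v rule: less_induct)
    case less
    show ?case
    proof (rule ccontr)
      assume ne: "f v \<noteq> g v"
      have "{v, f v} \<in> parent_edges S g" using eq less.prems unfolding parent_edges_def by blast
      then obtain w where w: "w \<in> S" "{v, f v} = {w, g w}" unfolding parent_edges_def by auto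
      then have fv: "f v = w" "g w = v" using ne by (auto simp: doubleton_eq_iff)
      have lv: "level f R v = Suc (level f R w)" using forests_levelD(2)[OF f RS less.prems] fv by simp
      then have "f w = v" using less.hyps[of w] w fv by simp
      then show False using forests_levelD(2)[OF f RS w(1)] lv by simp
    qed
  qed
  then show ?thesis using f g unfolding forests_def by (auto intro!: extensionalityI[of f S g] simp: PiE_def)
qed

text \<open>On a cycle, a vertex of maximal level would have both of its neighbours as its
  parent.\<close>

lemma forest_is_tree:
  assumes f: "f \<in> forests {u} (V - {u})" and u: "u \<in> V"
  shows "is_tree V (parent_edges (V - {u}) f)"
proof -
  let ?E = "parent_edges (V - {u}) f" and ?L = "level f {u}"
  note fl = forests_levelD[OF f, simplified]
  have fV: "f w \<in> V" if "w \<in> V - {u}" for w using fl(1)[of w] that u by auto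
  have Lf: "?L w = Suc (?L (f w))" if "w \<in> V - {u}" for w using fl(2)[of w] that by auto
  have edge: "(x \<in> V - {u} \<and> y = f x) \<or> (y \<in> V - {u} \<and> x = f y)" if "{x, y} \<in> ?E" for x y
    using that unfolding parent_edges_def by (auto simp: doubleton_eq_iff)
  have "simple_graph V ?E"
    unfolding simple_graph_def parent_edges_def
  proof (intro ballI, elim imageE)
    fix e w assume "e = {w, f w}" "w \<in> V - {u}"
    moreover then have "w \<noteq> f w" using Lf[of w] by auto
    ultimately show "e \<subseteq> V \<and> card e = 2" using fV by auto
  qed
  moreover have "is_connected V ?E"
  proof -
    have "(u, w) \<in> (adj ?E)\<^sup>*" if "w \<in> V" for w
      using that
    proof (induction "?L w" arbitrary: w rule: less_induct)
      case less
      show ?case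
      proof (cases "w = u")
        case False
        then have w: "w \<in> V - {u}" using less.prems by blast
        have "(u, f w) \<in> (adj ?E)\<^sup>*" using Lf[OF w] fV[OF w] by (intro less.hyps) auto
        moreover have "(f w, w) \<in> adj ?E" using w by (auto simp: adj_def parent_edges_def insert_commute)
        ultimately show ?thesis by (rule rtrancl_into_rtrancl)
      qed simp
    qed
    then show ?thesis unfolding is_connected_def using adj_sym rtrancl_trans by metis
  qed
  moreover have "\<not> is_cycle ?E vs" for vs
  proof
    assume cyc: "is_cycle ?E vs"
    then have len: "length vs \<ge> 3" and dist: "distinct vs"
      and E: "\<And>i. i < length vs \<Longrightarrow> {vs ! i, vs ! ((i + 1) mod length vs)} \<in> ?E"
      unfolding is_cycle_def by auto
    let ?n = "length vs"
    have ne: "{..<?n} \<noteq> {}" using len by (auto simp: lessThan_empty_iff)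
    have "Max ((\<lambda>i. ?L (vs ! i)) ` {..<?n}) \<in> (\<lambda>i. ?L (vs ! i)) ` {..<?n}"
      using ne by (intro Max_in) auto
    then obtain i where "i < ?n" "?L (vs ! i) = Max ((\<lambda>i. ?L (vs ! i)) ` {..<?n})" by auto
    then have i: "i < ?n" "\<And>j. j < ?n \<Longrightarrow> ?L (vs ! j) \<le> ?L (vs ! i)" by auto
    \<comment> \<open>\<open>j\<close> and \<open>k\<close> are the cyclic predecessor and successor
      of \<open>i\<close>; they differ because the cycle has at least three vertices.\<close>
    define j where "j = (if i = 0 then ?n - 1 else i - 1)"
    define k where "k = (i + 1) mod ?n"
    have k: "k = (if i = ?n - 1 then 0 else i + 1)" unfolding k_def using i len by (auto simp: mod_Suc)
    have j: "(j + 1) mod ?n = i" "j < ?n" using i len unfolding j_def by auto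
    have kn: "k < ?n" using len i k by (auto split: if_splits)
    have jk: "j \<noteq> k" using len i unfolding j_def k by (auto split: if_splits)
    have up: "vs ! x = f (vs ! i)" if "x < ?n" "{vs ! i, vs ! x} \<in> ?E" for x
      using edge[OF that(2)] Lf[of "vs ! x"] i(2)[OF that(1)] by auto
    have "vs ! j = f (vs ! i)" using up[OF j(2)] E[OF j(2)] j(1) by (simp add: insert_commute)
    moreover have "vs ! k = f (vs ! i)" using up[OF kn] E[OF i(1)] by (simp add: k_def)
    ultimately show False using nth_eq_iff_index_eq[OF dist j(2) kn] jk by simp
  qed
  ultimately show ?thesis unfolding is_tree_def by blast
qed

lemma finite_cayley_trees: "finite (cayley_trees n)"
proof (rule finite_subset)
  show "cayley_trees n \<subseteq> Pow (Pow {1..n})"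
    unfolding cayley_trees_def is_tree_def simple_graph_def by auto
qed simp

text \<open>The lower bound in Cayley's formula, with the exponent \<open>n - 2\<close> multiplied
  out: distinct forests with the single root 1 give distinct trees.\<close>

lemma card_cayley_trees_ge:
  assumes "n \<ge> 2"
  shows "real (card (cayley_trees n)) * (real n)\<^sup>2 \<ge> real n ^ n"
proof -
  let ?S = "{1..n} - {1}"
  have "parent_edges ?S ` forests {1} ?S \<subseteq> cayley_trees n"
    using forest_is_tree[of _ 1 "{1..n}"] assms unfolding cayley_trees_def by auto
  moreover have "inj_on (parent_edges ?S) (forests {1} ?S)"
    by (rule inj_onI) (rule parent_edges_inj, auto)
  ultimately have "card (forests {1::nat} ?S) \<le> card (cayley_trees n)"
    using card_inj_on_le finite_cayley_trees by blast
  moreover have "card (forests {1::nat} ?S) * n = n ^ (n - 1)"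
    using card_forests[of "{1::nat}" ?S] assms by simp
  ultimately have "n ^ (n - 1) * n \<le> card (cayley_trees n) * n * n"
    by (metis mult_le_mono1)
  also have "n ^ (n - 1) * n = n ^ n" using assms by (metis power_minus_mult not_numeral_le_zero gr0I)
  finally have "real (n ^ n) \<le> real (card (cayley_trees n) * n * n)" by (simp only: of_nat_le_iff)
  then show ?thesis by (simp add: power2_eq_square mult_ac)
qed

section \<open>A path in a tree as a spine\<close>

definition fireproof_linked :: "nat set \<Rightarrow> edge set \<Rightarrow> config \<Rightarrow> nat \<Rightarrow> nat \<Rightarrow> bool" where
  "fireproof_linked V T s u v \<longleftrightarrow>
     u \<in> fireproof_vertices V T s \<and> v \<in> fireproof_vertices V T s \<and>
     (u, v) \<in> (adj (fireproof_forest_edges V T s))\<^sup>*"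

locale path_tree =
  fixes V :: "nat set" and p :: "nat list" and f :: "nat \<Rightarrow> nat"
  assumes fin: "finite V" and p_ne: "p \<noteq> []" and p_dist: "distinct p" and p_V: "set p \<subseteq> V"
    and f_forest: "f \<in> forests (set p) (V - set p)"
begin

definition pos :: "nat \<Rightarrow> nat" where "pos = inv_into {..<length p} ((!) p)"

text \<open>The path is oriented towards \<open>hd p\<close>. Truncated subtraction makes
  \<open>hd p\<close> its own parent, but \<open>hd p\<close> indexes no edge.\<close>

definition par :: "nat \<Rightarrow> nat" where
  "par v = (if v \<in> set p then p ! (pos v - 1) else f v)"

lemma pos_nth: "i < length p \<Longrightarrow> pos (p ! i) = i"
  unfolding pos_def by (rule inv_into_f_f) (use p_dist in \<open>auto simp: inj_on_nth\<close>)

lemma par_nth: "Suc i < length p \<Longrightarrow> par (p ! Suc i) = p ! i"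
  unfolding par_def by (simp add: pos_nth)

lemma on_path_cases:
  assumes "v \<in> set p" "v \<noteq> hd p"
  obtains i where "Suc i < length p" "v = p ! Suc i"
proof -
  obtain j where j: "j < length p" "v = p ! j" using assms(1) by (auto simp: in_set_conv_nth)
  then have "j \<noteq> 0" using assms(2) p_ne by (metis hd_conv_nth)
  then obtain i where "j = Suc i" using not0_implies_Suc by blast
  then show thesis using j that by blast
qed

lemma level_f:
  assumes "v \<in> V - set p"
  shows "par v = f v" "f v \<in> V" "level f (set p) v = Suc (level f (set p) (par v))"
  using forests_levelD[OF f_forest _ assms] assms p_V unfolding par_def by auto

text \<open>The shift by \<open>length p\<close> places vertices off the path above all path
  positions. Depth then decreases towards the parent everywhere but at \<open>hd p\<close>, so no
  two vertices are parents of each other.\<close>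

definition depth :: "nat \<Rightarrow> nat" where
  "depth v = (if v \<in> set p then pos v else length p + level f (set p) v)"

lemma pos_less: "v \<in> set p \<Longrightarrow> pos v < length p"
  by (auto simp: in_set_conv_nth pos_nth)

lemma depth_par:
  assumes "v \<in> V - {hd p}"
  shows "depth (par v) < depth v"
proof (cases "v \<in> set p")
  case True
  then obtain i where "Suc i < length p" "v = p ! Suc i" using on_path_cases assms by blast
  then show ?thesis by (simp add: par_nth depth_def pos_nth)
next
  case False
  then show ?thesis using assms level_f[of v] pos_less[of "par v"] unfolding depth_def by auto
qed

sublocale spine V "set p" "hd p" par "level f (set p)"
proof
  show "finite V" "set p \<subseteq> V" "hd p \<in> set p" using fin p_V p_ne by auto
  show par_R: "par v \<in> set p" if "v \<in> set p - {hd p}" for v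
    using that by (auto elim!: on_path_cases simp: par_nth)
  show "par v \<in> V" if "v \<in> V - {hd p}" for v
    using that par_R[of v] level_f[of v] p_V by (cases "v \<in> set p") auto
  show "level f (set p) v = 0" if "v \<in> set p" for v using that by (rule level_root)
  show "level f (set p) v = Suc (level f (set p) (par v))" if "v \<in> V - set p" for v
    using that by (rule level_f)
  show "inj_on (\<lambda>v. {v, par v}) (V - {hd p})"
  proof (rule inj_onI, rule ccontr)
    fix v w assume *: "v \<in> V - {hd p}" "w \<in> V - {hd p}" "{v, par v} = {w, par w}" "v \<noteq> w"
    then have "par v = w" "par w = v" by (auto simp: doubleton_eq_iff)
    then show False using depth_par[OF *(1)] depth_par[OF *(2)] by simp
  qed
qed

lemma T_eq: "T = path_edges p \<union> parent_edges (V - set p) f"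
proof -
  have "up ` (set p - {hd p}) = path_edges p"
  proof (intro equalityI subsetI)
    fix e assume "e \<in> up ` (set p - {hd p})"
    then obtain v where v: "v \<in> set p" "v \<noteq> hd p" "e = up v" by auto
    then obtain i where "Suc i < length p" "v = p ! Suc i" using on_path_cases by blast
    then show "e \<in> path_edges p"
      using v(3) unfolding path_edges_def by (auto simp: up_def par_nth insert_commute)
  next
    fix e assume "e \<in> path_edges p"
    then obtain i where i: "Suc i < length p" "e = {p ! i, p ! Suc i}" unfolding path_edges_def by auto
    then have "e = up (p ! Suc i)" by (auto simp: up_def par_nth)
    moreover have "p ! Suc i \<noteq> hd p"
      using i p_ne p_dist by (simp add: hd_conv_nth nth_eq_iff_index_eq)
    ultimately show "e \<in> up ` (set p - {hd p})" using i by auto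
  qed
  moreover have "up ` (V - set p) = parent_edges (V - set p) f"
    unfolding parent_edges_def by (intro image_cong) (auto simp: up_def level_f)
  moreover have "W = (set p - {hd p}) \<union> (V - set p)" using p_V p_ne by auto
  ultimately show ?thesis unfolding T_def by (simp add: image_Un)
qed

lemma sum_link_length:
  "(\<Sum>v\<in>W. 1 / real (link_length v)) = real (length p - 1) + (\<Sum>v\<in>V - set p. 1 / real (level f (set p) v))"
proof -
  have "W = (set p - {hd p}) \<union> (V - set p)" using p_V p_ne by auto
  then have "(\<Sum>v\<in>W. 1 / real (link_length v)) =
    (\<Sum>v\<in>set p - {hd p}. 1 / real (link_length v)) + (\<Sum>v\<in>V - set p. 1 / real (link_length v))"
    using fin by (simp only:) (rule sum.union_disjoint, auto)
  also have "(\<Sum>v\<in>set p - {hd p}. 1 / real (link_length v)) = (\<Sum>v\<in>set p - {hd p}. 1)"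
    by (intro sum.cong) (auto simp: link_length_def level_root F_R)
  also have "\<dots> = real (length p - 1)"
    using p_ne p_dist by (simp add: card_Diff_singleton distinct_card)
  also have "(\<Sum>v\<in>V - set p. 1 / real (link_length v)) = (\<Sum>v\<in>V - set p. 1 / real (level f (set p) v))"
    by (intro sum.cong refl) (auto simp: link_length_def level_f(3))
  finally show ?thesis .
qed

lemma touch_bound_initial_le:
  assumes "r \<ge> 0"
  shows "touch_bound r (initial_config T) \<le> r * (real (length p) + (\<Sum>v\<in>V - set p. 1 / real (level f (set p) v)))"
  unfolding touch_bound_def using not_touched_initial assms
  by (auto simp: potential_initial sum_link_length intro!: mult_left_mono)

lemma escape_bound_initial_le:
  assumes "r \<ge> 0"
  shows "escape_bound r (initial_config T) \<le> 1 / (1 + r * (\<Sum>v\<in>V - set p. 1 / real (level f (set p) v)))"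
proof -
  let ?A = "\<Sum>v\<in>V - set p. 1 / real (level f (set p) v)"
  have "0 \<le> r * ?A" using assms by (intro mult_nonneg_nonneg sum_nonneg) auto
  moreover have "r * ?A \<le> r * (real (length p - 1) + ?A)" using assms by (intro mult_left_mono) auto
  ultimately show ?thesis
    unfolding escape_bound_def using not_touched_initial
    by (auto simp: potential_initial sum_link_length intro!: divide_left_mono)
qed

text \<open>In a terminal configuration every edge at the path that is not burnt is fireproof, so
  the whole path survives in the fireproof forest.\<close>

lemma untouched_linked:
  assumes "inflammable_edges T s = {}" and "\<not> touched s"
  shows "fireproof_linked V T s (hd p) (last p)"
proof -
  have fp: "s e = Fireproof" if "e \<in> T" "e \<inter> set p \<noteq> {}" for e
    using assms that unfolding inflammable_edges_def touched_def by (cases "s e") auto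
  have R: "set p \<subseteq> fireproof_vertices V T s"
    unfolding fireproof_vertices_def using fp p_V by auto
  have "path_edges p \<subseteq> fireproof_forest_edges V T s"
  proof
    fix e assume e: "e \<in> path_edges p"
    then have "e \<subseteq> set p" "e \<noteq> {}" unfolding path_edges_def by auto
    moreover have "e \<in> T" using e T_eq by blast
    ultimately show "e \<in> fireproof_forest_edges V T s"
      unfolding fireproof_forest_edges_def using fp[of e] R by auto
  qed
  then have "(p ! 0, p ! (length p - 1)) \<in> (adj (fireproof_forest_edges V T s))\<^sup>*"
    using p_ne by (intro path_rtrancl) auto
  then show ?thesis
    using R p_ne unfolding fireproof_linked_def by (auto simp: hd_conv_nth last_conv_nth)
qed

text \<open>Every walk from \<open>hd p\<close> to \<open>last p\<close> visits all vertices of \<open>p\<close>: the position of the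
  projection to \<open>p\<close> changes by at most one in each step, and only along edges of \<open>p\<close>.\<close>

definition proj_pos :: "nat \<Rightarrow> nat" where
  "proj_pos v = pos ((f ^^ level f (set p) v) v)"

lemma proj_pos_path: "v \<in> set p \<Longrightarrow> proj_pos v = pos v"
  unfolding proj_pos_def by (simp add: level_root)

lemma proj_pos_off_path: "v \<in> V - set p \<Longrightarrow> proj_pos (par v) = proj_pos v"
  unfolding proj_pos_def using level_f[of v] by (simp add: funpow_swap1)

lemma linked_untouched:
  assumes "fireproof_linked V T s (hd p) (last p)"
  shows "\<not> touched s"
proof -
  let ?P = "fireproof_vertices V T s"
  have "\<forall>j\<le>proj_pos x. j < length p \<longrightarrow> p ! j \<in> ?P"
    if "(hd p, x) \<in> (adj (fireproof_forest_edges V T s))\<^sup>*" for x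
    using that
  proof (induction rule: rtrancl_induct)
    case base
    have "proj_pos (hd p) = 0" using p_ne pos_nth[of 0] by (simp add: proj_pos_path hd_conv_nth)
    then show ?case using assms p_ne by (auto simp: fireproof_linked_def hd_conv_nth)
  next
    case (step y z)
    then have "{y, z} \<in> T" and yz: "y \<in> ?P" "z \<in> ?P"
      unfolding adj_def fireproof_forest_edges_def by auto
    then obtain w where w: "w \<in> W" "{y, z} = {w, par w}" unfolding T_def up_def by auto
    show ?case
    proof (cases "w \<in> set p")
      case False
      then have "proj_pos z = proj_pos y" using w proj_pos_off_path[of w] by (auto simp: doubleton_eq_iff)
      then show ?thesis using step.IH by simp
    next
      case True
      then obtain i where i: "Suc i < length p" "w = p ! Suc i" using on_path_cases[of w] w by blast
      have pw: "proj_pos w = Suc i" "proj_pos (par w) = i"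
        using i by (simp_all add: proj_pos_path pos_nth par_nth)
      show ?thesis
      proof (cases "z = w")
        case True
        then have "y = par w" using w(2) by (auto simp: doubleton_eq_iff)
        then show ?thesis using step.IH pw True yz i by (auto simp: le_Suc_eq)
      next
        case False
        then have "z = par w" "y = w" using w(2) by (auto simp: doubleton_eq_iff)
        then show ?thesis using step.IH pw by auto
      qed
    qed
  qed
  from this[of "last p"] assms have "\<forall>j\<le>proj_pos (last p). j < length p \<longrightarrow> p ! j \<in> ?P"
    unfolding fireproof_linked_def by blast
  moreover have "proj_pos (last p) = length p - 1"
    using p_ne pos_nth[of "length p - 1"] by (simp add: proj_pos_path last_conv_nth)
  ultimately have "p ! j \<in> ?P" if "j < length p" for j using that by auto
  then have "set p \<subseteq> ?P" by (auto simp: in_set_conv_nth)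
  then show ?thesis unfolding touched_def fireproof_vertices_def by fastforce
qed

end

section \<open>Averaging over Cayley trees\<close>

text \<open>The birthday problem: the probability that \<open>m\<close> independent uniform draws
  from \<open>n\<close> labels are distinct. Then \<open>survival n m * m / n\<close> is the
  probability that the first repetition occurs at draw \<open>m + 1\<close>; this is also the law of
  the number of vertices on the path between two independent uniform vertices of a uniform Cayley
  tree.\<close>

definition survival :: "nat \<Rightarrow> nat \<Rightarrow> real" where
  "survival n m = (\<Prod>i<m. 1 - real i / real n)"

definition path_lists :: "nat \<Rightarrow> nat list set" where
  "path_lists n = {p. p \<noteq> [] \<and> distinct p \<and> set p \<subseteq> {1..n}}"

lemma survival_Suc: "survival n (Suc m) = survival n m * (1 - real m / real n)"
  unfolding survival_def by simp

lemma survival_nonneg: "m \<le> Suc n \<Longrightarrow> survival n m \<ge> 0"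
  unfolding survival_def by (cases "n = 0") (auto intro!: prod_nonneg simp: divide_le_eq)

lemma survival_le_1: "m \<le> n \<Longrightarrow> survival n m \<le> 1"
  unfolding survival_def by (rule prod_le_1) (auto simp: divide_le_eq)

lemma survival_diff: "survival n m * (real m / real n) = survival n m - survival n (Suc m)"
  by (simp add: survival_Suc algebra_simps)

lemma card_path_lists_length:
  assumes "m \<le> n"
  shows "real (card {p. length p = m \<and> distinct p \<and> set p \<subseteq> {1..n}}) = real n ^ m * survival n m"
proof -
  have "card {p. length p = m \<and> distinct p \<and> set p \<subseteq> {1..n}} = \<Prod>{n - m + 1..n}"
    using card_lists_distinct_length_eq[of "{1..n}" m] assms by simp
  moreover have "real (\<Prod>{n - m + 1..n}) = real n ^ m * survival n m"
    using assms
  proof (induction m)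
    case 0
    then show ?case by (simp add: survival_def)
  next
    case (Suc m)
    then have "{n - Suc m + 1..n} = insert (n - m) {n - m + 1..n}" by auto
    then have "real (\<Prod>{n - Suc m + 1..n}) = real (n - m) * real (\<Prod>{n - m + 1..n})" by simp
    also have "\<dots> = real (n - m) * (real n ^ m * survival n m)" using Suc by simp
    also have "real (n - m) = real n * (1 - real m / real n)"
      using Suc.prems by (simp add: of_nat_diff algebra_simps)
    finally show ?case by (simp add: survival_Suc mult_ac)
  qed
  ultimately show ?thesis by simp
qed

text \<open>Telescoping; the last term vanishes because \<open>n + 1\<close> draws cannot be
  distinct.\<close>

lemma survival_mass:
  assumes "n \<ge> 1"
  shows "(\<Sum>m=1..n. survival n m * (real m / n)) = 1"
proof -
  have "(\<Sum>m=1..n. survival n m * (real m / n)) = (\<Sum>m=1..n. survival n m - survival n (Suc m))"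
    by (intro sum.cong refl survival_diff)
  also have "\<dots> = survival n 1 - survival n (Suc n)"
  proof -
    have "(\<Sum>m=1..k. survival n m - survival n (Suc m)) = survival n 1 - survival n (Suc k)" for k
      by (induction k) auto
    then show ?thesis .
  qed
  also have "\<dots> = 1" using assms by (simp add: survival_Suc) (simp add: survival_def)
  finally show ?thesis .
qed

text \<open>Terms up to \<open>sqrt n\<close> are at most one; beyond, the factor
  \<open>m / sqrt n\<close>, which exceeds one, turns the sum into \<open>sqrt n\<close> times a
  part of the total mass.\<close>

lemma sum_survival_le:
  assumes "n \<ge> 1"
  shows "(\<Sum>m=1..n. survival n m) \<le> 2 * sqrt n"
proof -
  have "(\<Sum>m=1..n. survival n m)
    \<le> (\<Sum>m=1..n. of_bool (real m \<le> sqrt n) + sqrt n * (survival n m * (real m / n)))"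
  proof (rule sum_mono)
    fix m assume m: "m \<in> {1..n}"
    have s0: "survival n m \<ge> 0" using survival_nonneg m by auto
    show "survival n m \<le> of_bool (real m \<le> sqrt n) + sqrt n * (survival n m * (real m / n))"
    proof (cases "real m \<le> sqrt n")
      case True
      then show ?thesis using survival_le_1[of m n] m s0 by (auto intro!: add_increasing2)
    next
      case False
      have "sqrt n * sqrt n \<le> sqrt n * real m" using False by (intro mult_left_mono) auto
      then have "real n \<le> sqrt n * real m" by simp
      then have "survival n m * 1 \<le> survival n m * (sqrt n * (real m / n))"
        using s0 assms by (intro mult_left_mono) (auto simp: le_divide_eq)
      then show ?thesis using False by (simp add: mult_ac)
    qed
  qed
  also have "\<dots> = card {m \<in> {1..n}. real m \<le> sqrt n} + sqrt n * 1"
    unfolding sum.distrib sum_distrib_left[symmetric] survival_mass[OF assms]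
    by (simp add: of_bool_def sum.inter_filter[symmetric])
  also have "card {m \<in> {1..n}. real m \<le> sqrt n} \<le> card {1..nat \<lfloor>sqrt n\<rfloor>}"
    by (rule card_mono) (auto simp: le_nat_floor)
  also have "real (card {1..nat \<lfloor>sqrt n\<rfloor>}) \<le> sqrt n" by simp
  finally show ?thesis by simp
qed

text \<open>Summation by parts: the mean is the sum of the tails, which are the values
  \<open>survival n m\<close>.\<close>

lemma survival_mean_le:
  assumes "n \<ge> 1"
  shows "(\<Sum>m=1..n. survival n m * (real m / n) * real m) \<le> 2 * sqrt n"
proof -
  have "(\<Sum>m=1..k. survival n m * (real m / n) * real m)
      = (\<Sum>m=1..k. survival n m) - real k * survival n (Suc k)" for k
    unfolding survival_diff
    by (induction k) (simp_all add: algebra_simps)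
  then have "(\<Sum>m=1..n. survival n m * (real m / n) * real m) \<le> (\<Sum>m=1..n. survival n m)"
    using survival_nonneg[of "Suc n" n] by simp
  then show ?thesis using sum_survival_le[OF assms] by (rule order_trans)
qed

lemma survival_inverse_mean_le:
  assumes "n \<ge> 1"
  shows "(\<Sum>m=1..n. survival n m * (real m / n) * (1 / real m)) \<le> 2 / sqrt n"
proof -
  have "(\<Sum>m=1..n. survival n m * (real m / n) * (1 / real m)) = (\<Sum>m=1..n. survival n m) / n"
    unfolding sum_divide_distrib by (intro sum.cong) auto
  also have "\<dots> \<le> 2 * sqrt n / n" using sum_survival_le[OF assms] by (intro divide_right_mono) auto
  also have "\<dots> = 2 / sqrt n" using assms by (simp add: field_simps)
  finally show ?thesis .
qed

section \<open>Sums over paths with forests and over trees with two marked vertices\<close>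

lemma path_lists_length:
  assumes "p \<in> path_lists n"
  shows "length p \<in> {1..n}"
proof -
  have "card (set p) \<le> card {1..n}" using assms by (intro card_mono) (auto simp: path_lists_def)
  then show ?thesis using assms by (simp add: path_lists_def distinct_card Suc_le_eq)
qed

lemma finite_path_lists: "finite (path_lists n)"
proof (rule finite_subset)
  show "path_lists n \<subseteq> {p. set p \<subseteq> {1..n} \<and> length p \<le> n}"
    using path_lists_length by (auto simp: path_lists_def)
  show "finite {p. set p \<subseteq> {1..n} \<and> length p \<le> n}" by (rule finite_lists_length_le) simp
qed

text \<open>There are \<open>n ^ m * survival n m\<close> paths with \<open>m\<close> vertices, and
  each is the root set of \<open>m * n ^ (n - m) / n\<close> forests; so length \<open>m\<close>
  accounts for a fraction \<open>survival n m * m / n\<close> of the \<open>n ^ n\<close>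
  pairs.\<close>

lemma sum_path_forests_le:
  fixes \<beta> :: "nat list \<Rightarrow> (nat \<Rightarrow> nat) \<Rightarrow> real" and \<psi> :: "nat \<Rightarrow> real"
  assumes n: "n \<ge> 1"
    and \<beta>: "\<And>p. p \<in> path_lists n \<Longrightarrow> (\<Sum>f\<in>forests (set p) ({1..n} - set p). \<beta> p f)
      \<le> \<psi> (length p) * real (card (forests (set p) ({1..n} - set p)))"
  shows "(\<Sum>p\<in>path_lists n. \<Sum>f\<in>forests (set p) ({1..n} - set p). \<beta> p f)
    \<le> real n ^ n * (\<Sum>m=1..n. survival n m * (real m / n) * \<psi> m)"
proof -
  note len = path_lists_length
  have cf: "real (card (forests (set p) ({1..n} - set p))) = real (length p) * real n ^ (n - length p) / n"
    if p: "p \<in> path_lists n" for p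
  proof -
    have c: "card (set p) = length p" "card ({1..n} - set p) = n - length p"
      using p unfolding path_lists_def by (auto simp: distinct_card card_Diff_subset)
    have "card (forests (set p) ({1..n} - set p)) * n = length p * n ^ (n - length p)"
      using card_forests[of "set p" "{1..n} - set p"] c len[OF p] by simp
    then have "real (card (forests (set p) ({1..n} - set p))) * n = real (length p) * real n ^ (n - length p)"
      by (metis of_nat_mult of_nat_power)
    then show ?thesis using n by (simp add: field_simps)
  qed
  have "(\<Sum>p\<in>path_lists n. \<Sum>f\<in>forests (set p) ({1..n} - set p). \<beta> p f)
    \<le> (\<Sum>p\<in>path_lists n. \<psi> (length p) * (real (length p) * real n ^ (n - length p) / n))"
  proof (rule sum_mono)
    fix p assume "p \<in> path_lists n"
    from \<beta>[OF this] show "(\<Sum>f\<in>forests (set p) ({1..n} - set p). \<beta> p f)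
        \<le> \<psi> (length p) * (real (length p) * real n ^ (n - length p) / n)"
      unfolding cf[OF \<open>p \<in> path_lists n\<close>] .
  qed
  also have "\<dots> = (\<Sum>m=1..n. \<Sum>p\<in>{p \<in> path_lists n. length p = m}. \<psi> (length p) * (real (length p) * real n ^ (n - length p) / n))"
    using len finite_path_lists by (intro sum.group[symmetric]) auto
  also have "\<dots> = (\<Sum>m=1..n. real n ^ n * (survival n m * (real m / n) * \<psi> m))"
  proof (rule sum.cong[OF refl])
    fix m assume m: "m \<in> {1..n}"
    then have "{p \<in> path_lists n. length p = m} = {p. length p = m \<and> distinct p \<and> set p \<subseteq> {1..n}}"
      unfolding path_lists_def by auto
    then have "real (card {p \<in> path_lists n. length p = m}) = real n ^ m * survival n m"
      using card_path_lists_length[of m n] m by simp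
    then have "(\<Sum>p\<in>{p \<in> path_lists n. length p = m}. \<psi> (length p) * (real (length p) * real n ^ (n - length p) / n))
      = (real n ^ m * survival n m) * (\<psi> m * (real m * real n ^ (n - m) / n))" by simp
    also have "\<dots> = (real n ^ m * real n ^ (n - m)) * (survival n m * (real m / n) * \<psi> m)" by simp
    also have "real n ^ m * real n ^ (n - m) = real n ^ n" using m by (simp flip: power_add)
    finally show "(\<Sum>p\<in>{p \<in> path_lists n. length p = m}. \<psi> (length p) * (real (length p) * real n ^ (n - length p) / n))
      = real n ^ n * (survival n m * (real m / n) * \<psi> m)" .
  qed
  finally show ?thesis by (simp add: sum_distrib_left)
qed

definition path_of :: "nat \<Rightarrow> edge set \<Rightarrow> nat \<Rightarrow> nat \<Rightarrow> nat list \<times> (nat \<Rightarrow> nat)" where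
  "path_of n T u v = (SOME (p, f). p \<noteq> [] \<and> hd p = u \<and> last p = v \<and> distinct p \<and> set p \<subseteq> {1..n}
    \<and> f \<in> forests (set p) ({1..n} - set p) \<and> T = path_edges p \<union> parent_edges ({1..n} - set p) f)"

lemma path_of:
  assumes "T \<in> cayley_trees n" "u \<in> {1..n}" "v \<in> {1..n}" "path_of n T u v = (p, f)"
  shows "p \<noteq> []" "hd p = u" "last p = v" "p \<in> path_lists n"
    "f \<in> forests (set p) ({1..n} - set p)" "T = path_edges p \<union> parent_edges ({1..n} - set p) f"
    "path_tree {1..n} p f"
proof -
  let ?Q = "\<lambda>(p, f). p \<noteq> [] \<and> hd p = u \<and> last p = v \<and> distinct p \<and> set p \<subseteq> {1..n}
    \<and> f \<in> forests (set p) ({1..n} - set p) \<and> T = path_edges p \<union> parent_edges ({1..n} - set p) f"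
  have "is_tree {1..n} T" using assms unfolding cayley_trees_def by simp
  then have "\<exists>x. ?Q x" using tree_path_forest[of "{1..n}" T u v] assms by auto
  then have "?Q (path_of n T u v)" unfolding path_of_def by (rule someI_ex)
  then show "p \<noteq> []" "hd p = u" "last p = v" "p \<in> path_lists n"
    "f \<in> forests (set p) ({1..n} - set p)" "T = path_edges p \<union> parent_edges ({1..n} - set p) f"
    "path_tree {1..n} p f"
    unfolding assms(4) path_lists_def path_tree_def by auto
qed

text \<open>The tree and both marked vertices can be read off the path and the forest, so the
  decomposition is injective and a sum of nonnegative terms only grows.\<close>

lemma sum_trees_le:
  fixes \<beta> :: "nat list \<Rightarrow> (nat \<Rightarrow> nat) \<Rightarrow> real"
  assumes \<beta>: "\<And>p f. \<beta> p f \<ge> 0"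
  shows "(\<Sum>T\<in>cayley_trees n. \<Sum>u\<in>{1..n}. \<Sum>v\<in>{1..n}. case path_of n T u v of (p, f) \<Rightarrow> \<beta> p f)
    \<le> (\<Sum>p\<in>path_lists n. \<Sum>f\<in>forests (set p) ({1..n} - set p). \<beta> p f)"
proof -
  let ?D = "cayley_trees n \<times> {1..n} \<times> {1..n}"
  let ?g = "\<lambda>(T, u, v). path_of n T u v"
  have inj: "inj_on ?g ?D"
  proof (rule inj_onI)
    fix x y assume x: "x \<in> ?D" and y: "y \<in> ?D" and eq: "?g x = ?g y"
    obtain T u v where xx: "x = (T, u, v)" by (cases x) auto
    obtain T' u' v' where yy: "y = (T', u', v')" by (cases y) auto
    obtain p f where pf: "path_of n T u v = (p, f)" by fastforce
    then have pf': "path_of n T' u' v' = (p, f)" using eq xx yy by simp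
    show "x = y"
      using path_of(2,3,6)[OF _ _ _ pf] path_of(2,3,6)[OF _ _ _ pf'] x y unfolding xx yy by auto
  qed
  have "(\<Sum>T\<in>cayley_trees n. \<Sum>u\<in>{1..n}. \<Sum>v\<in>{1..n}. case path_of n T u v of (p, f) \<Rightarrow> \<beta> p f)
    = (\<Sum>x\<in>?D. case_prod \<beta> (?g x))"
    unfolding sum.cartesian_product by (intro sum.cong) auto
  also have "\<dots> = (\<Sum>y\<in>?g ` ?D. case_prod \<beta> y)"
    using inj by (simp add: sum.reindex)
  also have "\<dots> \<le> (\<Sum>y\<in>(SIGMA p:path_lists n. forests (set p) ({1..n} - set p)). case_prod \<beta> y)"
  proof (rule sum_mono2)
    show "finite (SIGMA p:path_lists n. forests (set p) ({1..n} - set p))"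
      using finite_path_lists by (intro finite_SigmaI finite_forests) auto
    show "?g ` ?D \<subseteq> (SIGMA p:path_lists n. forests (set p) ({1..n} - set p))"
    proof
      fix y assume "y \<in> ?g ` ?D"
      then obtain T u v where T: "T \<in> cayley_trees n" "u \<in> {1..n}" "v \<in> {1..n}" "path_of n T u v = y" by auto
      moreover obtain p f where "y = (p, f)" by fastforce
      ultimately show "y \<in> (SIGMA p:path_lists n. forests (set p) ({1..n} - set p))"
        using path_of(4,5)[of T n u v p f] by simp
    qed
  qed (use \<beta> in auto)
  also have "\<dots> = (\<Sum>p\<in>path_lists n. \<Sum>f\<in>forests (set p) ({1..n} - set p). \<beta> p f)"
    using finite_path_lists by (subst sum.Sigma) (auto intro: finite_forests)
  finally show ?thesis .
qed

lemma harm_le_ln: "n \<ge> 1 \<Longrightarrow> harm n \<le> 1 + ln (real n)"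
  using decseqD[OF decseq_harm_diff_ln, of 0 "n - 1"] by (simp add: harm_def)

lemma touch_average_le:
  assumes n: "n \<ge> 1" and r: "r \<ge> 0"
  shows "(\<Sum>p\<in>path_lists n. \<Sum>f\<in>forests (set p) ({1..n} - set p).
      r * (real (length p) + (\<Sum>v\<in>{1..n} - set p. 1 / real (level f (set p) v))))
    \<le> real n ^ n * (r * sqrt n * (7 + 2 * ln (real n)))"
proof -
  \<comment> \<open>The cutoff balances two errors: levels beyond \<open>s\<close> cost at most
    \<open>n / s\<close>, and the drift of the mean generation sizes costs \<open>s\<close>.\<close>
  define s where "s = nat \<lceil>sqrt n\<rceil>"
  have sq: "sqrt n \<ge> 1" using n by simp
  have s: "s > 0" "real s \<ge> sqrt n" "real s \<le> 2 * sqrt n"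
    using sq unfolding s_def by linarith+
  have sn: "s \<le> n"
  proof -
    have "sqrt n \<le> real n" using n by (simp add: real_sqrt_le_iff' real_le_lsqrt power2_eq_square)
    then show ?thesis unfolding s_def by linarith
  qed
  have h: "harm s \<le> 1 + ln (real n)"
    using harm_mono[OF sn, where 'a = real] harm_le_ln[OF n] by linarith
  have ns: "real n / s \<le> sqrt n"
  proof -
    have "real n / s \<le> real n / sqrt n" using s sq by (intro divide_left_mono mult_pos_pos) linarith+
    then show ?thesis by (simp add: real_div_sqrt)
  qed
  let ?\<psi> = "\<lambda>m. r * ((1 + harm s) * real m + (s + real n / s))"
  have "(\<Sum>p\<in>path_lists n. \<Sum>f\<in>forests (set p) ({1..n} - set p).
      r * (real (length p) + (\<Sum>v\<in>{1..n} - set p. 1 / real (level f (set p) v))))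
    \<le> real n ^ n * (\<Sum>m=1..n. survival n m * (real m / n) * ?\<psi> m)"
  proof (rule sum_path_forests_le[OF n])
    fix p assume p: "p \<in> path_lists n"
    let ?R = "set p" and ?S = "{1..n} - set p"
    have cR: "card ?R = length p" using p by (simp add: path_lists_def distinct_card)
    have "(\<Sum>f\<in>forests ?R ?S. r * (real (length p) + (\<Sum>v\<in>?S. 1 / real (level f ?R v))))
      = r * (real (length p) * real (card (forests ?R ?S)) + (\<Sum>f\<in>forests ?R ?S. \<Sum>v\<in>?S. 1 / real (level f ?R v)))"
      by (simp add: sum_distrib_left[symmetric] sum.distrib mult.commute)
    also have "\<dots> \<le> r * (real (length p) * real (card (forests ?R ?S))
        + (card ?R * harm s + s + card ?S / s) * real (card (forests ?R ?S)))"
      using r s by (intro mult_left_mono add_left_mono sum_inverse_level_mean_le) auto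
    also have "\<dots> \<le> r * (real (length p) * real (card (forests ?R ?S))
        + (real (length p) * harm s + s + real n / s) * real (card (forests ?R ?S)))"
      using r s card_mono[of "{1..n}" ?S] unfolding cR
      by (intro mult_left_mono add_left_mono mult_right_mono divide_right_mono) auto
    finally show "(\<Sum>f\<in>forests ?R ?S. r * (real (length p) + (\<Sum>v\<in>?S. 1 / real (level f ?R v))))
      \<le> ?\<psi> (length p) * real (card (forests ?R ?S))"
      by (simp add: algebra_simps)
  qed
  also have "(\<Sum>m=1..n. survival n m * (real m / n) * ?\<psi> m) =
      r * ((1 + harm s) * (\<Sum>m=1..n. survival n m * (real m / n) * real m)
        + (s + real n / s) * (\<Sum>m=1..n. survival n m * (real m / n)))"
  proof -
    have "(\<Sum>m=1..n. w m * (r * (a * real m + b)))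
      = r * (a * (\<Sum>m=1..n. w m * real m) + b * (\<Sum>m=1..n. w m))" for w a b
      by (simp add: sum_distrib_left sum.distrib algebra_simps)
    then show ?thesis .
  qed
  \<comment> \<open>In units of \<open>sqrt n\<close>, the harmonic part gives
    \<open>4 + 2 * ln n\<close> and the cutoff gives 3, whence \<open>7 + 2 * ln n\<close>.\<close>
  also have "\<dots> \<le> r * ((2 + ln (real n)) * (2 * sqrt n) + (2 * sqrt n + sqrt n) * 1)"
    unfolding survival_mass[OF n]
  proof (rule mult_left_mono[OF add_mono r])
    show "(1 + harm s) * (\<Sum>m=1..n. survival n m * (real m / n) * real m) \<le> (2 + ln (real n)) * (2 * sqrt n)"
    proof (rule mult_mono[OF _ survival_mean_le[OF n]])
      show "0 \<le> (\<Sum>m=1..n. survival n m * (real m / n) * real m)"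
        by (intro sum_nonneg mult_nonneg_nonneg survival_nonneg) auto
    qed (use h n in auto)
    show "(s + real n / s) * 1 \<le> (2 * sqrt n + sqrt n) * 1"
      unfolding mult_1_right using s ns by linarith
  qed
  also have "\<dots> = r * sqrt n * (7 + 2 * ln (real n))" by (simp add: algebra_simps)
  finally show ?thesis by (simp add: mult_left_mono)
qed

text \<open>The path length \<open>m\<close> enters through the means of \<open>1 / m\<close> and
  \<open>m / n\<close>, both at most \<open>2 / sqrt n\<close>. \<open>K\<close> depends on
  \<open>D\<close> alone.\<close>

lemma escape_average_le:
  assumes n: "n \<ge> 1" and r: "r > 0" and D: "D > 0"
  defines "K \<equiv> 4 * (real D)\<^sup>2 * (4 * 2 ^ D + 2 * mean_defect D)"
  shows "(\<Sum>p\<in>path_lists n. \<Sum>f\<in>forests (set p) ({1..n} - set p).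
      1 / (1 + r * (\<Sum>v\<in>{1..n} - set p. 1 / real (level f (set p) v))))
    \<le> real n ^ n * (4 / (r * sqrt n * harm D) + 4 * K / sqrt n)"
proof -
  have K0: "K \<ge> 0" unfolding K_def using mean_defect_ge[of D] by auto
  have H0: "harm D > (0::real)" using D by (simp add: harm_pos)
  let ?\<psi> = "\<lambda>m. (2 / (r * harm D) + K) * (1 / real m) + K / n * real m"
  have "(\<Sum>p\<in>path_lists n. \<Sum>f\<in>forests (set p) ({1..n} - set p).
      1 / (1 + r * (\<Sum>v\<in>{1..n} - set p. 1 / real (level f (set p) v))))
    \<le> real n ^ n * (\<Sum>m=1..n. survival n m * (real m / n) * ?\<psi> m)"
  proof (rule sum_path_forests_le[OF n])
    fix p assume p: "p \<in> path_lists n"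
    let ?R = "set p" and ?S = "{1..n} - set p"
    have cR: "card ?R = length p" using p by (simp add: path_lists_def distinct_card)
    have cS: "real (card ?R) + real (card ?S) = n"
      using p card_mono[of "{1..n}" "set p"] by (auto simp: path_lists_def card_Diff_subset of_nat_diff)
    have "(\<Sum>f\<in>forests ?R ?S. 1 / (1 + r * (\<Sum>v\<in>?S. 1 / real (level f ?R v))))
      \<le> (2 / (r * card ?R * harm D) + K * (1 / card ?R + card ?R / (real (card ?R) + card ?S)))
        * real (card (forests ?R ?S))"
      unfolding K_def using p r D by (intro inverse_sum_level_mean_le) (auto simp: path_lists_def)
    also have "2 / (r * card ?R * harm D) + K * (1 / card ?R + card ?R / (real (card ?R) + card ?S)) = ?\<psi> (length p)"
      unfolding cS unfolding cR by (simp add: distrib_left distrib_right mult_ac)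
    finally show "(\<Sum>f\<in>forests ?R ?S. 1 / (1 + r * (\<Sum>v\<in>?S. 1 / real (level f ?R v))))
      \<le> ?\<psi> (length p) * real (card (forests ?R ?S))" .
  qed
  also have "(\<Sum>m=1..n. survival n m * (real m / n) * ?\<psi> m) =
      (2 / (r * harm D) + K) * (\<Sum>m=1..n. survival n m * (real m / n) * (1 / real m))
        + K / n * (\<Sum>m=1..n. survival n m * (real m / n) * real m)"
    unfolding sum_distrib_left sum.distrib[symmetric]
    by (intro sum.cong refl) (simp add: algebra_simps)
  also have "\<dots> \<le> (2 / (r * harm D) + K) * (2 / sqrt n) + K / n * (2 * sqrt n)"
    using K0 H0 r
    by (intro add_mono mult_left_mono survival_mean_le survival_inverse_mean_le n
        add_nonneg_nonneg divide_nonneg_nonneg mult_nonneg_nonneg) linarith+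
  also have "K / n * (2 * sqrt n) = K * (2 / sqrt n)"
    using n by (simp add: field_simps)
  also have "(2 / (r * harm D) + K) * (2 / sqrt n) + K * (2 / sqrt n) = 4 / (r * sqrt n * harm D) + 4 * K / sqrt n"
  proof -
    have "K * (2 / sqrt n) + K * (2 / sqrt n) = 4 * K / sqrt n" by simp
    moreover have "2 / (r * harm D) * (2 / sqrt n) = 4 / (r * sqrt n * harm D)" by (simp add: mult_ac)
    ultimately show ?thesis by (simp only: distrib_right add.assoc)
  qed
  finally show ?thesis by (simp add: mult_left_mono)
qed

section \<open>Components of the fireproof forest\<close>

lemma forest_component_linked:
  assumes "C \<in> forest_components V T s" "u \<in> C" "v \<in> C"
  shows "fireproof_linked V T s u v"
proof -
  let ?E = "fireproof_forest_edges V T s"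
  obtain w where "C = {u \<in> fireproof_vertices V T s. (w, u) \<in> (adj ?E)\<^sup>*}"
    using assms(1) unfolding forest_components_def components_def by blast
  then have "u \<in> fireproof_vertices V T s" "v \<in> fireproof_vertices V T s"
    "(w, u) \<in> (adj ?E)\<^sup>*" "(w, v) \<in> (adj ?E)\<^sup>*" using assms by auto
  then show ?thesis unfolding fireproof_linked_def using adj_sym rtrancl_trans by metis
qed

lemma card_linked_pairs_ge:
  assumes "finite V" "C \<in> forest_components V T s"
  shows "(real (card C))\<^sup>2 \<le> (\<Sum>u\<in>V. \<Sum>v\<in>V. of_bool (fireproof_linked V T s u v))"
proof -
  have CV: "C \<subseteq> V"
    using assms(2) unfolding forest_components_def components_def fireproof_vertices_def by auto
  have "(real (card C))\<^sup>2 = (\<Sum>u\<in>C. \<Sum>v\<in>C. 1)" by (simp add: power2_eq_square)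
  also have "\<dots> = (\<Sum>u\<in>C. \<Sum>v\<in>C. of_bool (fireproof_linked V T s u v))"
    using forest_component_linked[OF assms(2)] by (intro sum.cong) auto
  also have "\<dots> \<le> (\<Sum>u\<in>C. \<Sum>v\<in>V. of_bool (fireproof_linked V T s u v))"
    using assms CV by (intro sum_mono sum_mono2) auto
  also have "\<dots> \<le> (\<Sum>u\<in>V. \<Sum>v\<in>V. of_bool (fireproof_linked V T s u v))"
    using assms CV by (intro sum_mono2) (auto intro: sum_nonneg)
  finally show ?thesis .
qed

lemma card_linked_pairs_le:
  assumes "finite V" and "k \<ge> 0" and k: "\<And>C. C \<in> forest_components V T s \<Longrightarrow> real (card C) \<le> k"
  shows "(\<Sum>u\<in>V. \<Sum>v\<in>V. of_bool (fireproof_linked V T s u v)) \<le> real (card V) * k"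
proof -
  have "(\<Sum>v\<in>V. of_bool (fireproof_linked V T s u v)) \<le> k" for u
  proof (cases "u \<in> fireproof_vertices V T s")
    case True
    let ?C = "{v \<in> fireproof_vertices V T s. (u, v) \<in> (adj (fireproof_forest_edges V T s))\<^sup>*}"
    have "?C \<in> forest_components V T s"
      unfolding forest_components_def components_def using True by blast
    moreover have "{v \<in> V. fireproof_linked V T s u v} = ?C"
      unfolding fireproof_linked_def using True by (auto simp: fireproof_vertices_def)
    moreover have "(\<Sum>v\<in>V. of_bool (fireproof_linked V T s u v)) = real (card {v \<in> V. fireproof_linked V T s u v})"
      using assms(1) by (simp add: of_bool_def sum.inter_filter[symmetric])
    ultimately show ?thesis using k by metis
  qed (use assms(2) in \<open>simp add: fireproof_linked_def\<close>)
  then have "(\<Sum>u\<in>V. \<Sum>v\<in>V. of_bool (fireproof_linked V T s u v)) \<le> (\<Sum>u\<in>V. k)"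
    by (intro sum_mono)
  then show ?thesis by simp
qed

section \<open>The terminal state of the fire dynamics\<close>

text \<open>An interface shared by both bounds: each pair of vertices has its own path and hence its
  own functions, which must be added up on the common tree.\<close>

definition superharmonic_majorant ::
    "edge set \<Rightarrow> real \<Rightarrow> (config \<Rightarrow> bool) \<Rightarrow> real \<Rightarrow> (config \<Rightarrow> real) \<Rightarrow> bool" where
  "superharmonic_majorant T r Q b h \<longleftrightarrow> (\<forall>s. h s \<ge> 0)
    \<and> (\<forall>s\<in>T \<rightarrow>\<^sub>E UNIV. gen_apply (T \<rightarrow>\<^sub>E UNIV) (fire_rate T r) h s \<le> 0)
    \<and> (\<forall>s. inflammable_edges T s = {} \<longrightarrow> of_bool (Q s) \<le> h s)
    \<and> h (initial_config T) \<le> b"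

context path_tree
begin

text \<open>Without inflammable edges the potential is zero, so \<open>touch_bound\<close> reduces
  to the indicator of \<open>touched\<close>, and \<open>escape_bound\<close> to that of its
  negation.\<close>

lemma touch_bound_majorant:
  assumes "r \<ge> 0"
  shows "superharmonic_majorant T r (\<lambda>s. \<not> fireproof_linked V T s (hd p) (last p))
    (r * (real (length p) + (\<Sum>v\<in>V - set p. 1 / real (level f (set p) v)))) (touch_bound r)"
  unfolding superharmonic_majorant_def
proof (intro conjI allI ballI impI)
  fix s assume "inflammable_edges T s = {}"
  then show "of_bool (\<not> fireproof_linked V T s (hd p) (last p)) \<le> touch_bound r s"
    using untouched_linked[of s] assms by (auto simp: touch_bound_def potential_terminal)
qed (use assms bounds_nonneg touch_bound_superharmonic touch_bound_initial_le in auto)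

lemma escape_bound_majorant:
  assumes "r \<ge> 0"
  shows "superharmonic_majorant T r (\<lambda>s. fireproof_linked V T s (hd p) (last p))
    (1 / (1 + r * (\<Sum>v\<in>V - set p. 1 / real (level f (set p) v)))) (escape_bound r)"
  unfolding superharmonic_majorant_def
proof (intro conjI allI ballI impI)
  fix s assume "inflammable_edges T s = {}"
  then show "of_bool (fireproof_linked V T s (hd p) (last p)) \<le> escape_bound r s"
    using linked_untouched[of s] by (auto simp: escape_bound_def potential_terminal)
qed (use assms bounds_nonneg escape_bound_superharmonic escape_bound_initial_le in auto)

end

lemma fire_terminal_event:
  assumes "fire_dynamics N T r X"
  shows "{\<omega> \<in> space N. terminal_config X \<omega> \<in> B} \<in> sets N"
  unfolding terminal_config_def
  by (rule chain_terminal_event[OF _ _ initial_config_in]) (use assms in \<open>auto simp: fire_dynamics_def\<close>)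

lemma fire_terminal_prob_le:
  assumes fire: "fire_dynamics N T r X" and T: "finite T" and r: "r \<ge> 0"
    and H: "\<And>s. H s \<ge> 0" "\<And>s. inflammable_edges T s = {} \<Longrightarrow> s \<in> B \<Longrightarrow> H s \<ge> 1"
      "\<And>s. s \<in> T \<rightarrow>\<^sub>E UNIV \<Longrightarrow> gen_apply (T \<rightarrow>\<^sub>E UNIV) (fire_rate T r) H s \<le> 0"
  shows "measure N {\<omega> \<in> space N. terminal_config X \<omega> \<in> B} \<le> H (initial_config T)"
  unfolding terminal_config_def
proof (rule chain_terminal_prob_le[where S = "T \<rightarrow>\<^sub>E UNIV" and q = "fire_rate T r"
      and A = "{s \<in> T \<rightarrow>\<^sub>E UNIV. inflammable_edges T s = {}}"
      and I = "\<lambda>s. real (card (inflammable_edges T s))"])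
  show "markov_chain N (T \<rightarrow>\<^sub>E UNIV) (fire_rate T r) X" "AE \<omega> in N. X 0 \<omega> = initial_config T"
    using fire unfolding fire_dynamics_def by auto
  show "initial_config T \<in> T \<rightarrow>\<^sub>E UNIV" by (rule initial_config_in)
  show "fire_rate T r s s' = 0" if "s \<in> {s \<in> T \<rightarrow>\<^sub>E UNIV. inflammable_edges T s = {}}" for s s'
    using that unfolding fire_rate_def by simp
  show "gen_apply (T \<rightarrow>\<^sub>E UNIV) (fire_rate T r) (\<lambda>s. real (card (inflammable_edges T s))) s
      \<le> - real (card (inflammable_edges T s))" if "s \<in> T \<rightarrow>\<^sub>E UNIV" for s
    using gen_apply_card_inflammable[OF T that r] .
  show "1 \<le> real (card (inflammable_edges T s))"
    if "s \<in> (T \<rightarrow>\<^sub>E UNIV) - {s \<in> T \<rightarrow>\<^sub>E UNIV. inflammable_edges T s = {}}" for s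
  proof -
    have "finite (inflammable_edges T s)" using T by (simp add: inflammable_edges_def)
    then show ?thesis using that by (auto simp: Suc_le_eq card_gt_0_iff)
  qed
qed (use H in auto)

lemma gen_apply_sum:
  "gen_apply S q (\<lambda>s. \<Sum>i\<in>I. h i s) x = (\<Sum>i\<in>I. gen_apply S q (h i) x)"
  unfolding gen_apply_def sum_distrib_left by (rule sum.swap)

lemma gen_apply_divide: "gen_apply S q (\<lambda>s. h s / c) x = gen_apply S q h x / c"
  unfolding gen_apply_def by (simp add: sum_divide_distrib)

text \<open>Markov's inequality for the number of pairs with property \<open>P\<close>: the sum of
  the majorants divided by \<open>c\<close> is again superharmonic, and it is at least one at
  terminal configurations in \<open>B\<close>.\<close>

lemma fire_terminal_pairs_le:
  fixes \<beta> :: "nat \<Rightarrow> nat \<Rightarrow> real"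
  assumes fire: "fire_dynamics N T r X" and T: "finite T" and r: "r \<ge> 0" and c: "c > 0"
    and h: "\<And>u v. u \<in> V \<Longrightarrow> v \<in> V \<Longrightarrow> \<exists>h. superharmonic_majorant T r (P u v) (\<beta> u v) h"
    and B: "\<And>s. s \<in> B \<Longrightarrow> c \<le> (\<Sum>u\<in>V. \<Sum>v\<in>V. of_bool (P u v s))"
  shows "measure N {\<omega> \<in> space N. terminal_config X \<omega> \<in> B} \<le> (\<Sum>u\<in>V. \<Sum>v\<in>V. \<beta> u v) / c"
proof -
  define h where "h u v = (SOME h. superharmonic_majorant T r (P u v) (\<beta> u v) h)" for u v
  have Q: "superharmonic_majorant T r (P u v) (\<beta> u v) (h u v)" if "u \<in> V" "v \<in> V" for u v
    unfolding h_def using someI_ex[OF h[OF that]] .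
  have h: "\<And>u v s. u \<in> V \<Longrightarrow> v \<in> V \<Longrightarrow> h u v s \<ge> 0"
    "\<And>u v s. u \<in> V \<Longrightarrow> v \<in> V \<Longrightarrow> s \<in> T \<rightarrow>\<^sub>E UNIV \<Longrightarrow> gen_apply (T \<rightarrow>\<^sub>E UNIV) (fire_rate T r) (h u v) s \<le> 0"
    "\<And>u v s. u \<in> V \<Longrightarrow> v \<in> V \<Longrightarrow> inflammable_edges T s = {} \<Longrightarrow> of_bool (P u v s) \<le> h u v s"
    "\<And>u v. u \<in> V \<Longrightarrow> v \<in> V \<Longrightarrow> h u v (initial_config T) \<le> \<beta> u v"
    using Q unfolding superharmonic_majorant_def by simp_all
  let ?H = "\<lambda>s. (\<Sum>u\<in>V. \<Sum>v\<in>V. h u v s) / c"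
  have "measure N {\<omega> \<in> space N. terminal_config X \<omega> \<in> B} \<le> ?H (initial_config T)"
  proof (rule fire_terminal_prob_le[OF fire T r])
    show "?H s \<ge> 0" for s using h(1) c by (intro divide_nonneg_nonneg sum_nonneg) auto
    show "?H s \<ge> 1" if "inflammable_edges T s = {}" "s \<in> B" for s
    proof -
      have "(\<Sum>u\<in>V. \<Sum>v\<in>V. of_bool (P u v s)) \<le> (\<Sum>u\<in>V. \<Sum>v\<in>V. h u v s)"
        using h(3) that by (intro sum_mono) auto
      then show ?thesis using B[OF that(2)] c by simp
    qed
    show "gen_apply (T \<rightarrow>\<^sub>E UNIV) (fire_rate T r) ?H s \<le> 0" if "s \<in> T \<rightarrow>\<^sub>E UNIV" for s
      unfolding gen_apply_divide gen_apply_sum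
      using h(2) that c by (intro divide_nonpos_pos sum_nonpos) auto
  qed
  also have "\<dots> \<le> (\<Sum>u\<in>V. \<Sum>v\<in>V. \<beta> u v) / c"
    using h(4) c by (intro divide_right_mono sum_mono) auto
  finally show ?thesis .
qed

section \<open>Conditioning on the tree\<close>

lemma cond_space_simps:
  assumes "prob_space M" "A \<in> sets M" and "measure M A > 0"
  shows "space (cond_space M A) = A" and "E \<in> sets (cond_space M A) \<longleftrightarrow> E \<subseteq> A \<and> E \<in> sets M"
    and "E \<in> sets M \<Longrightarrow> E \<subseteq> A \<Longrightarrow> measure (cond_space M A) E = measure M E / measure M A"
proof -
  interpret prob_space M by fact
  have A: "A \<inter> space M = A" using assms(2) sets.sets_into_space by blast
  show sp: "space (cond_space M A) = A" unfolding cond_space_def by (simp add: space_restrict_space A)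
  show st: "E \<in> sets (cond_space M A) \<longleftrightarrow> E \<subseteq> A \<and> E \<in> sets M"
    unfolding cond_space_def using assms(2) A by (simp add: sets_restrict_space_iff)
  assume E: "E \<in> sets M" "E \<subseteq> A"
  have em: "emeasure (restrict_space M A) F = emeasure M F" if "F \<subseteq> A" for F
    using that assms(2) A by (simp add: emeasure_restrict_space)
  have "measure (cond_space M A) E = measure (restrict_space M A) (A \<inter> E) / measure (restrict_space M A) A"
    unfolding cond_space_def
  proof (rule measure_uniform_measure)
    show "emeasure (restrict_space M A) A \<noteq> 0" "emeasure (restrict_space M A) A \<noteq> \<infinity>"
      using assms(3) by (auto simp: em emeasure_eq_measure)
    show "E \<in> sets (restrict_space M A)"
      using E assms(2) A by (simp add: sets_restrict_space_iff)
  qed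
  also have "A \<inter> E = E" using E by auto
  also have "measure (restrict_space M A) E = measure M E"
    using E by (simp add: measure_def em)
  also have "measure (restrict_space M A) A = measure M A" by (simp add: measure_def em)
  finally show "measure (cond_space M A) E = measure M E / measure M A" .
qed

text \<open>The event splits according to the value of the tree. Each value has the same
  probability, so the conditional bounds are averaged with equal weights.\<close>

lemma cayley_fire_terminal:
  assumes cfd: "cayley_fire_dynamics n r M tr X" and n: "n \<ge> 2"
    and b: "\<And>T N. T \<in> cayley_trees n \<Longrightarrow> fire_dynamics N T r X \<Longrightarrow>
      measure N {\<omega> \<in> space N. terminal_config X \<omega> \<in> B T} \<le> b T"
  shows "{\<omega> \<in> space M. terminal_config X \<omega> \<in> B (tr \<omega>)} \<in> sets M"
    and "measure M {\<omega> \<in> space M. terminal_config X \<omega> \<in> B (tr \<omega>)}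
      \<le> (\<Sum>T\<in>cayley_trees n. b T) / real (card (cayley_trees n))"
proof -
  let ?C = "cayley_trees n"
  let ?A = "\<lambda>T. {\<omega> \<in> space M. tr \<omega> = T}"
  let ?E = "\<lambda>T. {\<omega> \<in> ?A T. terminal_config X \<omega> \<in> B T}"
  interpret prob_space M using cfd unfolding cayley_fire_dynamics_def by simp
  have tr: "tr \<in> measurable M (count_space ?C)"
    and dist: "distr M (count_space ?C) tr = uniform_count_measure ?C"
    and fire: "\<And>T. T \<in> ?C \<Longrightarrow> fire_dynamics (cond_space M (?A T)) T r X"
    using cfd unfolding cayley_fire_dynamics_def by auto
  have "0 < real (card ?C) * (real n)\<^sup>2"
    using n by (intro less_le_trans[OF _ card_cayley_trees_ge[OF n]]) simp
  then have card0: "card ?C > 0" using n by (auto simp: zero_less_mult_iff)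
  have A: "?A T \<in> sets M" "prob (?A T) = 1 / card ?C" if "T \<in> ?C" for T
  proof -
    have eq: "?A T = tr -` {T} \<inter> space M" by auto
    show "?A T \<in> sets M" unfolding eq using that by (intro measurable_sets[OF tr]) auto
    have "prob (?A T) = measure (distr M (count_space ?C) tr) {T}"
      unfolding eq using that by (intro measure_distr[symmetric] tr) auto
    also have "\<dots> = 1 / card ?C"
      unfolding dist using that finite_cayley_trees by (simp add: measure_uniform_count_measure)
    finally show "prob (?A T) = 1 / card ?C" .
  qed
  have E: "?E T \<in> sets M" "prob (?E T) \<le> b T / card ?C" if T: "T \<in> ?C" for T
  proof -
    have pos: "prob (?A T) > 0" using A(2)[OF T] card0 by simp
    note cs = cond_space_simps[OF prob_space_axioms A(1)[OF T] pos]
    have "{\<omega> \<in> space (cond_space M (?A T)). terminal_config X \<omega> \<in> B T} \<in> sets (cond_space M (?A T))"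
      by (rule fire_terminal_event[OF fire[OF T]])
    then show Es: "?E T \<in> sets M" unfolding cs(1) cs(2) by simp
    have "measure (cond_space M (?A T)) {\<omega> \<in> space (cond_space M (?A T)). terminal_config X \<omega> \<in> B T} \<le> b T"
      by (rule b[OF T fire[OF T]])
    then have "prob (?E T) / prob (?A T) \<le> b T"
      unfolding cs(1) using cs(3)[OF Es Collect_restrict] by simp
    then show "prob (?E T) \<le> b T / card ?C"
      using A(2)[OF T] card0 by (simp add: field_simps)
  qed
  have eq: "{\<omega> \<in> space M. terminal_config X \<omega> \<in> B (tr \<omega>)} = (\<Union>T\<in>?C. ?E T)"
    using measurable_space[OF tr] by auto
  show "{\<omega> \<in> space M. terminal_config X \<omega> \<in> B (tr \<omega>)} \<in> sets M"
    unfolding eq using E(1) finite_cayley_trees by (intro sets.finite_UN) auto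
  have "prob (\<Union>T\<in>?C. ?E T) \<le> (\<Sum>T\<in>?C. prob (?E T))"
    using E(1) finite_cayley_trees by (intro finite_measure_subadditive_finite) auto
  also have "\<dots> \<le> (\<Sum>T\<in>?C. b T / card ?C)" by (intro sum_mono E(2))
  finally show "prob {\<omega> \<in> space M. terminal_config X \<omega> \<in> B (tr \<omega>)} \<le> (\<Sum>T\<in>?C. b T) / card ?C"
    unfolding eq by (simp add: sum_divide_distrib)
qed

lemma cayley_tree_finite:
  assumes "T \<in> cayley_trees n"
  shows "finite T"
proof (rule finite_subset)
  show "T \<subseteq> Pow {1..n}"
    using assms unfolding cayley_trees_def is_tree_def simple_graph_def by blast
qed simp

lemma cayley_average_le:
  fixes \<beta> :: "nat list \<Rightarrow> (nat \<Rightarrow> nat) \<Rightarrow> real"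
  assumes n: "n \<ge> 2" and c: "c > 0" and \<beta>: "\<And>p f. \<beta> p f \<ge> 0"
    and avg: "(\<Sum>p\<in>path_lists n. \<Sum>f\<in>forests (set p) ({1..n} - set p). \<beta> p f) \<le> real n ^ n * b"
  shows "(\<Sum>T\<in>cayley_trees n. (\<Sum>u\<in>{1..n}. \<Sum>v\<in>{1..n}. case path_of n T u v of (p, f) \<Rightarrow> \<beta> p f) / (c * (real n)\<^sup>2))
    / real (card (cayley_trees n)) \<le> b / c"
proof -
  let ?K = "real (card (cayley_trees n))"
  have nn: "real n ^ n > 0" using n by simp
  have "(\<Sum>p\<in>path_lists n. \<Sum>f\<in>forests (set p) ({1..n} - set p). \<beta> p f) \<ge> 0"
    using \<beta> by (intro sum_nonneg) auto
  then have "0 \<le> real n ^ n * b" using avg by (rule order_trans)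
  \<comment> \<open>The sign is used when \<open>n ^ n\<close> is enlarged to the number of trees
    with two marked vertices.\<close>
  then have b0: "b \<ge> 0" using nn by (simp add: zero_le_mult_iff)
  have K: "?K * (real n)\<^sup>2 \<ge> real n ^ n" by (rule card_cayley_trees_ge[OF n])
  have "(\<Sum>T\<in>cayley_trees n. \<Sum>u\<in>{1..n}. \<Sum>v\<in>{1..n}. case path_of n T u v of (p, f) \<Rightarrow> \<beta> p f)
      \<le> real n ^ n * b" using sum_trees_le[OF \<beta>] avg by (rule order_trans)
  also have "\<dots> \<le> ?K * (real n)\<^sup>2 * b" using K b0 by (rule mult_right_mono)
  finally have "(\<Sum>T\<in>cayley_trees n. \<Sum>u\<in>{1..n}. \<Sum>v\<in>{1..n}. case path_of n T u v of (p, f) \<Rightarrow> \<beta> p f)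
      / (?K * (real n)\<^sup>2 * c) \<le> ?K * (real n)\<^sup>2 * b / (?K * (real n)\<^sup>2 * c)"
    using c by (intro divide_right_mono) auto
  also have "\<dots> = b / c"
  proof -
    have "?K * (real n)\<^sup>2 \<noteq> 0" using K nn by linarith
    then show ?thesis by simp
  qed
  finally show ?thesis by (simp add: sum_divide_distrib mult_ac)
qed

text \<open>The event is the complement of the desired one; its measurability is recorded because
  the theorem passes back by complementation.\<close>

lemma no_giant_component_prob_le:
  assumes cfd: "cayley_fire_dynamics n r M tr X" and n: "n \<ge> 2" and r: "r \<ge> 0"
    and \<epsilon>: "0 < \<epsilon>" "\<epsilon> < 1"
  defines "E \<equiv> {\<omega> \<in> space M. terminal_config X \<omega> \<in>
      {s. \<not> (\<exists>C\<in>forest_components {1..n} (tr \<omega>) s. real (card C) > (1 - \<epsilon>) * real n)}}"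
  shows "E \<in> sets M" and "measure M E \<le> r * sqrt n * (7 + 2 * ln (real n)) / \<epsilon>"
proof -
  let ?V = "{1..n}"
  let ?B = "\<lambda>T. {s. \<not> (\<exists>C\<in>forest_components ?V T s. real (card C) > (1 - \<epsilon>) * real n)}"
  let ?\<beta> = "\<lambda>p f. r * (real (length p) + (\<Sum>v\<in>?V - set p. 1 / real (level f (set p) v)))"
  let ?b = "\<lambda>T. (\<Sum>u\<in>?V. \<Sum>v\<in>?V. case path_of n T u v of (p, f) \<Rightarrow> ?\<beta> p f) / (\<epsilon> * (real n)\<^sup>2)"
  have bound: "measure N {\<omega> \<in> space N. terminal_config X \<omega> \<in> ?B T} \<le> ?b T"
    if T: "T \<in> cayley_trees n" and fire: "fire_dynamics N T r X" for T and N :: "'a measure"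
  proof (rule fire_terminal_pairs_le[OF fire cayley_tree_finite[OF T] r])
    show "\<epsilon> * (real n)\<^sup>2 > 0" using \<epsilon> n by simp
    show "\<exists>h. superharmonic_majorant T r (\<lambda>s. \<not> fireproof_linked ?V T s u v)
        (case path_of n T u v of (p, f) \<Rightarrow> ?\<beta> p f) h"
      if uv: "u \<in> ?V" "v \<in> ?V" for u v
    proof -
      obtain p f where pf: "path_of n T u v = (p, f)" by fastforce
      note P = path_of[OF T uv pf]
      interpret P: path_tree ?V p f by (rule P(7))
      have "P.T = T" using P.T_eq P(6) by simp
      then show ?thesis using P.touch_bound_majorant[OF r] P(2,3) unfolding pf by auto
    qed
    show "\<epsilon> * (real n)\<^sup>2 \<le> (\<Sum>u\<in>?V. \<Sum>v\<in>?V. of_bool (\<not> fireproof_linked ?V T s u v))" if "s \<in> ?B T" for s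
    proof -
      have "(\<Sum>u\<in>?V. \<Sum>v\<in>?V. of_bool (fireproof_linked ?V T s u v)) \<le> real (card ?V) * ((1 - \<epsilon>) * real n)"
        using that \<epsilon> by (intro card_linked_pairs_le) (auto simp: not_less)
      moreover have "(\<Sum>u\<in>?V. \<Sum>v\<in>?V. of_bool (\<not> fireproof_linked ?V T s u v))
          = (\<Sum>u\<in>?V. \<Sum>v\<in>?V. 1 - of_bool (fireproof_linked ?V T s u v) :: real)"
        by (intro sum.cong) auto
      ultimately show ?thesis by (simp add: sum_subtractf power2_eq_square algebra_simps)
    qed
  qed
  show "E \<in> sets M" unfolding E_def by (rule cayley_fire_terminal(1)[OF cfd n bound])
  have "measure M E \<le> (\<Sum>T\<in>cayley_trees n. ?b T) / real (card (cayley_trees n))"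
    unfolding E_def by (rule cayley_fire_terminal(2)[OF cfd n bound])
  also have "\<dots> \<le> r * sqrt n * (7 + 2 * ln (real n)) / \<epsilon>"
    using n r \<epsilon> by (intro cayley_average_le touch_average_le) (auto intro!: mult_nonneg_nonneg add_nonneg_nonneg sum_nonneg)
  finally show "measure M E \<le> r * sqrt n * (7 + 2 * ln (real n)) / \<epsilon>" .
qed

lemma large_component_prob_le:
  assumes cfd: "cayley_fire_dynamics n r M tr X" and n: "n \<ge> 2" and r: "r > 0"
    and \<epsilon>: "0 < \<epsilon>" and D: "D > 0"
  shows "measure M {\<omega> \<in> space M. \<exists>C\<in>forest_components {1..n} (tr \<omega>) (terminal_config X \<omega>).
      real (card C) > \<epsilon> * real n}
    \<le> (4 / (r * sqrt n * harm D) + 4 * (4 * (real D)\<^sup>2 * (4 * 2 ^ D + 2 * mean_defect D)) / sqrt n) / \<epsilon>\<^sup>2"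
proof -
  let ?V = "{1..n}"
  let ?B = "\<lambda>T. {s. \<exists>C\<in>forest_components ?V T s. real (card C) > \<epsilon> * real n}"
  let ?\<beta> = "\<lambda>p f. 1 / (1 + r * (\<Sum>v\<in>?V - set p. 1 / real (level f (set p) v)))"
  let ?b = "\<lambda>T. (\<Sum>u\<in>?V. \<Sum>v\<in>?V. case path_of n T u v of (p, f) \<Rightarrow> ?\<beta> p f) / (\<epsilon>\<^sup>2 * (real n)\<^sup>2)"
  have r0: "r \<ge> 0" using r by simp
  have bound: "measure N {\<omega> \<in> space N. terminal_config X \<omega> \<in> ?B T} \<le> ?b T"
    if T: "T \<in> cayley_trees n" and fire: "fire_dynamics N T r X" for T and N :: "'a measure"
  proof (rule fire_terminal_pairs_le[OF fire cayley_tree_finite[OF T] r0])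
    show "\<epsilon>\<^sup>2 * (real n)\<^sup>2 > 0" using \<epsilon> n by simp
    show "\<exists>h. superharmonic_majorant T r (\<lambda>s. fireproof_linked ?V T s u v)
        (case path_of n T u v of (p, f) \<Rightarrow> ?\<beta> p f) h"
      if uv: "u \<in> ?V" "v \<in> ?V" for u v
    proof -
      obtain p f where pf: "path_of n T u v = (p, f)" by fastforce
      note P = path_of[OF T uv pf]
      interpret P: path_tree ?V p f by (rule P(7))
      have "P.T = T" using P.T_eq P(6) by simp
      then show ?thesis using P.escape_bound_majorant[OF r0] P(2,3) unfolding pf by auto
    qed
    show "\<epsilon>\<^sup>2 * (real n)\<^sup>2 \<le> (\<Sum>u\<in>?V. \<Sum>v\<in>?V. of_bool (fireproof_linked ?V T s u v))" if "s \<in> ?B T" for s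
    proof -
      from that obtain C where C: "C \<in> forest_components ?V T s" "real (card C) > \<epsilon> * real n" by blast
      have "\<epsilon>\<^sup>2 * (real n)\<^sup>2 \<le> (real (card C))\<^sup>2"
        unfolding power_mult_distrib[symmetric] using C(2) \<epsilon> by (intro power_mono) auto
      also have "\<dots> \<le> (\<Sum>u\<in>?V. \<Sum>v\<in>?V. of_bool (fireproof_linked ?V T s u v))"
        using C(1) by (intro card_linked_pairs_ge) auto
      finally show ?thesis .
    qed
  qed
  have "measure M {\<omega> \<in> space M. terminal_config X \<omega> \<in> ?B (tr \<omega>)}
      \<le> (\<Sum>T\<in>cayley_trees n. ?b T) / real (card (cayley_trees n))"
    by (rule cayley_fire_terminal(2)[OF cfd n bound])
  also have "\<dots> \<le> (4 / (r * sqrt n * harm D)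
      + 4 * (4 * (real D)\<^sup>2 * (4 * 2 ^ D + 2 * mean_defect D)) / sqrt n) / \<epsilon>\<^sup>2"
    using n r \<epsilon> D by (intro cayley_average_le escape_average_le) (auto intro!: mult_nonneg_nonneg add_nonneg_nonneg sum_nonneg)
  finally show ?thesis by simp
qed

theorem corollary1:
  fixes \<epsilon> \<alpha> :: real
    and M :: "nat \<Rightarrow> 'w measure"
    and tr :: "nat \<Rightarrow> 'w \<Rightarrow> edge set"
    and X :: "nat \<Rightarrow> real \<Rightarrow> 'w \<Rightarrow> config"
  assumes "0 < \<epsilon>" and "\<epsilon> < 1"
    and "\<And>n. n \<ge> 1 \<Longrightarrow> cayley_fire_dynamics n (real n powr (- \<alpha>)) (M n) (tr n) (X n)"
  shows "(\<alpha> > 1/2 \<longrightarrow>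
           (\<lambda>n. measure (M n) {\<omega> \<in> space (M n).
              \<exists>C \<in> forest_components {1..n} (tr n \<omega>) (terminal_config (X n) \<omega>).
                real (card C) > (1 - \<epsilon>) * real n}) \<longlonglongrightarrow> 1) \<and>
         (\<alpha> = 1/2 \<longrightarrow>
           (\<lambda>n. measure (M n) {\<omega> \<in> space (M n).
              \<exists>C \<in> forest_components {1..n} (tr n \<omega>) (terminal_config (X n) \<omega>).
                real (card C) > \<epsilon> * real n}) \<longlonglongrightarrow> 0)"
proof (intro conjI impI)
  assume \<alpha>: "\<alpha> > 1/2"
  let ?G = "\<lambda>n. {\<omega> \<in> space (M n). \<exists>C \<in> forest_components {1..n} (tr n \<omega>) (terminal_config (X n) \<omega>).
                real (card C) > (1 - \<epsilon>) * real n}"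
  let ?b = "\<lambda>n. real n powr (- \<alpha>) * sqrt n * (7 + 2 * ln (real n)) / \<epsilon>"
  have bound: "1 - ?b n \<le> measure (M n) (?G n)" "measure (M n) (?G n) \<le> 1" if "n \<ge> 2" for n
  proof -
    have cfd: "cayley_fire_dynamics n (real n powr (- \<alpha>)) (M n) (tr n) (X n)" using assms(3) that by simp
    interpret prob_space "M n" using cfd unfolding cayley_fire_dynamics_def by simp
    let ?E = "{\<omega> \<in> space (M n). terminal_config (X n) \<omega> \<in>
      {s. \<not> (\<exists>C\<in>forest_components {1..n} (tr n \<omega>) s. real (card C) > (1 - \<epsilon>) * real n)}}"
    have E: "?E \<in> sets (M n)" "prob ?E \<le> ?b n"
      using no_giant_component_prob_le[OF cfd that powr_ge_zero assms(1,2)] .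
    have "?G n = space (M n) - ?E" by auto
    then have "prob (?G n) = 1 - prob ?E" using prob_compl[OF E(1)] by simp
    then show "1 - ?b n \<le> prob (?G n)" "prob (?G n) \<le> 1" using E(2) by auto
  qed
  have "?b \<longlonglongrightarrow> 0"
  proof -
    have d: "\<alpha> - 1/2 > 0" using \<alpha> by simp
    \<comment> \<open>The product \<open>r * sqrt n\<close> is a negative power of \<open>n\<close>
      with exponent \<open>1/2 - \<alpha>\<close>, which beats the logarithm.\<close>
    have "(\<lambda>n. (7 * (1 / real n powr (\<alpha> - 1/2)) + 2 * (ln (real n) / real n powr (\<alpha> - 1/2))) / \<epsilon>)
      \<longlonglongrightarrow> (7 * 0 + 2 * 0) / \<epsilon>"
    proof (intro tendsto_intros lim_ln_over_power[OF d])
      show "(\<lambda>n. 1 / real n powr (\<alpha> - 1/2)) \<longlonglongrightarrow> 0"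
        using lim_1_over_real_power[OF d] .
    qed (use assms in auto)
    moreover have "\<forall>\<^sub>F n in sequentially.
      (7 * (1 / real n powr (\<alpha> - 1/2)) + 2 * (ln (real n) / real n powr (\<alpha> - 1/2))) / \<epsilon> = ?b n"
    proof (rule eventually_mono[OF eventually_gt_at_top[of 0]])
      fix n :: nat assume "n > 0"
      then have "real n powr (- \<alpha>) * sqrt n = 1 / real n powr (\<alpha> - 1/2)"
        using powr_add[of "real n" "- \<alpha>" "1/2"] powr_minus_divide[of "real n" "\<alpha> - 1/2"]
        by (simp add: powr_half_sqrt)
      then show "(7 * (1 / real n powr (\<alpha> - 1/2)) + 2 * (ln (real n) / real n powr (\<alpha> - 1/2))) / \<epsilon> = ?b n"
        by (simp add: add_divide_distrib mult.commute)
    qed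
    ultimately have "?b \<longlonglongrightarrow> (7 * 0 + 2 * 0) / \<epsilon>" by (rule Lim_transform_eventually)
    then show ?thesis by simp
  qed
  from tendsto_diff[OF tendsto_const this, of 1] have lower: "(\<lambda>n. 1 - ?b n) \<longlonglongrightarrow> 1" by simp
  show "(\<lambda>n. measure (M n) (?G n)) \<longlonglongrightarrow> 1"
  proof (rule tendsto_sandwich[OF _ _ lower tendsto_const])
    show "\<forall>\<^sub>F n in sequentially. 1 - ?b n \<le> measure (M n) (?G n)"
      using bound(1) by (rule eventually_sequentiallyI)
    show "\<forall>\<^sub>F n in sequentially. measure (M n) (?G n) \<le> 1"
      using bound(2) by (rule eventually_sequentiallyI)
  qed
next
  assume \<alpha>: "\<alpha> = 1/2"
  let ?G = "\<lambda>n. {\<omega> \<in> space (M n). \<exists>C \<in> forest_components {1..n} (tr n \<omega>) (terminal_config (X n) \<omega>).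
                real (card C) > \<epsilon> * real n}"
  let ?K = "\<lambda>D. 4 * (4 * (real D)\<^sup>2 * (4 * 2 ^ D + 2 * mean_defect D))"
  have bound: "measure (M n) (?G n) \<le> (4 / harm D + ?K D / sqrt n) / \<epsilon>\<^sup>2" if "n \<ge> 2" "D > 0" for n D
  proof -
    have cfd: "cayley_fire_dynamics n (real n powr (- \<alpha>)) (M n) (tr n) (X n)" using assms(3) that by simp
    \<comment> \<open>At the critical exponent the bound has no decaying power left; only
      \<open>harm D\<close> can make its main term small.\<close>
    have "real n powr (- \<alpha>) * sqrt n = 1"
      using that powr_add[of "real n" "- (1/2)" "1/2"] unfolding \<alpha> by (simp add: powr_half_sqrt)
    then show ?thesis using large_component_prob_le[OF cfd that(1) _ assms(1) that(2)] that by simp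
  qed
  show "(\<lambda>n. measure (M n) (?G n)) \<longlonglongrightarrow> 0"
  proof (rule LIMSEQ_I)
    fix \<delta> :: real assume \<delta>: "0 < \<delta>"
    have e2: "\<epsilon>\<^sup>2 > 0" using assms by simp
    \<comment> \<open>The value 8 makes \<open>4 / harm D / \<epsilon>\<^sup>2\<close> less than
      half of \<delta>. Only after \<open>D\<close> is fixed is \<open>n\<close> taken large, which
      disposes of the term \<open>?K D / sqrt n\<close>.\<close>
    have "\<forall>\<^sub>F D in sequentially. (harm D :: real) > 8 / (\<delta> * \<epsilon>\<^sup>2)"
      using harm_at_top by (simp add: filterlim_at_top_dense)
    then have "\<forall>\<^sub>F D in sequentially. (harm D :: real) > 8 / (\<delta> * \<epsilon>\<^sup>2) \<and> D > 0"
      using eventually_gt_at_top[of 0] by (rule eventually_conj)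
    then obtain D where D: "(harm D :: real) > 8 / (\<delta> * \<epsilon>\<^sup>2)" "D > 0"
      using eventually_happens'[OF sequentially_bot] by blast
    have h0: "harm D > (0::real)" using D(2) by (simp add: harm_pos)
    have "4 / harm D / \<epsilon>\<^sup>2 < \<delta> / 2" using D(1) \<delta> e2 h0 by (simp add: field_simps)
    have "(\<lambda>n. ?K D / sqrt n) \<longlonglongrightarrow> 0"
      by (intro real_tendsto_divide_at_top[OF tendsto_const] filterlim_compose[OF sqrt_at_top filterlim_real_sequentially])
    then have "\<forall>\<^sub>F n in sequentially. ?K D / sqrt n < \<delta> / 2 * \<epsilon>\<^sup>2"
      using \<delta> e2 by (intro order_tendstoD(2)) auto
    then obtain N :: nat where N: "\<And>n :: nat. n \<ge> N \<Longrightarrow> ?K D / sqrt n < \<delta> / 2 * \<epsilon>\<^sup>2"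
      unfolding eventually_sequentially by blast
    show "\<exists>no. \<forall>n\<ge>no. norm (measure (M n) (?G n) - 0) < \<delta>"
    proof (intro exI allI impI)
      fix n assume n: "n \<ge> max N 2"
      have "?K D / sqrt n < \<delta> / 2 * \<epsilon>\<^sup>2" using N[of n] n by simp
      then have "?K D / sqrt n / \<epsilon>\<^sup>2 < \<delta> / 2" unfolding pos_divide_less_eq[OF e2] .
      with \<open>4 / harm D / \<epsilon>\<^sup>2 < \<delta> / 2\<close> have "(4 / harm D + ?K D / sqrt n) / \<epsilon>\<^sup>2 < \<delta>"
        by (simp add: add_divide_distrib)
      then show "norm (measure (M n) (?G n) - 0) < \<delta>" using bound[of n D] n D(2) by simp
    qed
  qed
qed

end
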